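(* Let $w:\mathbb S^2\times\mathbb S^2\to[0,1]$ be measurable and symmetric. Then \[ \operatorname{Cr}(w)\ \ge\ \frac{(\sin t-t\cos t)^2}{8\pi^2}, \] where $t\in[0,\pi]$ satisfies $\cos t=1-2e(w)$. Moreover, equality is attained by $w(x,y)=\mathbf 1\{d(x,y)\le t\}$.
   Context: $\mathbb S^2\subset\mathbb R^3$ is the unit sphere, $\sigma$ its area measure, $\mu=\sigma/(4\pi)$. $d(x,y)$ is spherical (geodesic) distance, and for non-antipodal $x,y$, $[xy]$ is the shorter great-circle arc joining them. Define $e(w)=\int\int w(x,y)\,\mu(dx)\mu(dy)$ and $\operatorname{Cr}(w)=\int_{(\mathbb S^2)^4} w(x_1,x_2)w(x_3,x_4)\,\mathbf 1\{[x_1x_2]\text{ crosses }[x_3x_4]\}\prod_{i=1}^4\mu(dx_i)$, where "crosses" means the two arcs meet at a point interior to both (degenerate configurations form a null set and are ignored). Equivalently, $\operatorname{Cr}(w)=\mathbb E[w(x_1,x_2)w(x_3,x_4)\mathbf 1\{[x_1x_2]\text{ crosses }[x_3x_4]\}]$ for independent uniform $x_1,\dots,x_4\in\mathbb S^2$. *)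

theory Defs
  imports "HOL-Analysis.Analysis"
begin

abbreviation S2 :: "(real^3) set" where
  "S2 \<equiv> sphere 0 1"

text \<open>Surface area measure on the Borel sets of the unit sphere, given by the cone formula
  (polar coordinates): the area of \<open>A\<close> is three times the volume of the solid cone
  \<open>{r x | 0 < r \<le> 1, x \<in> A}\<close>; see \<open>emeasure_sphere_area\<close> below.\<close>

definition sphere_area :: "(real^3) measure" where
  "sphere_area =
     distr (scale_measure 3 (restrict_space lborel (cball 0 1 - {0})))
           (restrict_space borel S2)
           (\<lambda>x. x /\<^sub>R norm x)"

definition sphere_unif :: "(real^3) measure" where
  "sphere_unif = scale_measure (ennreal (1 / (4 * pi))) sphere_area"

definition sph_dist :: "real^3 \<Rightarrow> real^3 \<Rightarrow> real" where
  "sph_dist x y = arccos (x \<bullet> y)"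

text \<open>The curve \<open>s \<mapsto> cos s x + sin s v\<close>, with \<open>v\<close> a unit tangent vector at \<open>x\<close>, runs along a great
  circle at unit speed. The shorter arc from \<open>x\<close> to \<open>y\<close> is the piece of length \<open>sph_dist x y\<close>
  that ends in \<open>y\<close>. It is only meaningful for non-antipodal \<open>x\<close>, \<open>y\<close>, since otherwise \<open>v\<close> is not
  determined. For \<open>x = y\<close> it is \<open>{x}\<close>.\<close>

definition gc_arc :: "real^3 \<Rightarrow> real^3 \<Rightarrow> (real^3) set" where
  "gc_arc x y = {cos s *\<^sub>R x + sin s *\<^sub>R v | s v.
     norm v = 1 \<and> x \<bullet> v = 0 \<and>
     cos (sph_dist x y) *\<^sub>R x + sin (sph_dist x y) *\<^sub>R v = y \<and>
     0 \<le> s \<and> s \<le> sph_dist x y}"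

definition arc_interior :: "real^3 \<Rightarrow> real^3 \<Rightarrow> (real^3) set" where
  "arc_interior x y = gc_arc x y - {x, y}"

text \<open>Antipodal pairs have no arc, so they never cross anything (a null set of configurations).\<close>

definition arcs_cross :: "real^3 \<Rightarrow> real^3 \<Rightarrow> real^3 \<Rightarrow> real^3 \<Rightarrow> bool" where
  "arcs_cross x1 x2 x3 x4 \<longleftrightarrow>
     x1 \<noteq> - x2 \<and> x3 \<noteq> - x4 \<and> arc_interior x1 x2 \<inter> arc_interior x3 x4 \<noteq> {}"

text \<open>Values of \<open>w\<close> off the sphere are irrelevant.\<close>

definition sym_kernel :: "(real^3 \<Rightarrow> real^3 \<Rightarrow> real) \<Rightarrow> bool" where
  "sym_kernel w \<longleftrightarrow>
     (\<lambda>(x, y). w x y) \<in> borel_measurable (sphere_unif \<Otimes>\<^sub>M sphere_unif) \<and>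
     (\<forall>x\<in>S2. \<forall>y\<in>S2. w x y \<in> {0..1} \<and> w x y = w y x)"

definition edge_density :: "(real^3 \<Rightarrow> real^3 \<Rightarrow> real) \<Rightarrow> real" where
  "edge_density w = (\<integral>x. (\<integral>y. w x y \<partial>sphere_unif) \<partial>sphere_unif)"

definition Cr :: "(real^3 \<Rightarrow> real^3 \<Rightarrow> real) \<Rightarrow> real" where
  "Cr w = (\<integral>(x1, x2, x3, x4). w x1 x2 * w x3 x4 * of_bool (arcs_cross x1 x2 x3 x4)
             \<partial>(sphere_unif \<Otimes>\<^sub>M sphere_unif \<Otimes>\<^sub>M sphere_unif \<Otimes>\<^sub>M sphere_unif))"

lemma normalize_measurable:
  "(\<lambda>x::real^3. x /\<^sub>R norm x) \<in>
     scale_measure 3 (restrict_space lborel (cball 0 1 - {0})) \<rightarrow>\<^sub>M restrict_space borel S2"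
proof -
  have "(\<lambda>x::real^3. x /\<^sub>R norm x) \<in>
     restrict_space lborel (cball 0 1 - {0}) \<rightarrow>\<^sub>M restrict_space borel S2"
    by (rule measurable_restrict_space3) (auto intro!: borel_measurable_scaleR)
  then show ?thesis
    by (simp cong: measurable_cong_sets)
qed

lemma emeasure_sphere_area:
  assumes "A \<in> sets borel" "A \<subseteq> S2"
  shows "emeasure sphere_area A = 3 * emeasure lborel {r *\<^sub>R x | r x. 0 < r \<and> r \<le> 1 \<and> x \<in> A}"
proof -
  have A: "A \<in> sets (restrict_space borel S2)"
    using assms by (simp add: sets_restrict_space_iff)
  have eq: "(\<lambda>x. x /\<^sub>R norm x) -` A \<inter> (cball 0 1 - {0})
      = {r *\<^sub>R x | r x. 0 < r \<and> r \<le> 1 \<and> x \<in> A}" (is "?L = ?R")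
  proof
    show "?L \<subseteq> ?R"
    proof
      fix z assume z: "z \<in> ?L"
      then have "z = norm z *\<^sub>R (z /\<^sub>R norm z)" "0 < norm z" "norm z \<le> 1" "z /\<^sub>R norm z \<in> A"
        by auto
      then show "z \<in> ?R" by blast
    qed
    show "?R \<subseteq> ?L"
      using assms(2) by (auto simp: subset_iff)
  qed
  have "emeasure sphere_area A = 3 * emeasure (restrict_space lborel (cball 0 1 - {0}))
      ((\<lambda>x. x /\<^sub>R norm x) -` A \<inter> (cball 0 1 - {0}))"
    unfolding sphere_area_def
    by (subst emeasure_distr[OF normalize_measurable A]) (simp add: space_restrict_space space_scale_measure)
  also have "\<dots> = 3 * emeasure lborel ((\<lambda>x. x /\<^sub>R norm x) -` A \<inter> (cball 0 1 - {0}))"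
    by (subst emeasure_restrict_space) auto
  finally show ?thesis unfolding eq .
qed

lemma emeasure_sphere_area_space: "emeasure sphere_area S2 = ennreal (4 * pi)"
proof -
  have eq: "{r *\<^sub>R x | r x. 0 < r \<and> r \<le> 1 \<and> x \<in> S2} = cball (0::real^3) 1 - {0}" (is "?L = ?R")
  proof
    show "?R \<subseteq> ?L"
    proof
      fix z :: "real^3" assume z: "z \<in> ?R"
      then have "z = norm z *\<^sub>R (z /\<^sub>R norm z)" "0 < norm z" "norm z \<le> 1" "z /\<^sub>R norm z \<in> S2"
        by auto
      then show "z \<in> ?L" by blast
    qed
  qed auto
  have "emeasure lborel (cball (0::real^3) 1 - {0}) = emeasure lborel (cball (0::real^3) 1)"
    by (intro emeasure_Diff_null_set) (auto intro: null_setsI)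
  also have "\<dots> = ennreal (4 / 3 * pi)"
    by (simp add: emeasure_cball unit_ball_vol_3)
  finally have "emeasure sphere_area S2 = 3 * ennreal (4 / 3 * pi)"
    using emeasure_sphere_area[of S2] unfolding eq by simp
  also have "\<dots> = ennreal (3 * (4 / 3 * pi))"
    by (subst ennreal_mult) auto
  finally show ?thesis by simp
qed

end

theory Submission
  imports Defs
begin

text \<open>
  An arc \<open>[x\<^sub>1x\<^sub>2]\<close> is described by a uniformly random orthonormal frame and a length \<open>\<theta>\<close> with density
  \<open>sin \<theta> / 2\<close>. Let \<open>F(p,\<phi>)\<close> be the total weight (with density \<open>sin \<theta> ds d\<theta>\<close>) of the arcs through \<open>p\<close> in
  direction \<open>\<phi>\<close>. Euler angles and the two-sided invariance of the uniform measure on rotations turn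
  \<open>Cr w\<close> into a constant times the mean over \<open>p\<close> of \<open>\<integral>\<integral> F(p,\<phi>) F(p,\<psi>) \<bar>sin (\<phi> - \<psi>)\<bar>\<close>.

  For fixed \<open>p\<close>, the reverse Hardy-Littlewood-Sobolev (Busemann) inequality bounds the double integral
  from below by \<open>(2/\<pi>\<^sup>2) (\<integral> F\<^sup>2\<^sup>/\<^sup>3)\<^sup>3\<close>, integrating over a half circle; it follows from Hoelder's
  inequality and Santalo's inequality for the body with support function \<open>\<integral> F \<bar>sin\<bar>\<close>. For fixed direction,
  weigh each arc of length \<open>\<theta>\<close> by \<open>1/\<theta>\<close> to get \<open>m(p,\<phi>)\<close>, whose mean is \<open>2 e(w)\<close> since the arc passes
  through its points for total length \<open>\<theta>\<close>. As \<open>0 \<le> w \<le> 1\<close>, the bathtub principle gives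
  \<open>F \<ge> sin r - r cos r\<close> when \<open>m = 1 - cos r\<close>, and \<open>(sin r - r cos r)\<^sup>2\<^sup>/\<^sup>3\<close> is convex as a function of
  \<open>1 - cos r\<close>, so a tangent at \<open>t\<close> can be averaged. All steps are equalities for the caps.
\<close>

text \<open>Let \<open>h\<close> be the convolution of the density \<open>f\<close> with
  \<open>|sin|\<close>. On the circle of length \<open>pi\<close>,
  \<open>|sin|'' + |sin| = 2 delta\<close>, so \<open>h'' + h = 2 f\<close>, and the double
  integral, which is the integral \<open>I\<close> of \<open>f h\<close>, is half the integral of
  \<open>h^2 - h'^2\<close>. Santalo bounds the latter by \<open>pi^2 / T\<close>, where
  \<open>T\<close> is the integral of \<open>1/h^2\<close>. Hoelder is applied to
  \<open>f^(2/3) = (f h)^(2/3) (h^(-2))^(1/3)\<close>; this fixes the exponent 2/3 and the constant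
  \<open>pi^2 / 2\<close>, and thereby which function has to be convex in \<open>1 - cos r\<close>.
  The obstacle is that \<open>e(w)\<close> is only a mean over all points and directions. So the
  cube of the 2/3-integral and the profile are both replaced by their tangents at the cap, which
  makes the bound affine in \<open>m\<close>; the cap itself loses nothing. The constant: the two
  length densities \<open>sin / 2\<close> and the Euler-angle density \<open>1/(16 pi^2)\<close>,
  doubled because great circles meet twice, give \<open>1/(32 pi^2)\<close>. For the cap the weight
  is \<open>psi t\<close> everywhere and \<open>|sin|\<close> has integral 4 over the circle, whence
  \<open>(psi t)^2 / (8 pi^2)\<close>.\<close>

section \<open>Wirtinger inequality and planar Santalo inequality\<close>

text \<open>Since \<open>cot' = - 1 - cot^2\<close>, the expression
  \<open>g'^2 - g^2 - (g^2 cot)'\<close> is the square \<open>(g' - g cot)^2\<close>. The boundary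
  term at \<open>y\<close> is kept because \<open>g y\<close> need not vanish;
  \<open>wirtinger_antiperiodic\<close> cancels two such terms against each other.\<close>

lemma wirtinger_right:
  fixes g g' :: "real \<Rightarrow> real"
  assumes zy: "z < y" "y < z + pi"
    and g: "\<And>x. x \<in> {z..y} \<Longrightarrow> (g has_real_derivative g' x) (at x within {z..y})"
    and g': "continuous_on {z..y} g'" and "g z = 0"
  shows "integral {z..y} (\<lambda>x. (g x)\<^sup>2) + (g y)\<^sup>2 * cot (y - z) \<le> integral {z..y} (\<lambda>x. (g' x)\<^sup>2)"
proof -
  have cg: "continuous_on {z..y} g"
    using g by (meson DERIV_continuous_on)
  let ?I = "integral {z..y} (\<lambda>x. (g' x)\<^sup>2) - integral {z..y} (\<lambda>x. (g x)\<^sup>2)"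
  \<comment> \<open>The shift \<open>d\<close> moves the pole of \<open>cot\<close> off the
    interval, and its upper limit keeps \<open>x - z + d\<close> below \<open>pi\<close>;
    \<open>g z = 0\<close> removes the lower boundary term for every \<open>d\<close>.\<close>
  have le: "(g y)\<^sup>2 * cot (y - z + d) \<le> ?I" if d: "0 < d" "d < z + pi - y" for d
  proof -
    let ?D = "\<lambda>x. 2 * g x * g' x * cot (x - z + d) - (g x)\<^sup>2 * inverse ((sin (x - z + d))\<^sup>2)"
    have s: "sin (x - z + d) > 0" if "x \<in> {z..y}" for x
      using that d by (intro sin_gt_zero) auto
    have "(?D has_integral (g y)\<^sup>2 * cot (y - z + d) - (g z)\<^sup>2 * cot (z - z + d)) {z..y}"
    proof (rule fundamental_theorem_of_calculus)
      fix x assume x: "x \<in> {z..y}"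
      show "((\<lambda>x. (g x)\<^sup>2 * cot (x - z + d)) has_vector_derivative ?D x) (at x within {z..y})"
        unfolding has_real_derivative_iff_has_vector_derivative[symmetric]
        using s[OF x]
        by (auto intro!: derivative_eq_intros g[OF x] DERIV_chain'[OF _ DERIV_cot] simp: power2_eq_square)
    qed (use zy in auto)
    then have D: "(?D has_integral (g y)\<^sup>2 * cot (y - z + d)) {z..y}"
      using \<open>g z = 0\<close> by simp
    have "(g y)\<^sup>2 * cot (y - z + d) = integral {z..y} ?D"
      using D by (simp add: integral_unique)
    also have "\<dots> \<le> integral {z..y} (\<lambda>x. (g' x)\<^sup>2 - (g x)\<^sup>2)"
    proof (rule integral_le)
      show "?D integrable_on {z..y}"
        using D by blast
      show "(\<lambda>x. (g' x)\<^sup>2 - (g x)\<^sup>2) integrable_on {z..y}"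
        by (intro integrable_continuous_real continuous_intros cg g')
      fix x assume x: "x \<in> {z..y}"
      have "inverse ((sin (x - z + d))\<^sup>2) = 1 + (cot (x - z + d))\<^sup>2"
        using s[OF x] sin_cos_squared_add[of "x - z + d"]
        by (simp add: cot_def field_simps)
      then have "(g' x)\<^sup>2 - (g x)\<^sup>2 - ?D x = (g' x - g x * cot (x - z + d))\<^sup>2"
        by (simp add: power2_eq_square algebra_simps)
      then show "?D x \<le> (g' x)\<^sup>2 - (g x)\<^sup>2"
        by (smt (verit) zero_le_power2)
    qed
    also have "\<dots> = ?I"
      by (intro integral_diff integrable_continuous_real continuous_intros cg g')
    finally show ?thesis .
  qed
  have "((\<lambda>d. (g y)\<^sup>2 * cot (y - z + d)) \<longlongrightarrow> (g y)\<^sup>2 * cot (y - z + 0)) (at_right 0)"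
    using zy sin_gt_zero[of "y - z"] by (intro tendsto_intros) auto
  moreover have "\<forall>\<^sub>F d in at_right 0. (g y)\<^sup>2 * cot (y - z + d) \<le> ?I"
    using zy by (auto simp: eventually_at_right[of 0 "z + pi - y"] intro!: exI[of _ "z + pi - y"] le)
  ultimately have "(g y)\<^sup>2 * cot (y - z + 0) \<le> ?I"
    by (intro tendsto_upperbound) auto
  then show ?thesis by simp
qed

lemma wirtinger_left:
  fixes g g' :: "real \<Rightarrow> real"
  assumes zy: "y < z" "z < y + pi"
    and g: "\<And>x. x \<in> {y..z} \<Longrightarrow> (g has_real_derivative g' x) (at x within {y..z})"
    and g': "continuous_on {y..z} g'" and "g z = 0"
  shows "integral {y..z} (\<lambda>x. (g x)\<^sup>2) + (g y)\<^sup>2 * cot (z - y) \<le> integral {y..z} (\<lambda>x. (g' x)\<^sup>2)"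
proof -
  have im: "uminus ` {-z..-y} = {y..z}"
    by (simp add: image_uminus_atLeastAtMost)
  have "integral {-z..-y} (\<lambda>x. (g (- x))\<^sup>2) + (g (- (- y)))\<^sup>2 * cot (- y - (- z))
      \<le> integral {-z..-y} (\<lambda>x. (- g' (- x))\<^sup>2)"
  proof (rule wirtinger_right)
    fix x assume x: "x \<in> {-z..-y}"
    have "((\<lambda>x. g (- x)) has_real_derivative g' (- x) * (- 1)) (at x within {-z..-y})"
    proof (rule DERIV_image_chain[where f = g and g = uminus, unfolded o_def])
      show "(uminus has_real_derivative - 1) (at x within {-z..-y})"
        by (auto intro!: derivative_eq_intros)
      show "(g has_real_derivative g' (- x)) (at (- x) within uminus ` {-z..-y})"
        unfolding im using x by (intro g) auto
    qed
    then show "((\<lambda>x. g (- x)) has_real_derivative - g' (- x)) (at x within {-z..-y})"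
      by simp
  next
    have "continuous_on {-z..-y} (\<lambda>x. g' (- x))"
      by (rule continuous_on_compose2[OF g']) (auto intro: continuous_intros)
    then show "continuous_on {-z..-y} (\<lambda>x. - g' (- x))"
      by (rule continuous_on_minus)
  qed (use assms in auto)
  then show ?thesis
    using Henstock_Kurzweil_Integration.integral_reflect_real[of z y "\<lambda>x. (g x)\<^sup>2"]
      Henstock_Kurzweil_Integration.integral_reflect_real[of z y "\<lambda>x. (g' x)\<^sup>2"]
    by simp
qed

text \<open>Antiperiodicity forces a zero \<open>z\<close>. Cutting there leaves the boundary terms
  \<open>(g 0)^2 cot z\<close> and \<open>(g pi)^2 cot (pi - z)\<close>, which cancel.\<close>

lemma wirtinger_antiperiodic:
  fixes g g' :: "real \<Rightarrow> real"
  assumes g: "\<And>x. x \<in> {0..pi} \<Longrightarrow> (g has_real_derivative g' x) (at x within {0..pi})"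
    and g': "continuous_on {0..pi} g'" and anti: "g pi = - g 0"
  shows "integral {0..pi} (\<lambda>x. (g x)\<^sup>2) \<le> integral {0..pi} (\<lambda>x. (g' x)\<^sup>2)"
proof -
  have cg: "continuous_on {0..pi} g"
    using g by (meson DERIV_continuous_on)
  have sub: "(g has_real_derivative g' x) (at x within {a..b})"
    if "0 \<le> a" "b \<le> pi" "x \<in> {a..b}" for a b x
    using that by (auto intro: has_field_derivative_subset[OF g[of x]])
  have sub': "continuous_on {a..b} g'" if "0 \<le> a" "b \<le> pi" for a b
    using that by (auto intro: continuous_on_subset[OF g'])
  have split: "integral {0..pi} f = integral {0..c} f + integral {c..pi} f"
    if "0 \<le> c" "c \<le> pi" "continuous_on {0..pi} f" for c and f :: "real \<Rightarrow> real"
    using Henstock_Kurzweil_Integration.integral_combine[OF that(1,2) integrable_continuous_real[OF that(3)]] by simp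
  have c2: "continuous_on {0..pi} (\<lambda>x. (g x)\<^sup>2)" "continuous_on {0..pi} (\<lambda>x. (g' x)\<^sup>2)"
    by (intro continuous_intros cg g')+
  show ?thesis
  proof (cases "g 0 = 0")
    case True
    \<comment> \<open>Here both ends are zeros, at distance exactly \<open>pi\<close>, which the
      one-sided lemmas exclude; the extra cut at \<open>pi/2\<close> is harmless because
      \<open>cot (pi/2) = 0\<close>.\<close>
    have "integral {0..pi/2} (\<lambda>x. (g x)\<^sup>2) + (g (pi/2))\<^sup>2 * cot (pi/2 - 0) \<le> integral {0..pi/2} (\<lambda>x. (g' x)\<^sup>2)"
      using True by (intro wirtinger_right sub sub') auto
    moreover have "integral {pi/2..pi} (\<lambda>x. (g x)\<^sup>2) + (g (pi/2))\<^sup>2 * cot (pi - pi/2) \<le> integral {pi/2..pi} (\<lambda>x. (g' x)\<^sup>2)"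
      using True anti by (intro wirtinger_left sub sub') auto
    ultimately show ?thesis
      using split[of "pi/2"] c2 by (simp add: cot_def)
  next
    case False
    have "\<exists>z\<ge>0. z \<le> pi \<and> g z = 0"
    proof (cases "g 0 < 0")
      case True
      then show ?thesis using anti cg by (intro IVT') auto
    next
      case False
      then show ?thesis using anti cg by (intro IVT2') auto
    qed
    then obtain z where z: "0 \<le> z" "z \<le> pi" "g z = 0" by blast
    with False anti have z': "0 < z" "z < pi"
      by (auto simp: less_le)
    have "integral {0..z} (\<lambda>x. (g x)\<^sup>2) + (g 0)\<^sup>2 * cot (z - 0) \<le> integral {0..z} (\<lambda>x. (g' x)\<^sup>2)"
      using z z' by (intro wirtinger_left sub sub') auto
    moreover have "integral {z..pi} (\<lambda>x. (g x)\<^sup>2) + (g pi)\<^sup>2 * cot (pi - z) \<le> integral {z..pi} (\<lambda>x. (g' x)\<^sup>2)"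
      using z z' by (intro wirtinger_right sub sub') auto
    moreover have "cot (pi - z) = - cot z"
      by (simp add: cot_def)
    ultimately show ?thesis
      using split[of z] z c2 anti by simp
  qed
qed

text \<open>Santalo's inequality for the planar convex body with support function \<open>h\<close>, from the
  Wirtinger inequality for the two coordinates of the curve \<open>h e\<^sup>i\<^sup>\<tau>\<close>, where \<open>\<tau>' = \<pi> / (T h\<^sup>2)\<close>.\<close>

lemma santalo_support:
  fixes h h' :: "real \<Rightarrow> real"
  assumes h: "\<And>x. x \<in> {0..pi} \<Longrightarrow> (h has_real_derivative h' x) (at x within {0..pi})"
    and h': "continuous_on {0..pi} h'" and per: "h pi = h 0"
    and pos: "\<And>x. x \<in> {0..pi} \<Longrightarrow> h x > 0"
  defines "T \<equiv> integral {0..pi} (\<lambda>x. 1 / (h x)\<^sup>2)"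
  shows "T > 0" "integral {0..pi} (\<lambda>x. (h x)\<^sup>2 - (h' x)\<^sup>2) \<le> pi\<^sup>2 / T"
proof -
  have ch: "continuous_on {0..pi} h"
    using h by (meson DERIV_continuous_on)
  have ne: "\<forall>x\<in>{0..pi}. h x \<noteq> 0"
    using pos by force
  have ci: "continuous_on {0..pi} (\<lambda>x. 1 / (h x)\<^sup>2)"
    using ne by (intro continuous_intros ch) auto
  show T: "T > 0"
  proof -
    have "T \<ge> 0"
      unfolding T_def by (intro integral_nonneg integrable_continuous_real ci) auto
    moreover have "T \<noteq> 0"
    proof
      assume "T = 0"
      then have "((\<lambda>x. 1 / (h x)\<^sup>2) has_integral 0) (cbox 0 pi)"
        unfolding T_def using integrable_integral[OF integrable_continuous_real[OF ci]] by simp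
      from has_integral_0_cbox_imp_0[OF _ _ this, of 0] ci ne[rule_format, of 0] pi_gt_zero show False
        by (simp add: box_real zero_le_divide_iff)
    qed
    ultimately show ?thesis by simp
  qed
  \<comment> \<open>By Cauchy-Schwarz this choice minimises the integral of
    \<open>h^2 \<tau>'^2\<close> among all time changes of total increase \<open>pi\<close>, with
    minimum \<open>pi^2 / T\<close>. The total \<open>pi\<close> makes \<open>h cos \<tau>\<close>
    and \<open>h sin \<tau>\<close> antiperiodic although \<open>h\<close> has equal end
    values.\<close>
  define \<tau> where "\<tau> x = pi / T * integral {0..x} (\<lambda>x. 1 / (h x)\<^sup>2)" for x
  have \<tau>: "(\<tau> has_real_derivative pi / T * (1 / (h x)\<^sup>2)) (at x within {0..pi})" if "x \<in> {0..pi}" for x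
    unfolding \<tau>_def
    by (intro DERIV_cmult integral_has_real_derivative ci that)
  have \<tau>_0: "\<tau> 0 = 0" and \<tau>_pi: "\<tau> pi = pi"
    using T by (simp_all add: \<tau>_def T_def[symmetric])
  have ct: "continuous_on {0..pi} \<tau>"
    using \<tau> by (meson DERIV_continuous_on)
  let ?a = "\<lambda>x. h x * cos (\<tau> x)" and ?a' = "\<lambda>x. h' x * cos (\<tau> x) - pi / T / h x * sin (\<tau> x)"
  let ?b = "\<lambda>x. h x * sin (\<tau> x)" and ?b' = "\<lambda>x. h' x * sin (\<tau> x) + pi / T / h x * cos (\<tau> x)"
  have a: "integral {0..pi} (\<lambda>x. (?a x)\<^sup>2) \<le> integral {0..pi} (\<lambda>x. (?a' x)\<^sup>2)"
  proof (rule wirtinger_antiperiodic)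
    fix x assume x: "x \<in> {0..pi}"
    show "(?a has_real_derivative ?a' x) (at x within {0..pi})"
      using pos[OF x] by (auto intro!: derivative_eq_intros h[OF x] \<tau>[OF x] simp: field_simps power2_eq_square)
  qed (use ne in \<open>auto intro!: continuous_intros ch h' ct simp: \<tau>_0 \<tau>_pi per T[THEN less_imp_neq, symmetric]\<close>)
  have b: "integral {0..pi} (\<lambda>x. (?b x)\<^sup>2) \<le> integral {0..pi} (\<lambda>x. (?b' x)\<^sup>2)"
  proof (rule wirtinger_antiperiodic)
    fix x assume x: "x \<in> {0..pi}"
    show "(?b has_real_derivative ?b' x) (at x within {0..pi})"
      using pos[OF x] by (auto intro!: derivative_eq_intros h[OF x] \<tau>[OF x] simp: field_simps power2_eq_square)
  qed (use ne in \<open>auto intro!: continuous_intros ch h' ct simp: \<tau>_0 \<tau>_pi per T[THEN less_imp_neq, symmetric]\<close>)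
  have i: "f integrable_on {0..pi}" if "continuous_on {0..pi} f" for f :: "real \<Rightarrow> real"
    using that by (rule integrable_continuous_real)
  have "integral {0..pi} (\<lambda>x. (h x)\<^sup>2) = integral {0..pi} (\<lambda>x. (?a x)\<^sup>2 + (?b x)\<^sup>2)"
    by (intro integral_cong) (simp add: power_mult_distrib distrib_left[symmetric])
  also have "\<dots> = integral {0..pi} (\<lambda>x. (?a x)\<^sup>2) + integral {0..pi} (\<lambda>x. (?b x)\<^sup>2)"
    by (intro integral_add i continuous_intros ch ct)
  also have "\<dots> \<le> integral {0..pi} (\<lambda>x. (?a' x)\<^sup>2) + integral {0..pi} (\<lambda>x. (?b' x)\<^sup>2)"
    using a b by simp
  also have "\<dots> = integral {0..pi} (\<lambda>x. (?a' x)\<^sup>2 + (?b' x)\<^sup>2)"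
    by (intro integral_add[symmetric] i continuous_intros ch ct h' ne)
  \<comment> \<open>Squared speed of the curve \<open>h e^(i \<tau>)\<close>: a radial part
    \<open>h'^2\<close> and an angular part \<open>(h \<tau>')^2\<close>, where
    \<open>h \<tau>' = pi / (T h)\<close>.\<close>
  also have "\<dots> = integral {0..pi} (\<lambda>x. (h' x)\<^sup>2 + (pi / T)\<^sup>2 * (1 / (h x)\<^sup>2))"
  proof (intro integral_cong)
    fix x
    have "(p * c - q * s)\<^sup>2 + (p * s + q * c)\<^sup>2 = (p\<^sup>2 + q\<^sup>2) * (s\<^sup>2 + c\<^sup>2)" for p q s c :: real
      by algebra
    then have "(?a' x)\<^sup>2 + (?b' x)\<^sup>2 = ((h' x)\<^sup>2 + (pi / T / h x)\<^sup>2) * ((sin (\<tau> x))\<^sup>2 + (cos (\<tau> x))\<^sup>2)"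
      .
    then show "(?a' x)\<^sup>2 + (?b' x)\<^sup>2 = (h' x)\<^sup>2 + (pi / T)\<^sup>2 * (1 / (h x)\<^sup>2)"
      by (simp add: power_divide power_mult_distrib)
  qed
  also have "\<dots> = integral {0..pi} (\<lambda>x. (h' x)\<^sup>2) + (pi / T)\<^sup>2 * T"
  proof -
    have "integral {0..pi} (\<lambda>x. (h' x)\<^sup>2 + (pi / T)\<^sup>2 * (1 / (h x)\<^sup>2))
        = integral {0..pi} (\<lambda>x. (h' x)\<^sup>2) + integral {0..pi} (\<lambda>x. (pi / T)\<^sup>2 * (1 / (h x)\<^sup>2))"
      by (intro integral_add i continuous_on_mult continuous_on_const continuous_on_power h' ci)
    also have "integral {0..pi} (\<lambda>x. (pi / T)\<^sup>2 * (1 / (h x)\<^sup>2)) = (pi / T)\<^sup>2 * T"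
      unfolding T_def by (rule integral_mult_right)
    finally show ?thesis .
  qed
  finally have "integral {0..pi} (\<lambda>x. (h x)\<^sup>2) - integral {0..pi} (\<lambda>x. (h' x)\<^sup>2) \<le> pi\<^sup>2 / T"
    using T by (simp add: power2_eq_square)
  then show "integral {0..pi} (\<lambda>x. (h x)\<^sup>2 - (h' x)\<^sup>2) \<le> pi\<^sup>2 / T"
    by (subst integral_diff) (auto intro!: i continuous_intros h' ch)
qed

section \<open>Lebesgue measure on an interval\<close>

text \<open>Kept as a measure on the whole line, so that measurability is plain Borel measurability
  and the restriction to the interval enters through \<open>AE_seg\<close>; for \<open>b < a\<close>
  it is the zero measure.\<close>

definition seg :: "real \<Rightarrow> real \<Rightarrow> real measure" where
  "seg a b = density lborel (indicator {a..b})"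

lemma sets_seg [measurable_cong, simp]: "sets (seg a b) = sets borel"
  by (simp add: seg_def)

lemma space_seg [simp]: "space (seg a b) = UNIV"
  by (simp add: seg_def)

lemma nn_integral_seg:
  assumes [measurable]: "f \<in> borel_measurable borel"
  shows "(\<integral>\<^sup>+x. f x \<partial>seg a b) = (\<integral>\<^sup>+x. f x * indicator {a..b} x \<partial>lborel)"
  unfolding seg_def by (subst nn_integral_density) (auto simp: mult.commute)

lemma emeasure_seg:
  assumes [measurable]: "A \<in> sets borel"
  shows "emeasure (seg a b) A = emeasure lborel (A \<inter> {a..b})"
  unfolding seg_def
  by (subst emeasure_density) (auto simp: indicator_inter_arith[symmetric] Int_commute)

lemma finite_measure_seg [simp]: "finite_measure (seg a b)"
  by (intro finite_measureI) (auto simp: emeasure_seg emeasure_lborel_Icc_eq)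

lemmas borel_measurable_integral_seg [measurable (raw)] =
  sigma_finite_measure.borel_measurable_lebesgue_integral[OF finite_measure.axioms(1)[OF finite_measure_seg]]
  and borel_measurable_nn_integral_seg [measurable (raw)] =
  sigma_finite_measure.borel_measurable_nn_integral[OF finite_measure.axioms(1)[OF finite_measure_seg]]

lemma AE_seg: "AE x in seg a b. x \<in> {a..b}"
  unfolding seg_def by (subst AE_density) (auto simp: indicator_def)

lemma integral_seg:
  fixes f :: "real \<Rightarrow> real"
  assumes [measurable]: "f \<in> borel_measurable borel"
  shows "(\<integral>x. f x \<partial>seg a b) = (\<integral>x\<in>{a..b}. f x \<partial>lborel)"
proof -
  have "seg a b = density lborel (\<lambda>x. ennreal (indicator {a..b} x))"
    unfolding seg_def by (intro density_cong) (auto simp: indicator_def)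
  then show ?thesis
    by (simp add: integral_density set_lebesgue_integral_def)
qed

lemma integral_seg_eq:
  fixes f :: "real \<Rightarrow> real"
  assumes [measurable]: "f \<in> borel_measurable borel" and "(f has_integral I) {a..b}"
    and "\<And>x. x \<in> {a..b} \<Longrightarrow> \<bar>f x\<bar> \<le> M"
  shows "(\<integral>x. f x \<partial>seg a b) = I"
proof -
  have "set_integrable lborel {a..b} f"
    unfolding set_integrable_def
    by (rule integrableI_bounded_set_indicator[where B=M])
        (use assms(3) in \<open>auto simp: emeasure_lborel_Icc_eq\<close>)
  from set_borel_integral_eq_integral[OF this] assms(2) show ?thesis
    by (simp add: integral_seg integral_unique)
qed

lemma integrable_seg:
  fixes f :: "real \<Rightarrow> real"
  assumes [measurable]: "f \<in> borel_measurable borel" and "\<And>x. x \<in> {a..b} \<Longrightarrow> \<bar>f x\<bar> \<le> M"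
  shows "integrable (seg a b) f"
  by (rule finite_measure.integrable_const_bound[where B=M])
    (use assms AE_seg[of a b] in \<open>auto elim!: AE_mp\<close>)

lemma measure_seg_between: "measure (seg a b) {min x y..max x y} \<le> \<bar>y - x\<bar>"
proof -
  have "emeasure (seg a b) {min x y..max x y} \<le> emeasure lborel {min x y..max x y}"
    by (subst emeasure_seg[OF borel_closed[OF closed_atLeastAtMost]]) (rule emeasure_mono, auto)
  also have "\<dots> = ennreal (max x y - min x y)"
    by (simp add: emeasure_lborel_Icc_eq)
  also have "max x y - min x y = \<bar>y - x\<bar>"
    by auto
  finally have "emeasure (seg a b) {min x y..max x y} \<le> ennreal \<bar>y - x\<bar>" .
  then show ?thesis
    by (simp add: measure_def enn2real_leI)
qed

section \<open>The kernel \<open>|sin (x - u)|\<close> and its kink\<close>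

text \<open>The derivative of \<open>\<bar>sin\<bar>\<close> at \<open>x - u\<close> for \<open>x, u\<close> in \<open>[0, \<pi>]\<close>.\<close>

definition dsin :: "real \<Rightarrow> real \<Rightarrow> real" where
  "dsin x u = (if u \<le> x then cos (x - u) else - cos (x - u))"

lemma dsin_measurable [measurable (raw)]:
  assumes [measurable]: "g \<in> borel_measurable M" "h \<in> borel_measurable M"
  shows "(\<lambda>x. dsin (g x) (h x)) \<in> borel_measurable M"
  unfolding dsin_def by measurable

lemma abs_dsin_le: "\<bar>dsin x u\<bar> \<le> 1"
  by (simp add: dsin_def)

lemma sin_lipschitz: "\<bar>sin b - sin a\<bar> \<le> \<bar>b - a\<bar>" for a b :: real
proof -
  have "sin b - sin a = 2 * sin ((b - a) / 2) * cos ((b + a) / 2)"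
    by (simp add: sin_diff_sin)
  then have "\<bar>sin b - sin a\<bar> \<le> 2 * \<bar>sin ((b - a) / 2)\<bar>"
    by (simp add: abs_mult mult_left_le)
  also have "\<dots> \<le> \<bar>b - a\<bar>"
    using abs_sin_x_le_abs_x[of "(b - a) / 2"] by simp
  finally show ?thesis .
qed

lemma cos_lipschitz: "\<bar>cos b - cos a\<bar> \<le> \<bar>b - a\<bar>" for a b :: real
  using sin_lipschitz[of "pi/2 - b" "pi/2 - a"] by (simp add: sin_diff)

lemma sin_taylor: "\<bar>sin b - sin a - (b - a) * cos a\<bar> \<le> (b - a)\<^sup>2" for a b :: real
proof -
  define g where "g x = sin x - x * cos a" for x
  have "\<bar>g b - g a\<bar> \<le> \<bar>b - a\<bar> * \<bar>b - a\<bar>"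
  proof -
    have "norm (g b - g a) \<le> \<bar>b - a\<bar> * norm (b - a)"
    proof (rule field_differentiable_bound[where S = "{min a b..max a b}" and f' = "\<lambda>x. cos x - cos a"])
      fix x assume "x \<in> {min a b..max a b}"
      then show "norm (cos x - cos a) \<le> \<bar>b - a\<bar>"
        using cos_lipschitz[of x a] by (auto simp: min_def max_def split: if_splits)
      show "(g has_real_derivative cos x - cos a) (at x within {min a b..max a b})"
        unfolding g_def by (auto intro!: derivative_eq_intros)
    qed auto
    then show ?thesis by simp
  qed
  then show ?thesis
    by (simp add: g_def power2_eq_square abs_mult[symmetric] algebra_simps)
qed

text \<open>The remainder is quadratic unless the kink \<open>u\<close> lies between
  \<open>x\<close> and \<open>y\<close>. There it is only of first order, but those \<open>u\<close>
  fill an interval of length \<open>|y - x|\<close>, so the integral over \<open>u\<close> is again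
  quadratic.\<close>

lemma abs_sin_diff_taylor:
  assumes "x \<in> {0..pi}" "y \<in> {0..pi}" "u \<in> {0..pi}"
  shows "\<bar>\<bar>sin (y - u)\<bar> - \<bar>sin (x - u)\<bar> - (y - x) * dsin x u\<bar>
    \<le> (y - x)\<^sup>2 + 2 * \<bar>y - x\<bar> * indicator {min x y..max x y} u"
proof -
  have pos: "\<bar>sin (v - u)\<bar> = sin (v - u)" if "u \<le> v" "v \<in> {0..pi}" for v
    using that assms by (intro abs_of_nonneg sin_ge_zero) auto
  have neg: "\<bar>sin (v - u)\<bar> = - sin (v - u)" if "v \<le> u" "v \<in> {0..pi}" for v
    using that assms sin_ge_zero[of "u - v"] sin_minus[of "u - v"] by auto
  consider "u < x \<and> u < y" | "x < u \<and> y < u" | "u \<in> {min x y..max x y}"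
    by fastforce
  then show ?thesis
  proof cases
    case 1
    then show ?thesis
      using sin_taylor[of "y - u" "x - u"] assms by (auto simp: pos dsin_def indicator_def)
  next
    case 2
    then show ?thesis
      using sin_taylor[of "y - u" "x - u"] assms neg[of x] neg[of y]
      by (simp add: dsin_def indicator_def) (smt (verit))
  next
    case 3
    have "\<bar>\<bar>sin (y - u)\<bar> - \<bar>sin (x - u)\<bar>\<bar> \<le> \<bar>y - x\<bar>"
      using sin_lipschitz[of "y - u" "x - u"] by linarith
    moreover have "\<bar>(y - x) * dsin x u\<bar> \<le> \<bar>y - x\<bar>"
      using abs_dsin_le[of x u] by (simp add: abs_mult mult_left_le)
    ultimately show ?thesis
      using 3 by (simp add: abs_le_iff) (smt (verit) zero_le_power2)
  qed
qed

lemma dsin_lipschitz: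
  "\<bar>dsin y u - dsin x u\<bar> \<le> \<bar>y - x\<bar> + 2 * indicator {min x y..max x y} u"
proof (cases "u \<in> {min x y..max x y}")
  case True
  then show ?thesis
    using abs_dsin_le[of x u] abs_dsin_le[of y u] by simp
next
  case False
  then show ?thesis
    using cos_lipschitz[of "y - u" "x - u"] by (auto simp: dsin_def min_def max_def split: if_splits)
qed

text \<open>Weak form of \<open>|sin|'' + |sin| = 2 delta\<close> on the circle of length
  \<open>pi\<close>: formally, integrating the second product by parts leaves
  \<open>|sin (x - u)|\<close> paired with \<open>2 delta\<close> at \<open>v\<close>.\<close>

lemma integral_sin_sin_minus_dsin_dsin:
  assumes "u \<in> {0..pi}" "v \<in> {0..pi}"
  shows "(\<integral>x. \<bar>sin (x - u)\<bar> * \<bar>sin (x - v)\<bar> - dsin x u * dsin x v \<partial>seg 0 pi) = 2 * \<bar>sin (u - v)\<bar>"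
proof -
  let ?k = "\<lambda>u v x. \<bar>sin (x - u)\<bar> * \<bar>sin (x - v)\<bar> - dsin x u * dsin x v"
  have le: "(\<integral>x. ?k u v x \<partial>seg 0 pi) = 2 * sin (v - u)"
    if uv: "u \<in> {0..pi}" "v \<in> {0..pi}" "u \<le> v" for u v
  proof (rule integral_seg_eq)
    let ?c = "\<lambda>x. cos (2 * x - u - v)" and ?s = "\<lambda>x. sin (2 * x - u - v) / 2"
    have pos: "\<bar>sin (y - z)\<bar> = sin (y - z)" if "z \<le> y" "y \<in> {0..pi}" "z \<in> {0..pi}" for y z
      using that by (intro abs_of_nonneg sin_ge_zero) auto
    have neg: "\<bar>sin (y - z)\<bar> = - sin (y - z)" if "y \<le> z" "y \<in> {0..pi}" "z \<in> {0..pi}" for y z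
      using that sin_ge_zero[of "z - y"] sin_minus[of "z - y"] by auto
    have c: "?c x = cos (x - u) * cos (x - v) - sin (x - u) * sin (x - v)" for x
      using cos_add[of "x - u" "x - v"] by (simp add: algebra_simps)
    have i: "(?c has_integral ?s b - ?s a) {a..b}" if "a \<le> b" for a b
      using that by (intro fundamental_theorem_of_calculus)
        (auto intro!: derivative_eq_intros simp: has_real_derivative_iff_has_vector_derivative[symmetric])
    \<comment> \<open>The integrand is \<open>- ?c\<close> where \<open>u\<close> and
      \<open>v\<close> lie on the same side of \<open>x\<close>, and \<open>?c\<close> between them;
      \<open>?s\<close> is a primitive of \<open>?c\<close>.\<close>
    have 1: "(?k u v has_integral - (?s u - ?s 0)) {0..u}"
      by (rule has_integral_spike_finite[where S = "{u}", OF _ _ has_integral_neg[OF i]])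
        (use uv in \<open>auto simp: c neg dsin_def\<close>)
    have 2: "(?k u v has_integral (?s v - ?s u)) {u..v}"
      by (rule has_integral_spike_finite[where S = "{u, v}", OF _ _ i])
        (use uv in \<open>auto simp: c neg pos dsin_def\<close>)
    have 3: "(?k u v has_integral - (?s pi - ?s v)) {v..pi}"
      by (rule has_integral_spike_finite[where S = "{}", OF _ _ has_integral_neg[OF i]])
        (use uv in \<open>auto simp: c pos dsin_def\<close>)
    have "(?k u v has_integral - (?s u - ?s 0) + (?s v - ?s u) - (?s pi - ?s v)) {0..pi}"
      using has_integral_combine[OF _ _ has_integral_combine[OF _ _ 1 2] 3] uv by auto
    moreover have "- (?s u - ?s 0) + (?s v - ?s u) - (?s pi - ?s v) = 2 * sin (v - u)"
    proof -
      have "2 * pi - u - v = - (u + v) + 2 * pi" "0 * 2 - u - v = - (u + v)"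
        by auto
      then have "sin (2 * pi - u - v) = - sin (u + v)" "sin (2 * 0 - u - v) = - sin (u + v)"
        by (metis sin_periodic sin_minus, metis mult.commute sin_minus)
      moreover have "sin (2 * u - u - v) = - sin (v - u)"
        using sin_minus[of "v - u"] by simp
      ultimately show ?thesis
        by (simp add: field_simps)
    qed
    ultimately show "(?k u v has_integral 2 * sin (v - u)) {0..pi}" by simp
    show "\<bar>?k u v x\<bar> \<le> 2" for x
    proof -
      have "\<bar>\<bar>sin (x - u)\<bar> * \<bar>sin (x - v)\<bar>\<bar> \<le> 1 * 1" "\<bar>dsin x u * dsin x v\<bar> \<le> 1 * 1"
        unfolding abs_mult by (intro mult_mono; simp add: abs_dsin_le)+
      then show ?thesis by linarith
    qed
  qed measurable
  show ?thesis
  proof (cases "u \<le> v")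
    case True
    moreover have "\<bar>sin (u - v)\<bar> = sin (v - u)"
      using True assms sin_ge_zero[of "v - u"] sin_minus[of "v - u"] by auto
    ultimately show ?thesis using le[of u v] assms by simp
  next
    case False
    moreover have "\<bar>sin (u - v)\<bar> = sin (u - v)"
      using False assms sin_ge_zero[of "u - v"] by auto
    ultimately show ?thesis using le[of v u] assms by (simp add: mult.commute)
  qed
qed

lemma has_real_derivative_quadratic:
  fixes h :: "real \<Rightarrow> real"
  assumes "\<And>y. y \<in> S \<Longrightarrow> \<bar>h y - h x - (y - x) * d\<bar> \<le> C * (y - x)\<^sup>2"
  shows "(h has_real_derivative d) (at x within S)"
  unfolding has_field_derivative_iff
proof (rule LIM_zero_cancel, rule tendsto_0_le[where K = 1])
  show "((\<lambda>y. C * (y - x)) \<longlongrightarrow> 0) (at x within S)"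
    by (auto intro!: tendsto_eq_intros)
  have "norm ((h y - h x) / (y - x) - d) \<le> norm (C * (y - x)) * 1" if "y \<in> S" "y \<noteq> x" for y
  proof -
    have "\<bar>(h y - h x) / (y - x) - d\<bar> = \<bar>h y - h x - (y - x) * d\<bar> / \<bar>y - x\<bar>"
      using that by (simp add: abs_divide[symmetric] diff_divide_distrib)
    also have "\<dots> \<le> C * (y - x)\<^sup>2 / \<bar>y - x\<bar>"
      by (intro divide_right_mono assms that) auto
    also have "(y - x)\<^sup>2 = \<bar>y - x\<bar> * \<bar>y - x\<bar>"
      by (simp add: power2_eq_square)
    also have "C * (\<bar>y - x\<bar> * \<bar>y - x\<bar>) / \<bar>y - x\<bar> \<le> \<bar>C * (y - x)\<bar>"
    proof -
      have "C * (\<bar>y - x\<bar> * \<bar>y - x\<bar>) / \<bar>y - x\<bar> = C * \<bar>y - x\<bar>"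
        using that by (simp only: mult.assoc[symmetric]) simp
      also have "\<dots> \<le> \<bar>C\<bar> * \<bar>y - x\<bar>"
        by (intro mult_right_mono) auto
      finally show ?thesis by (simp add: abs_mult)
    qed
    finally show ?thesis by simp
  qed
  then show "\<forall>\<^sub>F y in at x within S. norm ((h y - h x) / (y - x) - d) \<le> norm (C * (y - x)) * 1"
    by (auto simp: eventually_at_filter)
qed

lemma measure_seg_UNIV: "a \<le> b \<Longrightarrow> measure (seg a b) UNIV = b - a"
  by (simp add: measure_def emeasure_seg)

lemma integral_seg_const: "a \<le> b \<Longrightarrow> (\<integral>x. c \<partial>seg a b) = (b - a) * (c::real)"
  by (simp add: measure_seg_UNIV)

text \<open>Supplies the positivity of the support function: \<open>|sin|\<close> dominates its
  square, whose integral over an interval of length \<open>pi\<close> is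
  \<open>pi / 2\<close>.\<close>

lemma integral_sin_kernel_gt_0:
  assumes [measurable]: "f \<in> borel_measurable borel" and f: "\<And>x. c \<le> f x" "\<And>x. f x \<le> M" and "0 < c"
  shows "(\<integral>u. f u * \<bar>sin (x - u)\<bar> \<partial>seg 0 pi) > 0"
proof -
  have s: "(\<integral>u. (sin (x - u))\<^sup>2 \<partial>seg 0 pi) = pi / 2"
  proof (rule integral_seg_eq)
    let ?g = "\<lambda>u. u / 2 + sin (2 * (x - u)) / 4"
    have "((\<lambda>u. (sin (x - u))\<^sup>2) has_integral ?g pi - ?g 0) {0..pi}"
    proof (rule fundamental_theorem_of_calculus)
      fix u
      have "1 / 2 - cos (2 * (x - u)) / 2 = (sin (x - u))\<^sup>2"
        by (simp only: cos_double_sin) (simp add: field_simps)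
      moreover have "(?g has_real_derivative 1 / 2 - cos (2 * (x - u)) / 2) (at u within {0..pi})"
        by (auto intro!: derivative_eq_intros)
      ultimately show "(?g has_vector_derivative (sin (x - u))\<^sup>2) (at u within {0..pi})"
        by (simp add: has_real_derivative_iff_has_vector_derivative)
    qed simp
    moreover have "sin (2 * (x - pi)) = sin (2 * x)"
      using sin_periodic[of "2 * (x - pi)"] by (simp add: algebra_simps)
    ultimately show "((\<lambda>u. (sin (x - u))\<^sup>2) has_integral pi / 2) {0..pi}"
      by simp
    show "\<bar>(sin (x - u))\<^sup>2\<bar> \<le> 1" for u
      by (simp add: abs_square_le_1)
  qed measurable
  have "0 < c * (\<integral>u. (sin (x - u))\<^sup>2 \<partial>seg 0 pi)"
    using \<open>0 < c\<close> by (simp add: s)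
  also have "\<dots> = (\<integral>u. c * (sin (x - u))\<^sup>2 \<partial>seg 0 pi)"
    by simp
  also have "\<dots> \<le> (\<integral>u. f u * \<bar>sin (x - u)\<bar> \<partial>seg 0 pi)"
  proof (rule integral_mono)
    show "integrable (seg 0 pi) (\<lambda>u. c * (sin (x - u))\<^sup>2)"
      by (rule integrable_seg[where M = c]) (use \<open>0 < c\<close> in \<open>auto simp: abs_mult abs_square_le_1 mult_left_le\<close>)
    show "integrable (seg 0 pi) (\<lambda>u. f u * \<bar>sin (x - u)\<bar>)"
    proof (rule integrable_seg[where M = "M * 1"])
      fix u show "\<bar>f u * \<bar>sin (x - u)\<bar>\<bar> \<le> M * 1"
        unfolding abs_mult using f[of u] \<open>0 < c\<close> by (intro mult_mono) auto
    qed measurable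
    fix u
    have "\<bar>sin (x - u)\<bar> * \<bar>sin (x - u)\<bar> \<le> \<bar>sin (x - u)\<bar> * 1"
      by (intro mult_left_mono) auto
    then have "(sin (x - u))\<^sup>2 \<le> \<bar>sin (x - u)\<bar>"
      by (simp add: power2_eq_square abs_mult[symmetric])
    then show "c * (sin (x - u))\<^sup>2 \<le> f u * \<bar>sin (x - u)\<bar>"
      using f[of u] \<open>0 < c\<close> by (intro mult_mono) auto
  qed
  finally show ?thesis .
qed

section \<open>The support function generated by a bounded density\<close>

context
  fixes f :: "real \<Rightarrow> real" and M :: real
  assumes f_meas [measurable]: "f \<in> borel_measurable borel" and f: "\<And>x. 0 \<le> f x" "\<And>x. f x \<le> M"
begin

lemma integrable_mult_seg:
  assumes [measurable]: "g \<in> borel_measurable borel" and g: "\<And>u. \<bar>g u\<bar> \<le> K"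
  shows "integrable (seg a b) (\<lambda>u. f u * g u)"
proof (rule integrable_seg[where M = "M * K"])
  fix u show "\<bar>f u * g u\<bar> \<le> M * K"
    unfolding abs_mult using f[of u] by (intro mult_mono g) auto
qed measurable

lemma integral_mult_seg_le:
  assumes [measurable]: "g \<in> borel_measurable borel" and g: "\<And>u. \<bar>g u\<bar> \<le> K"
    and [measurable]: "k \<in> borel_measurable borel" and k: "\<And>u. \<bar>k u\<bar> \<le> K'"
    and gk: "\<And>u. u \<in> {a..b} \<Longrightarrow> \<bar>g u\<bar> \<le> k u"
  shows "\<bar>\<integral>u. f u * g u \<partial>seg a b\<bar> \<le> M * (\<integral>u. k u \<partial>seg a b)"
proof -
  have "\<bar>\<integral>u. f u * g u \<partial>seg a b\<bar> \<le> (\<integral>u. \<bar>f u * g u\<bar> \<partial>seg a b)"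
    by (rule integral_abs_bound)
  also have "\<dots> \<le> (\<integral>u. M * k u \<partial>seg a b)"
  proof (rule integral_mono_AE)
    show "integrable (seg a b) (\<lambda>u. \<bar>f u * g u\<bar>)"
      by (intro Bochner_Integration.integrable_abs integrable_mult_seg[OF assms(1) g])
    show "integrable (seg a b) (\<lambda>u. M * k u)"
      using k by (intro integrable_mult_right integrable_seg[where M = K']) auto
    show "AE u in seg a b. \<bar>f u * g u\<bar> \<le> M * k u"
      using AE_seg[of a b]
    proof eventually_elim
      case (elim u)
      then show ?case
        unfolding abs_mult using f[of u] by (intro mult_mono gk) auto
    qed
  qed
  finally show ?thesis by simp
qed

text \<open>Support function of the centrally symmetric planar convex body whose radius of curvature
  is \<open>2 * f\<close> in the sense of distributions; \<open>sin_conv'\<close> is its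
  derivative.\<close>

definition "sin_conv x = (\<integral>u. f u * \<bar>sin (x - u)\<bar> \<partial>seg 0 pi)"
definition "sin_conv' x = (\<integral>u. f u * dsin x u \<partial>seg 0 pi)"

lemma integrable_sin_conv: "integrable (seg 0 pi) (\<lambda>u. f u * \<bar>sin (x - u)\<bar>)"
  by (rule integrable_mult_seg[where K = 1]) auto

lemma integrable_sin_conv': "integrable (seg 0 pi) (\<lambda>u. f u * dsin x u)"
  by (rule integrable_mult_seg[where K = 1]) (auto simp: abs_dsin_le)

lemma has_integral_sin_conv: "has_bochner_integral (seg 0 pi) (\<lambda>u. f u * \<bar>sin (x - u)\<bar>) (sin_conv x)"
  unfolding sin_conv_def by (rule has_bochner_integral_integrable[OF integrable_sin_conv])

lemma has_integral_sin_conv': "has_bochner_integral (seg 0 pi) (\<lambda>u. f u * dsin x u) (sin_conv' x)"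
  unfolding sin_conv'_def by (rule has_bochner_integral_integrable[OF integrable_sin_conv'])

lemma integral_seg_indicator_between:
  assumes "0 \<le> c" "0 \<le> d"
  shows "(\<integral>u. c + d * indicator {min x y..max x y} u \<partial>seg 0 pi) \<le> pi * c + d * \<bar>y - x\<bar>"
proof -
  have "(\<integral>u. c + d * indicator {min x y..max x y} u \<partial>seg 0 pi)
      = pi * c + d * measure (seg 0 pi) {min x y..max x y}"
    by (subst Bochner_Integration.integral_add)
      (auto intro!: integrable_seg[where M = 1] integrable_mult_right
        simp: measure_seg_UNIV finite_measure.integrable_const)
  also have "\<dots> \<le> pi * c + d * \<bar>y - x\<bar>"
    using measure_seg_between assms by (intro add_left_mono mult_left_mono) auto
  finally show ?thesis .
qed

lemma M_nonneg: "0 \<le> M"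
  using f[of 0] by linarith

lemma sin_conv_has_derivative:
  assumes x: "x \<in> {0..pi}"
  shows "(sin_conv has_real_derivative sin_conv' x) (at x within {0..pi})"
proof (rule has_real_derivative_quadratic)
  fix y :: real assume y: "y \<in> {0..pi}"
  have eq: "sin_conv y - sin_conv x - (y - x) * sin_conv' x
      = (\<integral>u. f u * (\<bar>sin (y - u)\<bar> - \<bar>sin (x - u)\<bar> - (y - x) * dsin x u) \<partial>seg 0 pi)"
  proof -
    have "has_bochner_integral (seg 0 pi)
        (\<lambda>u. f u * \<bar>sin (y - u)\<bar> - f u * \<bar>sin (x - u)\<bar> - (y - x) * (f u * dsin x u))
        (sin_conv y - sin_conv x - (y - x) * sin_conv' x)"
      by (intro has_bochner_integral_diff has_bochner_integral_mult_right has_integral_sin_conv has_integral_sin_conv')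
    then show ?thesis
      by (simp only: has_bochner_integral_iff right_diff_distrib mult.left_commute)
  qed
  have "\<bar>sin_conv y - sin_conv x - (y - x) * sin_conv' x\<bar>
      \<le> M * (\<integral>u. (y - x)\<^sup>2 + 2 * \<bar>y - x\<bar> * indicator {min x y..max x y} u \<partial>seg 0 pi)"
  proof -
    have *: "\<bar>a - b - c\<bar> \<le> 1 + d" if "a \<le> 1" "0 \<le> a" "b \<le> 1" "0 \<le> b" "\<bar>c\<bar> \<le> d" for a b c d :: real
      using that by linarith
    have 1: "\<bar>\<bar>sin (y - u)\<bar> - \<bar>sin (x - u)\<bar> - (y - x) * dsin x u\<bar> \<le> 1 + \<bar>y - x\<bar>" for u
      by (rule *) (use abs_dsin_le[of x u] in \<open>simp_all add: abs_mult mult_left_le\<close>)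
    have 2: "\<bar>(y - x)\<^sup>2 + 2 * \<bar>y - x\<bar> * indicator {min x y..max x y} u\<bar> \<le> (y - x)\<^sup>2 + 2 * \<bar>y - x\<bar>" for u
      by (cases "u \<in> {min x y..max x y}") (simp_all del: atLeastAtMost_iff)
    show ?thesis
      unfolding eq by (rule integral_mult_seg_le[OF _ 1 _ 2 abs_sin_diff_taylor[OF x y]]) measurable
  qed
  also have "\<dots> \<le> M * (pi * (y - x)\<^sup>2 + 2 * \<bar>y - x\<bar> * \<bar>y - x\<bar>)"
    by (rule mult_left_mono[OF integral_seg_indicator_between M_nonneg]) auto
  also have "\<dots> = M * (pi + 2) * (y - x)\<^sup>2"
    by (simp add: algebra_simps power2_eq_square)
  finally show "\<bar>sin_conv y - sin_conv x - (y - x) * sin_conv' x\<bar> \<le> M * (pi + 2) * (y - x)\<^sup>2" .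
qed

text \<open>The jump of \<open>dsin\<close> is felt only for \<open>u\<close> between the two
  arguments; as \<open>f\<close> is bounded, this costs a multiple of their distance.\<close>

lemma sin_conv'_continuous: "continuous_on {0..pi} sin_conv'"
proof -
  have "\<bar>sin_conv' y - sin_conv' x\<bar> \<le> M * (pi + 2) * \<bar>y - x\<bar>" for x y
  proof -
    have eq: "sin_conv' y - sin_conv' x = (\<integral>u. f u * (dsin y u - dsin x u) \<partial>seg 0 pi)"
      using has_bochner_integral_diff[OF has_integral_sin_conv' has_integral_sin_conv', of y x]
      by (simp only: has_bochner_integral_iff right_diff_distrib)
    have "\<bar>sin_conv' y - sin_conv' x\<bar> \<le> M * (\<integral>u. \<bar>y - x\<bar> + 2 * indicator {min x y..max x y} u \<partial>seg 0 pi)"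
    proof -
      have 1: "\<bar>dsin y u - dsin x u\<bar> \<le> 2" for u
        using add_mono[OF abs_dsin_le[of y u] abs_dsin_le[of x u]]
        by (intro order_trans[OF abs_triangle_ineq4]) simp
      have 2: "\<bar>\<bar>y - x\<bar> + 2 * indicator {min x y..max x y} u\<bar> \<le> \<bar>y - x\<bar> + 2" for u
        by (cases "u \<in> {min x y..max x y}") (simp_all del: atLeastAtMost_iff)
      show ?thesis
        unfolding eq by (rule integral_mult_seg_le[OF _ 1 _ 2 dsin_lipschitz]) measurable
    qed
    also have "\<dots> \<le> M * (pi * \<bar>y - x\<bar> + 2 * \<bar>y - x\<bar>)"
      by (rule mult_left_mono[OF integral_seg_indicator_between M_nonneg]) auto
    finally show ?thesis
      by (simp add: algebra_simps)
  qed
  then have "(M * (pi + 2))-lipschitz_on {0..pi} sin_conv'"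
    using M_nonneg by (intro lipschitz_onI) (auto simp: dist_real_def abs_minus_commute)
  then show ?thesis
    by (rule lipschitz_on_continuous_on)
qed

lemma sin_conv_pi: "sin_conv pi = sin_conv 0"
  unfolding sin_conv_def by (intro Bochner_Integration.integral_cong refl) (simp add: sin_diff)

text \<open>The left side is the area of the body with support function \<open>sin_conv\<close>;
  formally this is \<open>h'' + h = 2 f\<close> and an integration by parts. As \<open>f\<close> is
  merely measurable, \<open>h''\<close> need not exist. Instead the squares are expanded into double
  integrals, the order is exchanged, and \<open>integral_sin_sin_minus_dsin_dsin\<close> evaluates
  the integral over \<open>x\<close>.\<close>

lemma integral_sin_conv_sq_minus_sin_conv'_sq:
  "(\<integral>x. (sin_conv x)\<^sup>2 - (sin_conv' x)\<^sup>2 \<partial>seg 0 pi) = 2 * (\<integral>x. f x * sin_conv x \<partial>seg 0 pi)"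
proof -
  let ?N = "seg 0 pi"
  interpret N: finite_measure ?N by simp
  interpret NN: pair_sigma_finite ?N ?N ..
  interpret NNf: finite_measure "?N \<Otimes>\<^sub>M ?N"
    by (rule finite_measure_pair_measure) simp_all
  interpret N3f: finite_measure "?N \<Otimes>\<^sub>M (?N \<Otimes>\<^sub>M ?N)"
    by (rule finite_measure_pair_measure) (simp_all add: NNf.finite_measure_axioms)
  interpret N3: pair_sigma_finite ?N "?N \<Otimes>\<^sub>M ?N" ..
  let ?k = "\<lambda>x u v. \<bar>sin (x - u)\<bar> * \<bar>sin (x - v)\<bar> - dsin x u * dsin x v"
  have bound: "\<bar>f u * f v * ?k x u v\<bar> \<le> M * M * 2" for x u v
  proof -
    have "\<bar>\<bar>sin (x - u)\<bar> * \<bar>sin (x - v)\<bar>\<bar> \<le> 1 * 1" "\<bar>dsin x u * dsin x v\<bar> \<le> 1 * 1"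
      unfolding abs_mult by (intro mult_mono; simp add: abs_dsin_le)+
    then have "\<bar>?k x u v\<bar> \<le> 2"
      by (intro order_trans[OF abs_triangle_ineq4]) simp
    moreover have "\<bar>f u * f v\<bar> \<le> M * M"
      unfolding abs_mult using f[of u] f[of v] by (intro mult_mono) auto
    ultimately show ?thesis
      unfolding abs_mult[of "f u * f v"] using M_nonneg by (intro mult_mono) auto
  qed
  have [measurable]: "(\<lambda>(u, v). f u * f v * ?k x u v) \<in> borel_measurable (?N \<Otimes>\<^sub>M ?N)" for x
    by measurable
  have [measurable]: "(\<lambda>(x, u, v). f u * f v * ?k x u v) \<in> borel_measurable (?N \<Otimes>\<^sub>M (?N \<Otimes>\<^sub>M ?N))"
    by measurable
  have int2: "integrable (?N \<Otimes>\<^sub>M ?N) (\<lambda>(u, v). f u * f v * ?k x u v)" for x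
    by (rule NNf.integrable_const_bound[where B = "M * M * 2"])
      (auto simp only: real_norm_def split_beta bound intro!: AE_I2, measurable)
  have int3: "integrable (?N \<Otimes>\<^sub>M (?N \<Otimes>\<^sub>M ?N)) (\<lambda>(x, u, v). f u * f v * ?k x u v)"
    by (rule N3f.integrable_const_bound[where B = "M * M * 2"])
      (auto simp only: real_norm_def split_beta bound intro!: AE_I2, measurable)
  have eq: "(sin_conv x)\<^sup>2 - (sin_conv' x)\<^sup>2 = (\<integral>p. (case p of (u, v) \<Rightarrow> f u * f v * ?k x u v) \<partial>(?N \<Otimes>\<^sub>M ?N))" for x
  proof -
    have "(\<integral>p. (case p of (u, v) \<Rightarrow> f u * f v * ?k x u v) \<partial>(?N \<Otimes>\<^sub>M ?N))
        = (\<integral>u. \<integral>v. f u * f v * ?k x u v \<partial>?N \<partial>?N)"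
      using NN.integral_fst'[OF int2[of x]] by simp
    also have "\<dots> = (\<integral>u. f u * \<bar>sin (x - u)\<bar> * sin_conv x - f u * dsin x u * sin_conv' x \<partial>?N)"
    proof (intro Bochner_Integration.integral_cong refl)
      fix u
      have "(\<integral>v. f u * f v * ?k x u v \<partial>?N) = (\<integral>v. f u * \<bar>sin (x - u)\<bar> * (f v * \<bar>sin (x - v)\<bar>)
          - f u * dsin x u * (f v * dsin x v) \<partial>?N)"
        by (intro Bochner_Integration.integral_cong refl) (simp add: algebra_simps)
      then show "(\<integral>v. f u * f v * ?k x u v \<partial>?N) = f u * \<bar>sin (x - u)\<bar> * sin_conv x - f u * dsin x u * sin_conv' x"
        unfolding sin_conv_def sin_conv'_def by (simp add: integrable_sin_conv integrable_sin_conv')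
    qed
    also have "\<dots> = (sin_conv x)\<^sup>2 - (sin_conv' x)\<^sup>2"
      by (simp add: integrable_sin_conv integrable_sin_conv' sin_conv_def[symmetric] sin_conv'_def[symmetric] power2_eq_square)
    finally show ?thesis ..
  qed
  have "(\<integral>x. (sin_conv x)\<^sup>2 - (sin_conv' x)\<^sup>2 \<partial>?N)
      = (\<integral>x. \<integral>p. (case p of (u, v) \<Rightarrow> f u * f v * ?k x u v) \<partial>(?N \<Otimes>\<^sub>M ?N) \<partial>?N)"
    by (simp only: eq)
  also have "\<dots> = (\<integral>p. \<integral>x. (case p of (u, v) \<Rightarrow> f u * f v * ?k x u v) \<partial>?N \<partial>(?N \<Otimes>\<^sub>M ?N))"
    using int3 by (intro N3.Fubini_integral[symmetric]) simp
  also have "\<dots> = (\<integral>p. (case p of (u, v) \<Rightarrow> f u * f v * (\<integral>x. ?k x u v \<partial>?N)) \<partial>(?N \<Otimes>\<^sub>M ?N))"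
    by (intro Bochner_Integration.integral_cong refl) (simp add: split_beta)
  also have "\<dots> = (\<integral>u. \<integral>v. f u * f v * (\<integral>x. ?k x u v \<partial>?N) \<partial>?N \<partial>?N)"
  proof -
    have "integrable (?N \<Otimes>\<^sub>M ?N) (\<lambda>p. \<integral>x. (case p of (u, v) \<Rightarrow> f u * f v * ?k x u v) \<partial>?N)"
      using int3 by (intro N3.integrable_snd) simp
    then have "integrable (?N \<Otimes>\<^sub>M ?N) (\<lambda>(u, v). f u * f v * (\<integral>x. ?k x u v \<partial>?N))"
      by (simp add: case_prod_beta')
    from NN.integral_fst'[OF this] show ?thesis by simp
  qed
  also have "\<dots> = (\<integral>u. \<integral>v. 2 * f u * (f v * \<bar>sin (u - v)\<bar>) \<partial>?N \<partial>?N)"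
  proof -
    have m1: "(\<lambda>v. f u * f v * (\<integral>x. ?k x u v \<partial>?N)) \<in> borel_measurable ?N" for u
      by measurable
    have m1': "(\<lambda>v. 2 * f u * (f v * \<bar>sin (u - v)\<bar>)) \<in> borel_measurable ?N" for u
      by measurable
    have m2: "(\<lambda>u. \<integral>v. f u * f v * (\<integral>x. ?k x u v \<partial>?N) \<partial>?N) \<in> borel_measurable ?N"
      by measurable
    have m2': "(\<lambda>u. \<integral>v. 2 * f u * (f v * \<bar>sin (u - v)\<bar>) \<partial>?N) \<in> borel_measurable ?N"
      by measurable
    show ?thesis
  proof (rule integral_cong_AE)
    show "AE u in ?N. (\<integral>v. f u * f v * (\<integral>x. ?k x u v \<partial>?N) \<partial>?N)
        = (\<integral>v. 2 * f u * (f v * \<bar>sin (u - v)\<bar>) \<partial>?N)"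
      using AE_seg[of 0 pi]
    proof eventually_elim
      case (elim u)
      show ?case
      proof (rule integral_cong_AE)
        show "AE v in ?N. f u * f v * (\<integral>x. ?k x u v \<partial>?N) = 2 * f u * (f v * \<bar>sin (u - v)\<bar>)"
          using AE_seg[of 0 pi]
        proof eventually_elim
          case v: (elim v)
          show ?case
            unfolding integral_sin_sin_minus_dsin_dsin[OF elim v] by simp
        qed
      qed (rule m1 m1')+
    qed
  qed (rule m2 m2')+
  qed
  also have "\<dots> = 2 * (\<integral>x. f x * sin_conv x \<partial>?N)"
    by (simp add: sin_conv_def[symmetric] mult.assoc)
  finally show ?thesis .
qed

end

section \<open>A reverse Hardy-Littlewood-Sobolev inequality for the kernel \<open>\<bar>sin (u - v)\<bar>\<close>\<close>

lemma integral_seg_continuous: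
  fixes f :: "real \<Rightarrow> real"
  assumes [measurable]: "f \<in> borel_measurable borel" and c: "continuous_on {a..b} f"
  shows "(\<integral>x. f x \<partial>seg a b) = integral {a..b} f" "integrable (seg a b) f"
proof -
  obtain B where B: "\<forall>x\<in>{a..b}. norm (f x) \<le> B"
    using compact_imp_bounded[OF compact_continuous_image[OF c compact_Icc]]
    by (auto simp: bounded_iff)
  then show "(\<integral>x. f x \<partial>seg a b) = integral {a..b} f"
    by (intro integral_seg_eq[where M = B] integrable_integral integrable_continuous_real c) auto
  show "integrable (seg a b) f"
    by (rule integrable_seg[where M = B]) (use B in auto)
qed

text \<open>Young's inequality with exponents 3/2 and 3 for
  \<open>q^2 = (q^3 h)^(2/3) (h^(-2))^(1/3)\<close>; with \<open>c = l q h\<close> it becomes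
  \<open>(c - 1)^2 (2 c + 1) >= 0\<close>. Optimising the free scale \<open>l\<close> after
  integration yields Hoelder's inequality.\<close>

lemma young_cubic:
  fixes q h l :: real
  assumes "0 \<le> q" "0 < h" "0 < l"
  shows "q\<^sup>2 \<le> 2 / 3 * l * (q ^ 3 * h) + 1 / (3 * l\<^sup>2) * (1 / h\<^sup>2)"
proof -
  define c where "c = l * q * h"
  have c: "0 \<le> c" using assms by (simp add: c_def)
  have "0 \<le> (c - 1)\<^sup>2 * (2 * c + 1)"
    using c by simp
  also have "\<dots> = 2 * c ^ 3 - 3 * c\<^sup>2 + 1"
    by (simp add: power2_eq_square power3_eq_cube algebra_simps)
  finally have "c\<^sup>2 / (l\<^sup>2 * h\<^sup>2) \<le> (2 / 3 * c ^ 3 + 1 / 3) / (l\<^sup>2 * h\<^sup>2)"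
    using assms by (intro divide_right_mono) auto
  also have "c\<^sup>2 / (l\<^sup>2 * h\<^sup>2) = q\<^sup>2"
    using assms by (simp add: c_def power_mult_distrib)
  also have "(2 / 3 * c ^ 3 + 1 / 3) / (l\<^sup>2 * h\<^sup>2) = 2 / 3 * l * (q ^ 3 * h) + 1 / (3 * l\<^sup>2) * (1 / h\<^sup>2)"
    using assms by (simp add: c_def power_mult_distrib field_simps power2_eq_square power3_eq_cube)
  finally show ?thesis .
qed

text \<open>With \<open>f = q^3\<close> and \<open>h\<close> its support function, Hoelder gives
  \<open>X^3 <= I^2 T\<close> and Santalo gives \<open>I T <= pi^2 / 2\<close>. The lower bound
  \<open>c\<close> ensures \<open>h > 0\<close>, so that \<open>1/h^2\<close> is continuous.\<close>

lemma reverse_hls_pos: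
  fixes q :: "real \<Rightarrow> real"
  assumes [measurable]: "q \<in> borel_measurable borel" and q: "\<And>x. c \<le> q x" "\<And>x. q x \<le> M" and c: "0 < c"
  shows "(\<integral>u. (q u)\<^sup>2 \<partial>seg 0 pi) ^ 3
    \<le> pi\<^sup>2 / 2 * (\<integral>u. \<integral>v. q u ^ 3 * q v ^ 3 * \<bar>sin (u - v)\<bar> \<partial>seg 0 pi \<partial>seg 0 pi)"
proof -
  define f where "f x = q x ^ 3" for x
  have q0: "0 < q x" for x using q(1)[of x] c by linarith
  have fm [measurable]: "f \<in> borel_measurable borel"
    unfolding f_def by measurable
  have f: "c ^ 3 \<le> f x" "0 \<le> f x" "f x \<le> M ^ 3" for x
    using q0[of x] q[of x] c by (auto simp: f_def intro!: power_mono)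
  define h h' where "h = sin_conv f" and "h' = sin_conv' f"
  have hm [measurable]: "h \<in> borel_measurable borel"
    unfolding h_def sin_conv_def[OF fm f(2,3)] by measurable
  have hm' [measurable]: "h' \<in> borel_measurable borel"
    unfolding h'_def sin_conv'_def[OF fm f(2,3)] by measurable
  have pos: "h x > 0" for x
    unfolding h_def sin_conv_def[OF fm f(2,3)]
    by (rule integral_sin_kernel_gt_0[OF fm f(1) f(3)]) (use c in auto)
  note der = sin_conv_has_derivative[OF fm f(2,3), folded h_def h'_def]
    and ch' = sin_conv'_continuous[OF fm f(2,3), folded h'_def]
  have ch: "continuous_on {0..pi} h"
    using der by (meson DERIV_continuous_on)
  define T where "T = integral {0..pi} (\<lambda>x. 1 / (h x)\<^sup>2)"
  note T = santalo_support[OF der ch' sin_conv_pi[OF fm f(2,3), folded h_def] pos, folded T_def]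
  define I where "I = (\<integral>x. f x * h x \<partial>seg 0 pi)"
  define X where "X = (\<integral>u. (q u)\<^sup>2 \<partial>seg 0 pi)"
  have "2 * I = (\<integral>x. (h x)\<^sup>2 - (h' x)\<^sup>2 \<partial>seg 0 pi)"
    unfolding I_def using integral_sin_conv_sq_minus_sin_conv'_sq[OF fm f(2,3), folded h_def h'_def] by simp
  also have "\<dots> = integral {0..pi} (\<lambda>x. (h x)\<^sup>2 - (h' x)\<^sup>2)"
    by (intro integral_seg_continuous continuous_intros ch ch') measurable
  finally have "2 * I \<le> pi\<^sup>2 / T"
    using T(2) by simp
  then have IT: "I * T \<le> pi\<^sup>2 / 2"
    using T(1) by (simp add: field_simps)
  obtain B where B: "\<forall>x\<in>{0..pi}. \<bar>h x\<bar> \<le> B"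
    using compact_imp_bounded[OF compact_continuous_image[OF ch compact_Icc]]
    by (auto simp: bounded_iff)
  have i1: "integrable (seg 0 pi) (\<lambda>x. f x * h x)"
  proof (rule integrable_seg[where M = "M ^ 3 * B"])
    show "\<bar>f x * h x\<bar> \<le> M ^ 3 * B" if "x \<in> {0..pi}" for x
      unfolding abs_mult using f[of x] B that q0[of x] q(2)[of x] by (intro mult_mono) auto
  qed measurable
  have ci: "continuous_on {0..pi} (\<lambda>x. 1 / (h x)\<^sup>2)"
    using pos by (intro continuous_intros ch) (metis less_irrefl power_not_zero)
  have i2: "integrable (seg 0 pi) (\<lambda>x. 1 / (h x)\<^sup>2)" and T_eq: "(\<integral>x. 1 / (h x)\<^sup>2 \<partial>seg 0 pi) = T"
    unfolding T_def by (intro integral_seg_continuous ci; measurable)+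
  have i3: "integrable (seg 0 pi) (\<lambda>x. (q x)\<^sup>2)"
    by (rule integrable_seg[where M = "M\<^sup>2"])
      (use q0 q in \<open>auto intro!: power_mono simp: less_imp_le\<close>)
  have X0: "X > 0"
  proof -
    have "0 < (\<integral>x. c\<^sup>2 \<partial>seg 0 pi)"
      using c by (simp only: integral_seg_const[OF pi_ge_zero]) simp
    also have "\<dots> \<le> X"
      unfolding X_def using q c
      by (intro Bochner_Integration.integral_mono i3 finite_measure.integrable_const) (auto intro!: power_mono)
    finally show ?thesis .
  qed
  have le: "X \<le> 2 / 3 * l * I + 1 / (3 * l\<^sup>2) * T" if l: "l > 0" for l
  proof -
    have "X \<le> (\<integral>x. 2 / 3 * l * (f x * h x) + 1 / (3 * l\<^sup>2) * (1 / (h x)\<^sup>2) \<partial>seg 0 pi)"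
      unfolding X_def
      by (intro Bochner_Integration.integral_mono i3 Bochner_Integration.integrable_add integrable_mult_right i1 i2)
        (use young_cubic[OF less_imp_le[OF q0] pos l] in \<open>simp add: f_def\<close>)
    also have "\<dots> = 2 / 3 * l * I + 1 / (3 * l\<^sup>2) * T"
      by (subst Bochner_Integration.integral_add)
        (simp_all only: integral_mult_right_zero I_def T_eq integrable_mult_right i1 i2)
    finally show ?thesis .
  qed
  have I0: "I > 0"
  proof (rule ccontr)
    assume "\<not> I > 0"
    moreover have "I \<ge> 0"
      unfolding I_def using f pos by (intro Bochner_Integration.integral_nonneg) (auto simp: less_imp_le)
    ultimately have "I = 0" by simp
    \<comment> \<open>For \<open>I = 0\<close> the Young bound reduces to
      \<open>T / (3 l^2)\<close>; this \<open>l\<close> turns it into \<open>X / 3\<close>, which is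
      less than \<open>X\<close>.\<close>
    define l where "l = sqrt (T / X)"
    have "l > 0" "l\<^sup>2 = T / X"
      using T X0 by (auto simp: l_def)
    with le[of l] \<open>I = 0\<close> have "X \<le> 1 / (3 * (T / X)) * T"
      by simp
    also have "\<dots> = X / 3"
      using T X0 by simp
    finally show False using X0 by simp
  qed
  have third: "X \<le> Y" if "X \<le> 2 / 3 * X + Y / 3" for Y
    using that by linarith
  \<comment> \<open>The scale \<open>l = X / I\<close> makes the first term \<open>2/3 X\<close>,
    which is absorbed on the left.\<close>
  have "X \<le> 2 / 3 * (X / I) * I + 1 / (3 * (X / I)\<^sup>2) * T"
    using X0 I0 by (intro le) auto
  also have "\<dots> = 2 / 3 * X + I\<^sup>2 * T / (3 * X\<^sup>2)"
    using X0 I0 by (simp add: power_divide)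
  also have "I\<^sup>2 * T / (3 * X\<^sup>2) = (I\<^sup>2 * T / X\<^sup>2) / 3"
    by simp
  finally have "X \<le> I\<^sup>2 * T / X\<^sup>2"
    by (rule third)
  then have "X ^ 3 \<le> I * (I * T)"
    using X0 by (simp add: field_simps power2_eq_square power3_eq_cube)
  also have "\<dots> \<le> I * (pi\<^sup>2 / 2)"
    using I0 IT by (intro mult_left_mono) auto
  finally have "X ^ 3 \<le> pi\<^sup>2 / 2 * I" by (simp add: mult_ac)
  moreover have "I = (\<integral>u. \<integral>v. q u ^ 3 * q v ^ 3 * \<bar>sin (u - v)\<bar> \<partial>seg 0 pi \<partial>seg 0 pi)"
    unfolding I_def h_def sin_conv_def[OF fm f(2,3)] by (simp add: f_def mult.assoc)
  ultimately show ?thesis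
    by (simp add: X_def)
qed

text \<open>The positive lower bound is removed by applying \<open>reverse_hls_pos\<close> to
  \<open>q + e\<close> and letting \<open>e\<close> tend to 0; the error is linear in
  \<open>e\<close> with a constant uniform in both variables.\<close>

lemma reverse_hls:
  fixes q :: "real \<Rightarrow> real"
  assumes [measurable]: "q \<in> borel_measurable borel" and q: "\<And>x. 0 \<le> q x" "\<And>x. q x \<le> M"
  shows "(\<integral>u. (q u)\<^sup>2 \<partial>seg 0 pi) ^ 3
    \<le> pi\<^sup>2 / 2 * (\<integral>u. \<integral>v. q u ^ 3 * q v ^ 3 * \<bar>sin (u - v)\<bar> \<partial>seg 0 pi \<partial>seg 0 pi)"
    (is "?X ^ 3 \<le> pi\<^sup>2 / 2 * ?I")
proof -
  let ?N = "seg 0 pi"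
  have M: "0 \<le> M" using q[of 0] by linarith
  \<comment> \<open>Each cube grows by at most \<open>e (3 M^2 + 3 M + 1)\<close>, the other cube is
    at most \<open>(M + 1)^3\<close>, and there are two cubes.\<close>
  define K where "K = ((M + 1) ^ 3) * 2 * (3 * M\<^sup>2 + 3 * M + 1)"
  have main: "?X ^ 3 \<le> pi\<^sup>2 / 2 * ?I + e * (pi\<^sup>2 / 2 * (pi * (pi * K)))" if e: "0 < e" "e \<le> 1" for e
  proof -
    let ?r = "\<lambda>u. q u + e"
    have r: "0 \<le> ?r u" "?r u \<le> M + 1" "q u \<le> ?r u" for u
      using q[of u] e by auto
    have "?X \<le> (\<integral>u. (?r u)\<^sup>2 \<partial>?N)"
    proof (rule Bochner_Integration.integral_mono)
      show "integrable ?N (\<lambda>u. (q u)\<^sup>2)"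
        by (rule integrable_seg[where M = "M\<^sup>2"]) (use q in \<open>auto intro!: power_mono\<close>)
      show "integrable ?N (\<lambda>u. (?r u)\<^sup>2)"
        by (rule integrable_seg[where M = "(M + 1)\<^sup>2"]) (use r in \<open>auto intro!: power_mono\<close>)
    qed (use q e in \<open>auto intro!: power_mono\<close>)
    moreover have "0 \<le> ?X" by simp
    ultimately have "?X ^ 3 \<le> (\<integral>u. (?r u)\<^sup>2 \<partial>?N) ^ 3"
      by (intro power_mono)
    also have "\<dots> \<le> pi\<^sup>2 / 2 * (\<integral>u. \<integral>v. ?r u ^ 3 * ?r v ^ 3 * \<bar>sin (u - v)\<bar> \<partial>?N \<partial>?N)"
      by (rule reverse_hls_pos[where M = "M + 1" and c = e]) (use q e r in auto)
    also have "\<dots> \<le> pi\<^sup>2 / 2 * (?I + pi * (pi * (e * K)))"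
    proof (rule mult_left_mono)
      have cube: "?r u ^ 3 \<le> q u ^ 3 + e * (3 * M\<^sup>2 + 3 * M + 1)" for u
      proof -
        have "?r u ^ 3 = q u ^ 3 + e * (3 * (q u)\<^sup>2 + 3 * q u * e + e\<^sup>2)"
          by (simp add: power2_eq_square power3_eq_cube algebra_simps)
        also have "\<dots> \<le> q u ^ 3 + e * (3 * M\<^sup>2 + 3 * M * 1 + 1)"
          using q[of u] e
          by (intro add_left_mono mult_left_mono add_mono power_mono mult_mono) (auto simp: power_le_one)
        finally show ?thesis by simp
      qed
      have pt: "?r u ^ 3 * ?r v ^ 3 * \<bar>sin (u - v)\<bar> \<le> q u ^ 3 * q v ^ 3 * \<bar>sin (u - v)\<bar> + e * K" for u v
      proof -
        let ?C = "3 * M\<^sup>2 + 3 * M + 1"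
        have C: "0 \<le> ?C" using M by simp
        have r3: "?r u ^ 3 \<le> (M + 1) ^ 3" "q u ^ 3 \<le> (M + 1) ^ 3" for u
          using r[of u] q[of u] by (auto intro!: power_mono)
        have "?r u ^ 3 * ?r v ^ 3 \<le> ?r u ^ 3 * (q v ^ 3 + e * ?C)"
          using r by (intro mult_left_mono cube) auto
        also have "\<dots> = ?r u ^ 3 * q v ^ 3 + ?r u ^ 3 * (e * ?C)"
          by (simp add: distrib_left)
        also have "\<dots> \<le> (q u ^ 3 + e * ?C) * q v ^ 3 + (M + 1) ^ 3 * (e * ?C)"
          using r3 C q e by (intro add_mono mult_right_mono cube) auto
        also have "\<dots> \<le> q u ^ 3 * q v ^ 3 + (e * ?C) * (M + 1) ^ 3 + (M + 1) ^ 3 * (e * ?C)"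
          unfolding distrib_right using r3(2)[of v] C e
          by (intro add_mono mult_left_mono order_refl mult_nonneg_nonneg) auto
        also have "\<dots> = q u ^ 3 * q v ^ 3 + e * K"
          unfolding K_def by (simp only: mult_ac)
        finally have *: "?r u ^ 3 * ?r v ^ 3 \<le> q u ^ 3 * q v ^ 3 + e * K" .
        have "0 \<le> e * K" using e M C by (simp add: K_def)
        have "?r u ^ 3 * ?r v ^ 3 * \<bar>sin (u - v)\<bar> \<le> (q u ^ 3 * q v ^ 3 + e * K) * \<bar>sin (u - v)\<bar>"
          by (intro mult_right_mono *) auto
        also have "\<dots> \<le> q u ^ 3 * q v ^ 3 * \<bar>sin (u - v)\<bar> + e * K"
          using \<open>0 \<le> e * K\<close> by (simp add: distrib_right mult_left_le)
        finally show ?thesis .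
      qed
      have bd: "\<bar>a u ^ 3 * a v ^ 3 * \<bar>sin (u - v)\<bar>\<bar> \<le> L ^ 3 * L ^ 3 * 1"
        if "\<And>x. 0 \<le> a x \<and> a x \<le> L" for a :: "real \<Rightarrow> real" and L u v
        unfolding abs_mult using that[of u] that[of v]
        by (intro mult_mono) (auto intro!: power_mono mult_nonneg_nonneg)
      have m1: "(\<lambda>(u, v). a u ^ 3 * a v ^ 3 * \<bar>sin (u - v)\<bar>) \<in> borel_measurable (borel \<Otimes>\<^sub>M borel)"
        if [measurable]: "a \<in> borel_measurable borel" for a :: "real \<Rightarrow> real"
        by measurable
      have in1: "integrable ?N (\<lambda>v. a u ^ 3 * a v ^ 3 * \<bar>sin (u - v)\<bar>)"
        if [measurable]: "a \<in> borel_measurable borel" and "\<And>x. 0 \<le> a x \<and> a x \<le> L" for a :: "real \<Rightarrow> real" and L u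
        by (rule integrable_seg[where M = "L ^ 3 * L ^ 3 * 1"]) (measurable, rule bd[OF that(2)])
      have in2: "integrable ?N (\<lambda>u. \<integral>v. a u ^ 3 * a v ^ 3 * \<bar>sin (u - v)\<bar> \<partial>?N)"
        if [measurable]: "a \<in> borel_measurable borel" and "\<And>x. 0 \<le> a x \<and> a x \<le> L" for a :: "real \<Rightarrow> real" and L
      proof (rule integrable_seg[where M = "pi * (L ^ 3 * L ^ 3 * 1)"])
        fix u
        have "\<bar>\<integral>v. a u ^ 3 * a v ^ 3 * \<bar>sin (u - v)\<bar> \<partial>?N\<bar> \<le> (\<integral>v. \<bar>a u ^ 3 * a v ^ 3 * \<bar>sin (u - v)\<bar>\<bar> \<partial>?N)"
          by (rule integral_abs_bound)
        also have "\<dots> \<le> (\<integral>v. L ^ 3 * L ^ 3 * 1 \<partial>?N)"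
          by (rule Bochner_Integration.integral_mono[OF Bochner_Integration.integrable_abs[OF in1[OF that]]
            finite_measure.integrable_const[OF finite_measure_seg] bd[OF that(2)]])
        finally show "\<bar>\<integral>v. a u ^ 3 * a v ^ 3 * \<bar>sin (u - v)\<bar> \<partial>?N\<bar> \<le> pi * (L ^ 3 * L ^ 3 * 1)"
          by (simp only: integral_seg_const[OF pi_ge_zero] diff_zero)
      qed measurable
      have ib: "integrable ?N (\<lambda>v. ?r u ^ 3 * ?r v ^ 3 * \<bar>sin (u - v)\<bar>)" for u
        by (rule in1[where L = "M + 1"]) (use r in auto)
      have ib2: "integrable ?N (\<lambda>u. \<integral>v. ?r u ^ 3 * ?r v ^ 3 * \<bar>sin (u - v)\<bar> \<partial>?N)"
        by (rule in2[where L = "M + 1"]) (use r in auto)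
      have iq: "integrable ?N (\<lambda>v. q u ^ 3 * q v ^ 3 * \<bar>sin (u - v)\<bar>)" for u
        by (rule in1[where L = M]) (use q in auto)
      have iq2: "integrable ?N (\<lambda>u. \<integral>v. q u ^ 3 * q v ^ 3 * \<bar>sin (u - v)\<bar> \<partial>?N)"
        by (rule in2[where L = M]) (use q in auto)
      note ic = finite_measure.integrable_const[OF finite_measure_seg]
      have inner: "(\<integral>v. ?r u ^ 3 * ?r v ^ 3 * \<bar>sin (u - v)\<bar> \<partial>?N)
          \<le> (\<integral>v. q u ^ 3 * q v ^ 3 * \<bar>sin (u - v)\<bar> \<partial>?N) + pi * (e * K)" for u
      proof -
        have "(\<integral>v. ?r u ^ 3 * ?r v ^ 3 * \<bar>sin (u - v)\<bar> \<partial>?N)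
            \<le> (\<integral>v. q u ^ 3 * q v ^ 3 * \<bar>sin (u - v)\<bar> + e * K \<partial>?N)"
          by (rule Bochner_Integration.integral_mono[OF ib Bochner_Integration.integrable_add[OF iq ic] pt])
        also have "\<dots> = (\<integral>v. q u ^ 3 * q v ^ 3 * \<bar>sin (u - v)\<bar> \<partial>?N) + pi * (e * K)"
          by (subst Bochner_Integration.integral_add[OF iq ic])
            (simp only: integral_seg_const[OF pi_ge_zero] diff_zero)
        finally show ?thesis .
      qed
      have "(\<integral>u. \<integral>v. ?r u ^ 3 * ?r v ^ 3 * \<bar>sin (u - v)\<bar> \<partial>?N \<partial>?N)
          \<le> (\<integral>u. (\<integral>v. q u ^ 3 * q v ^ 3 * \<bar>sin (u - v)\<bar> \<partial>?N) + pi * (e * K) \<partial>?N)"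
        by (rule Bochner_Integration.integral_mono[OF ib2 Bochner_Integration.integrable_add[OF iq2 ic] inner])
      also have "\<dots> = ?I + pi * (pi * (e * K))"
        by (subst Bochner_Integration.integral_add[OF iq2 ic])
          (simp only: integral_seg_const[OF pi_ge_zero] diff_zero)
      finally show "(\<integral>u. \<integral>v. ?r u ^ 3 * ?r v ^ 3 * \<bar>sin (u - v)\<bar> \<partial>?N \<partial>?N) \<le> ?I + pi * (pi * (e * K))" .
    qed simp
    finally show ?thesis by (simp add: algebra_simps)
  qed
  have "((\<lambda>e. pi\<^sup>2 / 2 * ?I + e * (pi\<^sup>2 / 2 * (pi * (pi * K)))) \<longlongrightarrow> pi\<^sup>2 / 2 * ?I + 0 * (pi\<^sup>2 / 2 * (pi * (pi * K)))) (at_right 0)"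
    by (intro tendsto_intros)
  moreover have "\<forall>\<^sub>F e in at_right 0. ?X ^ 3 \<le> pi\<^sup>2 / 2 * ?I + e * (pi\<^sup>2 / 2 * (pi * (pi * K)))"
    using main by (auto simp: eventually_at_right[of 0 1] intro!: exI[of _ 1])
  ultimately have "?X ^ 3 \<le> pi\<^sup>2 / 2 * ?I + 0 * (pi\<^sup>2 / 2 * (pi * (pi * K)))"
    by (rule tendsto_lowerbound) simp
  then show ?thesis by simp
qed

section \<open>The profile function and the bathtub principle\<close>

text \<open>The integral of \<open>x sin x\<close> over \<open>[0, r]\<close>: the weight of all
  arcs of length at most \<open>r\<close> through a point in a given direction. The bound to be
  proved is \<open>(psi t)^2 / (8 pi^2)\<close>.\<close>

definition psi :: "real \<Rightarrow> real" where
  "psi r = sin r - r * cos r"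

lemma psi_has_derivative [derivative_intros]:
  "(psi has_real_derivative r * sin r) (at r within S)"
  unfolding psi_def[abs_def] by (auto intro!: derivative_eq_intros)

lemma continuous_on_psi: "continuous_on S psi"
  unfolding psi_def[abs_def] by (intro continuous_intros)

lemma psi_pos:
  assumes "0 < r" "r \<le> pi"
  shows "0 < psi r"
proof -
  have "psi 0 < psi r"
  proof (rule DERIV_pos_imp_increasing_open[of 0 r psi])
    fix x :: real assume "0 < x" "x < r"
    then have "0 < x * sin x"
      using assms by (intro mult_pos_pos sin_gt_zero) auto
    then show "\<exists>y. (psi has_real_derivative y) (at x) \<and> 0 < y"
      using psi_has_derivative by blast
  qed (use assms continuous_on_psi in auto)
  then show ?thesis by (simp add: psi_def)
qed

lemma psi_nonneg: "0 \<le> r \<Longrightarrow> r \<le> pi \<Longrightarrow> 0 \<le> psi r"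
  using psi_pos[of r] by (cases "r = 0") (auto simp: psi_def less_imp_le)

text \<open>The difference of the two sides has derivative \<open>r * psi r\<close>. Its sign is
  that of the derivative of \<open>r^3 / psi r\<close>.\<close>

lemma psi_ge_sq_sin:
  assumes "0 \<le> r" "r \<le> pi"
  shows "r\<^sup>2 * sin r \<le> 3 * psi r"
proof -
  define Z where "Z x = 3 * psi x - x\<^sup>2 * sin x" for x
  have "Z 0 \<le> Z r"
  proof (rule DERIV_nonneg_imp_nondecreasing[OF assms(1)])
    fix x assume x: "0 \<le> x" "x \<le> r"
    have "(Z has_real_derivative x * psi x) (at x)"
      unfolding Z_def by (auto intro!: derivative_eq_intros simp: psi_def power2_eq_square algebra_simps)
    moreover have "0 \<le> x * psi x"
      using x assms by (intro mult_nonneg_nonneg psi_nonneg) auto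
    ultimately show "\<exists>y. (Z has_real_derivative y) (at x) \<and> 0 \<le> y"
      by blast
  qed
  then show ?thesis by (simp add: Z_def psi_def)
qed

text \<open>The convexity behind the tangent bound: with respect to \<open>1 - cos r\<close>, the
  derivative of \<open>psi^(2/3)\<close> is \<open>2/3 * r / psi^(1/3)\<close>, a multiple of the
  cube root of \<open>r^3 / psi\<close>.\<close>

lemma cube_div_psi_mono:
  assumes "0 < r" "r \<le> s" "s \<le> pi"
  shows "r ^ 3 * psi s \<le> s ^ 3 * psi r"
proof -
  have "r ^ 3 / psi r \<le> s ^ 3 / psi s"
  proof (rule DERIV_nonneg_imp_nondecreasing[OF assms(2)])
    fix x assume x: "r \<le> x" "x \<le> s"
    then have p: "psi x > 0"
      using assms by (intro psi_pos) auto
    have "((\<lambda>x. x ^ 3 / psi x) has_real_derivative x\<^sup>2 * (3 * psi x - x\<^sup>2 * sin x) / (psi x)\<^sup>2) (at x)"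
      using p by (auto intro!: derivative_eq_intros simp: power2_eq_square power3_eq_cube algebra_simps)
    moreover have "0 \<le> x\<^sup>2 * (3 * psi x - x\<^sup>2 * sin x) / (psi x)\<^sup>2"
      using psi_ge_sq_sin[of x] x assms by simp
    ultimately show "\<exists>y. ((\<lambda>x. x ^ 3 / psi x) has_real_derivative y) (at x) \<and> 0 \<le> y"
      by blast
  qed
  moreover have "psi r > 0" "psi s > 0"
    using assms by (auto intro!: psi_pos)
  ultimately show ?thesis
    by (simp add: field_simps)
qed

text \<open>The curve \<open>r \<mapsto> (1 - cos r, (psi r) powr (2/3))\<close> lies above its tangent at \<open>t\<close>.\<close>

lemma psi_tangent:
  assumes t: "0 < t" "t \<le> pi" and r: "0 \<le> r" "r \<le> pi" and c: "0 < c" "c ^ 3 = psi t"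
  shows "c\<^sup>2 + 2 * t / (3 * c) * (cos t - cos r) \<le> (root 3 (psi r))\<^sup>2"
proof -
  \<comment> \<open>\<open>2 * t / (3 * c)\<close> is the slope of the curve at \<open>t\<close>;
    the gap between curve and tangent at \<open>r\<close> is \<open>G r - G t\<close>, so
    \<open>G\<close> has to be minimal at \<open>t\<close>.\<close>
  define G where "G x = (root 3 (psi x))\<^sup>2 + 2 * t / (3 * c) * cos x" for x
  have cG: "continuous_on S G" for S
    unfolding G_def by (intro continuous_intros continuous_on_psi)
  have rt: "root 3 (psi t) = c"
    using c by (metis less_imp_le real_root_power_cancel zero_less_numeral)
  have G': "(G has_real_derivative 2 / 3 * sin x * (x / root 3 (psi x) - t / c)) (at x)"
    and p: "0 < root 3 (psi x)" "root 3 (psi x) ^ 3 = psi x" if "0 < x" "x < pi" for x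
  proof -
    have p: "0 < psi x" using that by (intro psi_pos) auto
    then show p': "0 < root 3 (psi x)" and p3: "root 3 (psi x) ^ 3 = psi x"
      by auto
    have "((\<lambda>x. root 3 (psi x)) has_real_derivative inverse (real 3 * root 3 (psi x) ^ (3 - Suc 0)) * (x * sin x)) (at x)"
      by (rule DERIV_chain2[OF DERIV_real_root[OF _ p] psi_has_derivative]) simp
    then show "(G has_real_derivative 2 / 3 * sin x * (x / root 3 (psi x) - t / c)) (at x)"
      unfolding G_def using p' c
      by (auto intro!: derivative_eq_intros simp: field_simps power2_eq_square)
  qed
  have "G t \<le> G r"
  proof (cases "r \<le> t")
    case True
    \<comment> \<open>Derivatives are used only inside \<open>(0, pi)\<close>: at 0 the cube root is
      taken at its singular point.\<close>
    show ?thesis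
    proof (rule DERIV_nonpos_imp_decreasing_open[OF True])
      fix x assume x: "r < x" "x < t"
      have x0: "0 < x" "x < pi" using x r t by auto
      have "(x * c) ^ 3 \<le> (t * root 3 (psi x)) ^ 3"
        using cube_div_psi_mono[of x t] x0 x t p[OF x0] c by (simp add: power_mult_distrib)
      then have "x * c \<le> t * root 3 (psi x)"
        by (rule power_le_imp_le_base[where n = 2, unfolded numeral_3_eq_3[symmetric], simplified]) 
          (use t p[OF x0] in auto)
      then have "x / root 3 (psi x) - t / c \<le> 0"
        using p[OF x0] c by (simp add: field_simps)
      then have "2 / 3 * sin x * (x / root 3 (psi x) - t / c) \<le> 0"
        using x0 by (intro mult_nonneg_nonpos) (auto simp: sin_ge_zero)
      then show "\<exists>y. (G has_real_derivative y) (at x) \<and> y \<le> 0"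
        using G'[OF x0] by blast
    qed (rule cG)
  next
    case False
    show ?thesis
    proof (rule DERIV_nonneg_imp_increasing_open[of t r])
      show "t \<le> r" using False by simp
      fix x assume x: "t < x" "x < r"
      have x0: "0 < x" "x < pi" using x r t by auto
      have "(t * root 3 (psi x)) ^ 3 \<le> (x * c) ^ 3"
        using cube_div_psi_mono[of t x] x0 x t p[OF x0] c by (simp add: power_mult_distrib)
      then have "t * root 3 (psi x) \<le> x * c"
        by (rule power_le_imp_le_base[where n = 2, unfolded numeral_3_eq_3[symmetric], simplified])
          (use x0 c in auto)
      then have "0 \<le> x / root 3 (psi x) - t / c"
        using p[OF x0] c by (simp add: field_simps)
      then have "0 \<le> 2 / 3 * sin x * (x / root 3 (psi x) - t / c)"
        using x0 by (intro mult_nonneg_nonneg) (auto simp: sin_ge_zero)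
      then show "\<exists>y. (G has_real_derivative y) (at x) \<and> 0 \<le> y"
        using G'[OF x0] by blast
    qed (rule cG)
  qed
  then show ?thesis
    by (simp add: G_def rt right_diff_distrib)
qed

lemma integral_sin_le:
  assumes "0 \<le> r" "r \<le> pi"
  shows "(\<integral>x. sin x * of_bool (x \<le> r) \<partial>seg 0 pi) = 1 - cos r"
    and "(\<integral>x. x * sin x * of_bool (x \<le> r) \<partial>seg 0 pi) = psi r"
proof -
  have *: "(\<integral>x. g x * of_bool (x \<le> r) \<partial>seg 0 pi) = G r - G 0"
    if [measurable]: "g \<in> borel_measurable borel"
      and G: "\<And>x. (G has_real_derivative g x) (at x)" and B: "\<And>x. x \<in> {0..pi} \<Longrightarrow> \<bar>g x\<bar> \<le> B"
    for g G B
  proof (rule integral_seg_eq[where M = B])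
    have "(g has_integral G r - G 0) {0..r}"
      using assms G
      by (intro fundamental_theorem_of_calculus)
        (auto simp: has_real_derivative_iff_has_vector_derivative[symmetric] intro: DERIV_subset)
    then have "((\<lambda>x. g x * of_bool (x \<le> r)) has_integral G r - G 0) {0..r}"
      by (rule has_integral_eq[rotated]) auto
    moreover have "((\<lambda>x. g x * of_bool (x \<le> r)) has_integral 0) {r..pi}"
      by (rule has_integral_spike_finite[where S = "{r}", OF _ _ has_integral_0]) auto
    ultimately show "((\<lambda>x. g x * of_bool (x \<le> r)) has_integral G r - G 0) {0..pi}"
      using has_integral_combine[of 0 r pi] assms by fastforce
    show "\<bar>g x * of_bool (x \<le> r)\<bar> \<le> B" if "x \<in> {0..pi}" for x
      using B[OF that] abs_ge_zero[of "g x"] by auto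
  qed measurable
  have "((\<lambda>x. - cos x) has_real_derivative sin x) (at x)" for x :: real
    using DERIV_minus[OF DERIV_cos, of x] by simp
  then show "(\<integral>x. sin x * of_bool (x \<le> r) \<partial>seg 0 pi) = 1 - cos r"
    using *[of sin "\<lambda>x. - cos x" 1] by simp
  have "\<bar>x * sin x\<bar> \<le> pi * 1" if "x \<in> {0..pi}" for x
    unfolding abs_mult using that by (intro mult_mono) auto
  then show "(\<integral>x. x * sin x * of_bool (x \<le> r) \<partial>seg 0 pi) = psi r"
    using *[of "\<lambda>x. x * sin x" psi pi] by (auto intro!: psi_has_derivative simp: psi_def)
qed

text \<open>The density is compared with the indicator of the interval \<open>[0, r]\<close> of equal mass.\<close>

lemma bathtub_tangent:
  fixes arc_density :: "real \<Rightarrow> real"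
  assumes [measurable]: "arc_density \<in> borel_measurable borel" and arc_density: "\<And>x. 0 \<le> arc_density x" "\<And>x. arc_density x \<le> 1"
    and t: "0 < t" "t \<le> pi" and c: "0 < c" "c ^ 3 = psi t"
  shows "c\<^sup>2 + 2 * t / (3 * c) * ((\<integral>x. sin x * arc_density x \<partial>seg 0 pi) - (1 - cos t))
    \<le> (root 3 (\<integral>x. x * sin x * arc_density x \<partial>seg 0 pi))\<^sup>2"
proof -
  define m where "m = (\<integral>x. sin x * arc_density x \<partial>seg 0 pi)"
  define F where "F = (\<integral>x. x * sin x * arc_density x \<partial>seg 0 pi)"
  have int: "integrable (seg 0 pi) (\<lambda>x. g x * sin x * w x)"
    if [measurable]: "w \<in> borel_measurable borel" "g \<in> borel_measurable borel"
      and w: "\<And>x. 0 \<le> w x" "\<And>x. w x \<le> 1" and g: "\<And>x. x \<in> {0..pi} \<Longrightarrow> \<bar>g x\<bar> \<le> 4" for w g :: "real \<Rightarrow> real"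
  proof (rule integrable_seg)
    show "\<bar>g x * sin x * w x\<bar> \<le> 4 * 1 * 1" if "x \<in> {0..pi}" for x
      unfolding abs_mult using w[of x] g[OF that] by (intro mult_mono) auto
  qed measurable
  have pi4: "\<bar>x\<bar> \<le> 4" if "x \<in> {0..pi}" for x
    using that pi_less_4 by auto
  have i1: "integrable (seg 0 pi) (\<lambda>x. sin x * w x)" "integrable (seg 0 pi) (\<lambda>x. x * sin x * w x)"
    if "w \<in> borel_measurable borel" "\<And>x. 0 \<le> w x" "\<And>x. w x \<le> 1" for w
    using int[of w "\<lambda>_. 1", OF that(1) _ that(2,3)] int[of w "\<lambda>x. x", OF that(1) _ that(2,3) pi4] by auto
  have m0: "0 \<le> m"
    unfolding m_def
  proof (rule integral_nonneg_AE)
    show "AE x in seg 0 pi. 0 \<le> sin x * arc_density x"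
      using AE_seg[of 0 pi] by eventually_elim (use arc_density in \<open>auto intro!: mult_nonneg_nonneg sin_ge_zero\<close>)
  qed
  have m2: "m \<le> 2"
  proof -
    have "m \<le> (\<integral>x. sin x * of_bool (x \<le> pi) \<partial>seg 0 pi)"
      unfolding m_def
    proof (rule integral_mono_AE)
      show "AE x in seg 0 pi. sin x * arc_density x \<le> sin x * of_bool (x \<le> pi)"
        using AE_seg[of 0 pi] by eventually_elim (use arc_density in \<open>auto intro!: mult_left_le sin_ge_zero\<close>)
    qed (use arc_density in \<open>auto intro!: i1\<close>)
    then show ?thesis
      by (simp add: integral_sin_le)
  qed
  define r where "r = arccos (1 - m)"
  have r: "0 \<le> r" "r \<le> pi" "cos r = 1 - m"
    using m0 m2 by (auto simp: r_def arccos_lbound arccos_ubound)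
  let ?w = "\<lambda>x. of_bool (x \<le> r) :: real"
  \<comment> \<open>Since the density lies in \<open>[0, 1]\<close>, both \<open>x - r\<close> and
    \<open>arc_density x - ?w x\<close> are nonpositive up to \<open>r\<close> and nonnegative
    beyond. Equal masses then cancel the part multiplied by \<open>r\<close>.\<close>
  have "0 \<le> (\<integral>x. (x - r) * sin x * (arc_density x - ?w x) \<partial>seg 0 pi)"
  proof (rule integral_nonneg_AE)
    have "0 \<le> (x - r) * sin x * (arc_density x - ?w x)" if "x \<in> {0..pi}" for x
    proof (cases "x \<le> r")
      case True
      then have "0 \<le> (r - x) * sin x * (1 - arc_density x)"
        using that arc_density[of x] by (intro mult_nonneg_nonneg sin_ge_zero) auto
      then show ?thesis using True by (simp add: algebra_simps)
    next
      case False
      then show ?thesis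
        using that arc_density[of x] by (auto intro!: mult_nonneg_nonneg sin_ge_zero)
    qed
    then show "AE x in seg 0 pi. 0 \<le> (x - r) * sin x * (arc_density x - ?w x)"
      by (intro eventually_mono[OF AE_seg[of 0 pi]])
  qed
  also have "(\<integral>x. (x - r) * sin x * (arc_density x - ?w x) \<partial>seg 0 pi)
    = (\<integral>x. (x * sin x * arc_density x - x * sin x * ?w x) - r * (sin x * arc_density x - sin x * ?w x) \<partial>seg 0 pi)"
    by (intro Bochner_Integration.integral_cong refl) (simp add: algebra_simps)
  also have "\<dots> = (F - psi r) - r * (m - (1 - cos r))"
    unfolding F_def m_def using arc_density r
    by (simp add: i1 integral_sin_le)
  finally have "psi r \<le> F"
    using r by simp
  then have "(root 3 (psi r))\<^sup>2 \<le> (root 3 F)\<^sup>2"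
    using psi_nonneg[OF r(1,2)] by (intro power_mono) auto
  moreover have "c\<^sup>2 + 2 * t / (3 * c) * (cos t - cos r) \<le> (root 3 (psi r))\<^sup>2"
    by (rule psi_tangent[OF t r(1,2) c])
  moreover have "cos t - cos r = m - (1 - cos t)"
    using r by simp
  ultimately show ?thesis
    by (simp add: m_def F_def)
qed

text \<open>Turns \<open>reverse_hls\<close> into a bound affine in \<open>m\<close>, so that only
  the mean of \<open>m\<close> survives averaging over points. Here \<open>m\<close> stands for the
  excess of the \<open>1/\<theta>\<close>-weighted arcs over \<open>1 - cos t\<close>; a cap has
  \<open>m = 0\<close> and \<open>f = c^3\<close>.\<close>

lemma sin_kernel_lower_bound:
  fixes f m :: "real \<Rightarrow> real"
  assumes [measurable]: "f \<in> borel_measurable borel" "m \<in> borel_measurable borel"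
    and f: "\<And>x. 0 \<le> f x" "\<And>x. f x \<le> M" and m: "\<And>x. \<bar>m x\<bar> \<le> M"
    and c: "0 < c"
    and tangent: "\<And>x. c\<^sup>2 + 2 * t / (3 * c) * m x \<le> (root 3 (f x))\<^sup>2"
  shows "2 * pi * (c ^ 3)\<^sup>2 + 4 * t * c ^ 3 * (\<integral>x. m x \<partial>seg 0 pi)
    \<le> (\<integral>u. \<integral>v. f u * f v * \<bar>sin (u - v)\<bar> \<partial>seg 0 pi \<partial>seg 0 pi)"
proof -
  define q where "q x = root 3 (f x)" for x
  have [measurable]: "q \<in> borel_measurable borel"
    unfolding q_def by measurable
  have q: "0 \<le> q x" "q x \<le> root 3 M" "q x ^ 3 = f x" for x
    using f[of x] by (auto simp: q_def)
  define X where "X = (\<integral>x. (q x)\<^sup>2 \<partial>seg 0 pi)"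
  define D where "D = (\<integral>x. m x \<partial>seg 0 pi)"
  define I where "I = (\<integral>u. \<integral>v. f u * f v * \<bar>sin (u - v)\<bar> \<partial>seg 0 pi \<partial>seg 0 pi)"
  have "X ^ 3 \<le> pi\<^sup>2 / 2 * I"
    using reverse_hls[of q "root 3 M"] q by (simp add: X_def I_def)
  \<comment> \<open>Tangent of \<open>X^3\<close> at \<open>pi * c^2\<close>, the value of
    \<open>X\<close> when \<open>q\<close> is constantly \<open>c\<close>.\<close>
  moreover have "3 * (pi * c\<^sup>2)\<^sup>2 * X - 2 * (pi * c\<^sup>2) ^ 3 \<le> X ^ 3"
  proof -
    have "0 \<le> (X - pi * c\<^sup>2)\<^sup>2 * (X + 2 * (pi * c\<^sup>2))"
      by (auto intro!: mult_nonneg_nonneg add_nonneg_nonneg simp: X_def)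
    then show ?thesis
      by (simp add: power2_eq_square power3_eq_cube algebra_simps)
  qed
  moreover have "pi * c\<^sup>2 + 2 * t / (3 * c) * D \<le> X"
  proof -
    have i: "integrable (seg 0 pi) m"
      by (rule integrable_seg[where M = M]) (use m in auto)
    have "pi * c\<^sup>2 + 2 * t / (3 * c) * D = (\<integral>x. c\<^sup>2 + 2 * t / (3 * c) * m x \<partial>seg 0 pi)"
      by (subst Bochner_Integration.integral_add[OF finite_measure.integrable_const[OF finite_measure_seg] integrable_mult_right[OF i]])
        (simp only: integral_seg_const[OF pi_ge_zero] integral_mult_right_zero D_def diff_zero)
    also have "\<dots> \<le> X"
      unfolding X_def
    proof (rule Bochner_Integration.integral_mono)
      show "integrable (seg 0 pi) (\<lambda>x. (q x)\<^sup>2)"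
        by (rule integrable_seg[where M = "(root 3 M)\<^sup>2"]) (use q in \<open>auto intro!: power_mono\<close>)
      show "integrable (seg 0 pi) (\<lambda>x. c\<^sup>2 + 2 * t / (3 * c) * m x)"
        by (intro Bochner_Integration.integrable_add finite_measure.integrable_const integrable_mult_right i) simp
    qed (use tangent in \<open>simp add: q_def\<close>)
    finally show ?thesis .
  qed
  ultimately have "3 * (pi * c\<^sup>2)\<^sup>2 * (pi * c\<^sup>2 + 2 * t / (3 * c) * D) - 2 * (pi * c\<^sup>2) ^ 3 \<le> pi\<^sup>2 / 2 * I"
    by (smt (verit) mult_left_mono zero_le_power2)
  also have "3 * (pi * c\<^sup>2)\<^sup>2 * (pi * c\<^sup>2 + 2 * t / (3 * c) * D) - 2 * (pi * c\<^sup>2) ^ 3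
      = pi\<^sup>2 / 2 * (2 * pi * (c ^ 3)\<^sup>2 + 4 * t * c ^ 3 * D)"
    using c by (simp add: field_simps power2_eq_square power3_eq_cube)
  finally show ?thesis
    by (simp add: I_def D_def)
qed

section \<open>Periodic integrals and polar coordinates\<close>

lemma AE_seg_open: "AE x in seg a b. x \<in> {a<..<b}"
proof -
  have "AE x in lborel. x \<in> {a..b} \<longrightarrow> x \<in> {a<..<b}"
    using AE_lborel_singleton[of a] AE_lborel_singleton[of b]
    by eventually_elim auto
  then have "AE x in lborel. (0 :: ennreal) < indicator {a..b} x \<longrightarrow> x \<in> {a<..<b}"
    by eventually_elim (simp add: indicator_def)
  then show ?thesis
    unfolding seg_def by (subst AE_density) simp_all
qed

lemma nn_integral_seg_translate:
  assumes [measurable]: "f \<in> borel_measurable borel"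
  shows "(\<integral>\<^sup>+x. f (x + t) \<partial>seg a b) = (\<integral>\<^sup>+x. f x \<partial>seg (a + t) (b + t))"
proof -
  have "(\<integral>\<^sup>+x. f x \<partial>seg (a + t) (b + t)) = (\<integral>\<^sup>+x. f (t + 1 * x) * indicator {a + t..b + t} (t + 1 * x) \<partial>lborel)"
    using nn_integral_real_affine[of "\<lambda>x. f x * indicator {a + t..b + t} x" 1 t] by (simp add: nn_integral_seg)
  also have "\<dots> = (\<integral>\<^sup>+x. f (x + t) * indicator {a..b} x \<partial>lborel)"
    by (intro nn_integral_cong) (auto simp: indicator_def add.commute)
  finally show ?thesis
    by (simp add: nn_integral_seg)
qed

lemma nn_integral_seg_reflect:
  assumes [measurable]: "f \<in> borel_measurable borel"
  shows "(\<integral>\<^sup>+x. f (- x) \<partial>seg a b) = (\<integral>\<^sup>+x. f x \<partial>seg (- b) (- a))"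
proof -
  have "(\<integral>\<^sup>+x. f x \<partial>seg (- b) (- a)) = (\<integral>\<^sup>+x. f (0 + (-1) * x) * indicator {- b..- a} (0 + (-1) * x) \<partial>lborel)"
    using nn_integral_real_affine[of "\<lambda>x. f x * indicator {- b..- a} x" "-1" 0] by (simp add: nn_integral_seg)
  also have "\<dots> = (\<integral>\<^sup>+x. f (- x) * indicator {a..b} x \<partial>lborel)"
    by (intro nn_integral_cong) (auto simp: indicator_def)
  finally show ?thesis
    by (simp add: nn_integral_seg)
qed

lemma nn_integral_seg_split:
  assumes [measurable]: "f \<in> borel_measurable borel" and "a \<le> b" "b \<le> c"
  shows "(\<integral>\<^sup>+x. f x \<partial>seg a c) = (\<integral>\<^sup>+x. f x \<partial>seg a b) + (\<integral>\<^sup>+x. f x \<partial>seg b c)"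
proof -
  have "(\<integral>\<^sup>+x. f x \<partial>seg a c)
      = (\<integral>\<^sup>+x. f x * indicator {a..b} x + f x * indicator {b..c} x \<partial>lborel)"
    unfolding nn_integral_seg[OF assms(1)]
  proof (rule nn_integral_cong_AE)
    have "AE x in lborel. x \<noteq> b"
      by (rule AE_lborel_singleton)
    then show "AE x in lborel. f x * indicator {a..c} x = f x * indicator {a..b} x + f x * indicator {b..c} x"
      by eventually_elim (use assms in \<open>auto simp: indicator_def\<close>)
  qed
  also have "\<dots> = (\<integral>\<^sup>+x. f x \<partial>seg a b) + (\<integral>\<^sup>+x. f x \<partial>seg b c)"
    by (simp add: nn_integral_seg nn_integral_add)
  finally show ?thesis .
qed

lemma nn_integral_seg_shift:
  assumes [measurable]: "f \<in> borel_measurable borel" and per: "\<And>x. f (x + p) = f x" and p: "0 \<le> p"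
    and a: "- p \<le> a" "a \<le> p"
  shows "(\<integral>\<^sup>+x. f x \<partial>seg a (a + p)) = (\<integral>\<^sup>+x. f x \<partial>seg 0 p)"
proof -
  have *: "(\<integral>\<^sup>+x. f x \<partial>seg a (a + p)) = (\<integral>\<^sup>+x. f x \<partial>seg 0 p)" if "0 \<le> a" "a \<le> p" for a
  proof -
    have "(\<integral>\<^sup>+x. f x \<partial>seg p (a + p)) = (\<integral>\<^sup>+x. f x \<partial>seg 0 a)"
      using nn_integral_seg_translate[OF assms(1), where t = p and a = 0 and b = a] by (simp add: per)
    then show ?thesis
      using nn_integral_seg_split[OF assms(1), of a p "a + p"] nn_integral_seg_split[OF assms(1), of 0 a p] that
      by (simp add: add.commute)
  qed
  show ?thesis
  proof (cases "0 \<le> a")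
    case False
    have "(\<integral>\<^sup>+x. f x \<partial>seg a (a + p)) = (\<integral>\<^sup>+x. f (x + p) \<partial>seg a (a + p))"
      by (simp only: per)
    also have "\<dots> = (\<integral>\<^sup>+x. f x \<partial>seg (a + p) (a + p + p))"
      by (rule nn_integral_seg_translate[OF assms(1)])
    also have "\<dots> = (\<integral>\<^sup>+x. f x \<partial>seg 0 p)"
      using False a by (intro *) auto
    finally show ?thesis .
  qed (use * a in auto)
qed

abbreviation circ :: "real measure" where
  "circ \<equiv> seg 0 (2 * pi)"

lemma nn_integral_circ_translate:
  assumes [measurable]: "f \<in> borel_measurable borel" and per: "\<And>x. f (x + 2 * pi) = f x"
    and a: "\<bar>a\<bar> \<le> 2 * pi"
  shows "(\<integral>\<^sup>+x. f (x + a) \<partial>circ) = (\<integral>\<^sup>+x. f x \<partial>circ)"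
  using nn_integral_seg_translate[OF assms(1), where t = a and a = 0 and b = "2 * pi"]
    nn_integral_seg_shift[OF assms(1) per, of a] a by (simp add: add.commute)

lemma nn_integral_circ_reflect:
  assumes [measurable]: "f \<in> borel_measurable borel" and per: "\<And>x. f (x + 2 * pi) = f x"
  shows "(\<integral>\<^sup>+x. f (- x) \<partial>circ) = (\<integral>\<^sup>+x. f x \<partial>circ)"
  using nn_integral_seg_reflect[OF assms(1), of 0 "2 * pi"]
    nn_integral_seg_shift[OF assms(1) per, of "- 2 * pi"] by simp

lemma nn_integral_circ_half:
  assumes [measurable]: "f \<in> borel_measurable borel" and per: "\<And>x. f (x + pi) = f x"
  shows "(\<integral>\<^sup>+x. f x \<partial>circ) = 2 * (\<integral>\<^sup>+x. f x \<partial>seg 0 pi)"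
proof -
  have "(\<integral>\<^sup>+x. f x \<partial>seg pi (2 * pi)) = (\<integral>\<^sup>+x. f x \<partial>seg 0 pi)"
    using nn_integral_seg_translate[OF assms(1), where t = pi and a = 0 and b = pi] by (simp add: per)
  then show ?thesis
    unfolding mult_2[of "\<integral>\<^sup>+x. f x \<partial>seg 0 pi"]
    by (subst nn_integral_seg_split[OF assms(1) pi_ge_zero, of "2 * pi"]) simp_all
qed

lemma nn_integral_circ_even:
  assumes [measurable]: "f \<in> borel_measurable borel" and per: "\<And>x. f (x + 2 * pi) = f x"
    and even: "\<And>x. f (- x) = f x"
  shows "(\<integral>\<^sup>+x. f x \<partial>circ) = 2 * (\<integral>\<^sup>+x. f x \<partial>seg 0 pi)"
proof -
  have "(\<integral>\<^sup>+x. f x \<partial>circ) = (\<integral>\<^sup>+x. f x \<partial>seg (- pi) pi)"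
    using nn_integral_seg_shift[OF assms(1) per, of "- pi"] by simp
  also have "\<dots> = (\<integral>\<^sup>+x. f x \<partial>seg (- pi) 0) + (\<integral>\<^sup>+x. f x \<partial>seg 0 pi)"
    by (rule nn_integral_seg_split) auto
  also have "(\<integral>\<^sup>+x. f x \<partial>seg (- pi) 0) = (\<integral>\<^sup>+x. f x \<partial>seg 0 pi)"
    using nn_integral_seg_reflect[OF assms(1), of 0 pi] by (simp add: even)
  finally show ?thesis
    by (simp only: mult_2[of "\<integral>\<^sup>+x. f x \<partial>seg 0 pi"])
qed

text \<open>Substitution on \<open>[- n, n]\<close>, whose preimage ends at \<open>arctan n\<close>,
  followed by monotone convergence; the end points \<open>- pi/2\<close> and \<open>pi/2\<close> are
  null.\<close>

lemma nn_integral_tan: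
  assumes [measurable]: "f \<in> borel_measurable borel"
  shows "(\<integral>\<^sup>+x. f x \<partial>lborel) = (\<integral>\<^sup>+x. f (tan x) * ennreal (1 / (cos x)\<^sup>2) \<partial>seg (- pi/2) (pi/2))"
proof -
  let ?g = "\<lambda>x. f (tan x) * ennreal (1 / (cos x)\<^sup>2)"
  let ?A = "\<lambda>n::nat. {- arctan (real n)..arctan (real n)}"
  have seq: "(\<integral>\<^sup>+x. f x * indicator {- real n..real n} x \<partial>lborel) = (\<integral>\<^sup>+x. ?g x * indicator (?A n) x \<partial>lborel)" for n
  proof (cases "n = 0")
    case True
    then show ?thesis
      using nn_integral_cong_AE[of "\<lambda>x. f x * indicator {- real n..real n} x" "\<lambda>_. 0" lborel]
        nn_integral_cong_AE[of "\<lambda>x. ?g x * indicator (?A n) x" "\<lambda>_. 0" lborel]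
        eventually_mono[OF AE_lborel_singleton[of 0]] by simp
  next
    case False
    have "(\<integral>\<^sup>+x. f x * indicator {tan (- arctan (real n))..tan (arctan (real n))} x \<partial>lborel)
        = (\<integral>\<^sup>+x. f (tan x) * ennreal (inverse ((cos x)\<^sup>2)) * indicator (?A n) x \<partial>lborel)"
    proof (rule nn_integral_substitution_aux)
      fix x assume "x \<in> ?A n"
      then have "cos x > 0"
        using arctan_ubound[of "real n"] arctan_lbound[of "- real n"]
        by (intro cos_gt_zero_pi) (auto simp: arctan_minus)
      then show "(tan has_real_derivative inverse ((cos x)\<^sup>2)) (at x)"
        by (intro DERIV_tan) auto
    next
      have "cos x \<noteq> 0" if "x \<in> ?A n" for x
        using that arctan_ubound[of "real n"] arctan_lbound[of "- real n"] cos_gt_zero_pi[of x]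
        by (auto simp: arctan_minus)
      then show "continuous_on (?A n) (\<lambda>x. inverse ((cos x)\<^sup>2))"
        by (intro continuous_intros) auto
    qed (use False in auto)
    then show ?thesis
      by (simp add: tan_arctan inverse_eq_divide)
  qed
  have sup1: "(SUP n. f x * indicator {- real n..real n} x) = f x" for x
  proof (rule antisym)
    obtain n :: nat where "\<bar>x\<bar> \<le> real n"
      using real_arch_simple by blast
    then show "f x \<le> (SUP n. f x * indicator {- real n..real n} x)"
      by (intro SUP_upper2[of n]) (auto simp: indicator_def)
  qed (auto intro!: SUP_least simp: indicator_def)
  have sup2: "(SUP n. ?g x * indicator (?A n) x) = ?g x * indicator {- pi/2<..<pi/2} x" for x
  proof (rule antisym)
    show "(SUP n. ?g x * indicator (?A n) x) \<le> ?g x * indicator {- pi/2<..<pi/2} x"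
    proof (rule SUP_least)
      fix n :: nat
      have "?A n \<subseteq> {- pi/2<..<pi/2}"
        using arctan_bounded[of "real n"] by auto
      then show "?g x * indicator (?A n) x \<le> ?g x * indicator {- pi/2<..<pi/2} x"
        by (auto simp: indicator_def)
    qed
    show "?g x * indicator {- pi/2<..<pi/2} x \<le> (SUP n. ?g x * indicator (?A n) x)"
    proof (cases "x \<in> {- pi/2<..<pi/2}")
      case True
      obtain n :: nat where n: "\<bar>tan x\<bar> \<le> real n"
        using real_arch_simple by blast
      have "arctan (tan x) = x"
        using True by (intro arctan_tan) auto
      then have "x \<le> arctan (real n)" "- arctan (real n) \<le> x"
        using n arctan_le_iff[of "tan x" "real n"] arctan_le_iff[of "- real n" "tan x"]
        by (auto simp: arctan_minus)
      then show ?thesis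
        by (intro SUP_upper2[of n]) (auto simp: indicator_def)
    qed simp
  qed
  have "(\<integral>\<^sup>+x. f x \<partial>lborel) = (\<integral>\<^sup>+x. (SUP n. f x * indicator {- real n..real n} x) \<partial>lborel)"
    by (simp add: sup1)
  also have "\<dots> = (SUP n. \<integral>\<^sup>+x. f x * indicator {- real n..real n} x \<partial>lborel)"
    by (intro nn_integral_monotone_convergence_SUP) (auto simp: incseq_def le_fun_def indicator_def)
  also have "\<dots> = (SUP n. \<integral>\<^sup>+x. ?g x * indicator (?A n) x \<partial>lborel)"
    by (simp only: seq)
  also have "\<dots> = (\<integral>\<^sup>+x. (SUP n. ?g x * indicator (?A n) x) \<partial>lborel)"
  proof (intro nn_integral_monotone_convergence_SUP[symmetric])
    show "incseq (\<lambda>n x. ?g x * indicator (?A n) x)"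
    proof (intro incseq_SucI le_funI)
      fix n :: nat and x
      have "arctan (real n) \<le> arctan (real (Suc n))"
        by (simp add: arctan_le_iff)
      then show "?g x * indicator (?A n) x \<le> ?g x * indicator (?A (Suc n)) x"
        by (auto simp: indicator_def)
    qed
  qed (unfold tan_def, measurable)
  also have "\<dots> = (\<integral>\<^sup>+x. ?g x * indicator {- pi/2..pi/2} x \<partial>lborel)"
    unfolding sup2
  proof (rule nn_integral_cong_AE)
    show "AE x in lborel. ?g x * indicator {- pi/2<..<pi/2} x = ?g x * indicator {- pi/2..pi/2} x"
      using AE_lborel_singleton[of "- pi/2"] AE_lborel_singleton[of "pi/2"]
      by eventually_elim (auto simp: indicator_def)
  qed
  also have "\<dots> = (\<integral>\<^sup>+x. ?g x \<partial>seg (- pi/2) (pi/2))"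
    by (rule nn_integral_seg[symmetric]) (unfold tan_def, measurable)
  finally show ?thesis .
qed

text \<open>Polar coordinates with a signed radius over a half turn: first \<open>y = x * t\<close>
  with slope \<open>t\<close>, then the slope becomes a tangent and \<open>x = r * cos t\<close>.
  The signed radius avoids a case split by quadrant.\<close>

lemma nn_integral_polar:
  fixes f :: "real \<times> real \<Rightarrow> ennreal"
  assumes [measurable]: "f \<in> borel_measurable (borel \<Otimes>\<^sub>M borel)"
  shows "(\<integral>\<^sup>+x. \<integral>\<^sup>+y. f (x, y) \<partial>lborel \<partial>lborel)
    = (\<integral>\<^sup>+t. \<integral>\<^sup>+r. ennreal \<bar>r\<bar> * f (r * cos t, r * sin t) \<partial>lborel \<partial>seg (- pi/2) (pi/2))"
proof -
  have "(\<integral>\<^sup>+x. \<integral>\<^sup>+y. f (x, y) \<partial>lborel \<partial>lborel) = (\<integral>\<^sup>+x. \<integral>\<^sup>+t. ennreal \<bar>x\<bar> * f (x, x * t) \<partial>lborel \<partial>lborel)"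
  proof (rule nn_integral_cong_AE)
    show "AE x in lborel. (\<integral>\<^sup>+y. f (x, y) \<partial>lborel) = (\<integral>\<^sup>+t. ennreal \<bar>x\<bar> * f (x, x * t) \<partial>lborel)"
      using AE_lborel_singleton[of 0]
    proof eventually_elim
      case (elim x)
      then show ?case
        using nn_integral_real_affine[of "\<lambda>y. f (x, y)" x 0] by (simp add: nn_integral_cmult)
    qed
  qed
  also have "\<dots> = (\<integral>\<^sup>+t. \<integral>\<^sup>+x. ennreal \<bar>x\<bar> * f (x, x * t) \<partial>lborel \<partial>lborel)"
    by (rule lborel_pair.Fubini') measurable
  also have "\<dots> = (\<integral>\<^sup>+t. (\<integral>\<^sup>+x. ennreal \<bar>x\<bar> * f (x, x * tan t) \<partial>lborel) * ennreal (1 / (cos t)\<^sup>2) \<partial>seg (- pi/2) (pi/2))"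
    by (rule nn_integral_tan[of "\<lambda>t. \<integral>\<^sup>+x. ennreal \<bar>x\<bar> * f (x, x * t) \<partial>lborel"]) measurable
  also have "\<dots> = (\<integral>\<^sup>+t. \<integral>\<^sup>+r. ennreal \<bar>r\<bar> * f (r * cos t, r * sin t) \<partial>lborel \<partial>seg (- pi/2) (pi/2))"
  proof (rule nn_integral_cong_AE)
    have *: "(\<integral>\<^sup>+x. ennreal \<bar>x\<bar> * f (x, x * tan t) \<partial>lborel) * ennreal (1 / (cos t)\<^sup>2)
        = (\<integral>\<^sup>+r. ennreal \<bar>r\<bar> * f (r * cos t, r * sin t) \<partial>lborel)" if "t \<in> {- pi/2<..<pi/2}" for t
    proof -
      have c: "cos t > 0" using that by (intro cos_gt_zero_pi) auto
      have "(\<integral>\<^sup>+x. ennreal \<bar>x\<bar> * f (x, x * tan t) \<partial>lborel)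
          = ennreal (cos t) * (\<integral>\<^sup>+r. ennreal (cos t * \<bar>r\<bar>) * f (r * cos t, r * sin t) \<partial>lborel)"
      proof -
        have "(\<integral>\<^sup>+x. ennreal \<bar>x\<bar> * f (x, x * tan t) \<partial>lborel)
            = ennreal \<bar>cos t\<bar> * (\<integral>\<^sup>+r. ennreal \<bar>0 + cos t * r\<bar> * f (0 + cos t * r, (0 + cos t * r) * tan t) \<partial>lborel)"
          using c by (intro nn_integral_real_affine) auto
        then show ?thesis
          using c by (simp add: tan_def abs_mult mult.commute)
      qed
      also have "\<dots> = ennreal ((cos t)\<^sup>2) * (\<integral>\<^sup>+r. ennreal \<bar>r\<bar> * f (r * cos t, r * sin t) \<partial>lborel)"
        using c by (simp add: ennreal_mult nn_integral_cmult mult.assoc power2_eq_square)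
      finally show ?thesis
        using c by (simp add: mult.commute[of _ "ennreal (1 / _)"] mult.assoc[symmetric] ennreal_mult[symmetric])
    qed
    have "AE t in seg (- pi/2) (pi/2). t \<in> {- pi/2<..<pi/2}"
      by (rule AE_seg_open)
    then show "AE t in seg (- pi/2) (pi/2). (\<integral>\<^sup>+x. ennreal \<bar>x\<bar> * f (x, x * tan t) \<partial>lborel) * ennreal (1 / (cos t)\<^sup>2)
        = (\<integral>\<^sup>+r. ennreal \<bar>r\<bar> * f (r * cos t, r * sin t) \<partial>lborel)"
      by eventually_elim (rule *)
  qed
  finally show ?thesis .
qed

section \<open>Rotations of three-space\<close>

lemma continuous_on_vector_3 [continuous_intros]:
  fixes a b c :: "'b::topological_space \<Rightarrow> 'a::{zero, topological_space}"
  assumes "continuous_on S a" "continuous_on S b" "continuous_on S c"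
  shows "continuous_on S (\<lambda>x. vector [a x, b x, c x] :: 'a^3)"
proof -
  have eq: "(vector [p, q, r] :: 'a^3) = (\<chi> i. if i = 1 then p else if i = 2 then q else r)"
    for p q r :: 'a
    by (simp add: vec_eq_iff forall_3)
  show ?thesis
    unfolding eq
  proof (rule continuous_on_vec_lambda)
    fix i :: 3
    show "continuous_on S (\<lambda>x. if i = 1 then a x else if i = 2 then b x else c x)"
      using assms by (cases "i = 1"; cases "i = 2") simp_all
  qed
qed

lemma borel_measurable_vector_3 [measurable (raw)]:
  fixes a b c :: "'b \<Rightarrow> 'a::{zero, second_countable_topology}"
  assumes [measurable]: "a \<in> borel_measurable M" "b \<in> borel_measurable M" "c \<in> borel_measurable M"
  shows "(\<lambda>x. vector [a x, b x, c x] :: 'a^3) \<in> borel_measurable M"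
proof -
  have "(\<lambda>x. (\<lambda>p q. vector [fst p, snd p, q] :: 'a^3) (a x, b x) (c x)) \<in> borel_measurable M"
    by (rule borel_measurable_continuous_Pair) (auto intro!: continuous_intros)
  then show ?thesis by simp
qed

lemma borel_measurable_matrix_mult [measurable (raw)]:
  fixes A B :: "'b \<Rightarrow> real^3^3"
  assumes [measurable]: "A \<in> borel_measurable M" "B \<in> borel_measurable M"
  shows "(\<lambda>x. A x ** B x) \<in> borel_measurable M"
  by (rule borel_measurable_continuous_Pair)
    (auto simp: matrix_matrix_mult_def intro!: continuous_intros)

lemma borel_measurable_matrix_vector_mult [measurable (raw)]:
  fixes A :: "'b \<Rightarrow> real^3^3"
  assumes [measurable]: "A \<in> borel_measurable M" "v \<in> borel_measurable M"
  shows "(\<lambda>x. A x *v v x) \<in> borel_measurable M"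
  by (rule borel_measurable_continuous_Pair)
    (auto simp: matrix_vector_mult_def intro!: continuous_intros)

lemma borel_measurable_transpose [measurable]: "(transpose :: real^3^3 \<Rightarrow> _) \<in> borel_measurable borel"
  by (rule borel_measurable_continuous_onI) (auto simp: transpose_def intro!: continuous_intros)

lemma borel_measurable_vec_nth [measurable]: "(\<lambda>x::real^3. x $ i) \<in> borel_measurable borel"
  by (rule borel_measurable_continuous_onI) (auto intro!: continuous_intros)

lemma prod_Basis_vec_3: "(\<Prod>b\<in>Basis. g b) = g (axis 1 1) * g (axis 2 1) * g (axis 3 (1::real) :: real^3)"
proof -
  have inj: "inj (\<lambda>i. axis i 1 :: real^3)"
    by (simp add: inj_on_def axis_eq_axis)
  have B: "(Basis :: (real^3) set) = range (\<lambda>i. axis i 1)"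
    by (auto simp: Basis_vec_def)
  have "(\<Prod>b\<in>Basis. g b) = (\<Prod>i\<in>(UNIV::3 set). g (axis i (1::real)))"
    unfolding B prod.reindex[OF inj] o_def ..
  also have "\<dots> = g (axis 1 1) * g (axis 2 1) * g (axis 3 1)"
    unfolding UNIV_3 by (simp add: mult.assoc)
  finally show ?thesis .
qed

lemma lborel_vec_3:
  "(lborel :: (real^3) measure) = distr (lborel \<Otimes>\<^sub>M (lborel \<Otimes>\<^sub>M lborel)) borel (\<lambda>(x, y, z). vector [x, y, z])"
proof (rule lborel_eqI)
  fix l u :: "real^3" assume le: "\<And>b. b \<in> Basis \<Longrightarrow> l \<bullet> b \<le> u \<bullet> b"
  have le': "l $ i \<le> u $ i" for i
    using le[of "axis i 1"] by (simp add: inner_axis)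
  have box: "(\<lambda>(x, y, z). vector [x, y, z]) -` box l u = box (l $ 1) (u $ 1) \<times> box (l $ 2) (u $ 2) \<times> box (l $ 3) (u $ 3)"
    by (auto simp: mem_box_cart forall_3)
  have s: "sigma_finite_measure (lborel \<Otimes>\<^sub>M lborel :: (real \<times> real) measure)"
    unfolding lborel_prod by (rule sigma_finite_lborel)
  have "emeasure (distr (lborel \<Otimes>\<^sub>M (lborel \<Otimes>\<^sub>M lborel)) borel (\<lambda>(x, y, z). vector [x, y, z])) (box l u)
      = emeasure (lborel \<Otimes>\<^sub>M (lborel \<Otimes>\<^sub>M lborel)) (box (l $ 1) (u $ 1) \<times> box (l $ 2) (u $ 2) \<times> box (l $ 3) (u $ 3))"
    by (subst emeasure_distr) (simp_all add: space_pair_measure box)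
  also have "\<dots> = ennreal (u $ 1 - l $ 1) * (ennreal (u $ 2 - l $ 2) * ennreal (u $ 3 - l $ 3))"
    using le' by (simp add: sigma_finite_measure.emeasure_pair_measure_Times[OF s]
      lborel.emeasure_pair_measure_Times)
  also have "\<dots> = (\<Prod>b\<in>Basis. (u - l) \<bullet> b)"
    using le' by (simp add: prod_Basis_vec_3 inner_axis ennreal_mult mult.assoc)
  finally show "emeasure (distr (lborel \<Otimes>\<^sub>M (lborel \<Otimes>\<^sub>M lborel)) borel (\<lambda>(x, y, z). vector [x, y, z])) (box l u)
      = (\<Prod>b\<in>Basis. (u - l) \<bullet> b)" .
qed simp

lemma nn_integral_lborel_vec_3:
  fixes f :: "real^3 \<Rightarrow> ennreal"
  assumes [measurable]: "f \<in> borel_measurable borel"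
  shows "(\<integral>\<^sup>+x. f x \<partial>lborel) = (\<integral>\<^sup>+x. \<integral>\<^sup>+y. \<integral>\<^sup>+z. f (vector [x, y, z]) \<partial>lborel \<partial>lborel \<partial>lborel)"
proof -
  have s: "sigma_finite_measure (lborel \<Otimes>\<^sub>M lborel :: (real \<times> real) measure)"
    unfolding lborel_prod by (rule sigma_finite_lborel)
  have "(\<integral>\<^sup>+x. f x \<partial>lborel) = (\<integral>\<^sup>+(x, y, z). f (vector [x, y, z]) \<partial>(lborel \<Otimes>\<^sub>M (lborel \<Otimes>\<^sub>M lborel)))"
    by (subst lborel_vec_3, subst nn_integral_distr) (simp_all add: case_prod_beta')
  also have "\<dots> = (\<integral>\<^sup>+x. \<integral>\<^sup>+p. (case p of (y, z) \<Rightarrow> f (vector [x, y, z])) \<partial>(lborel \<Otimes>\<^sub>M lborel) \<partial>lborel)"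
    by (subst sigma_finite_measure.nn_integral_fst[OF s, symmetric]) auto
  also have "\<dots> = (\<integral>\<^sup>+x. \<integral>\<^sup>+y. \<integral>\<^sup>+z. f (vector [x, y, z]) \<partial>lborel \<partial>lborel \<partial>lborel)"
    by (subst lborel.nn_integral_fst[symmetric]) auto
  finally show ?thesis .
qed

text \<open>Roles relative to the great circle \<open>zeta\<close> and its base point
  \<open>zeta 0\<close>: \<open>rotz\<close> slides along the circle, \<open>rotx\<close> turns the
  direction at the base point. The products \<open>rotz s ** rotx p ** rotz c\<close> are Euler
  angles.\<close>

definition rotz :: "real \<Rightarrow> real^3^3" where
  "rotz s = vector [vector [cos s, - sin s, 0], vector [sin s, cos s, 0], vector [0, 0, 1]]"

definition rotx :: "real \<Rightarrow> real^3^3" where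
  "rotx p = vector [vector [1, 0, 0], vector [0, cos p, - sin p], vector [0, sin p, cos p]]"

text \<open>Unit-speed reference great circle. A rotation \<open>R\<close> encodes the point
  \<open>R *v zeta 0\<close> with a direction there, and the arc of length \<open>t\<close> from it
  ends in \<open>R *v zeta t\<close>.\<close>

definition zeta :: "real \<Rightarrow> real^3" where
  "zeta a = vector [cos a, sin a, 0]"

definition e3 :: "real^3" where
  "e3 = vector [0, 0, 1]"

lemmas mat3_simps = vec_eq_iff forall_3 sum_3 matrix_matrix_mult_def matrix_vector_mult_def
  transpose_def

lemma rotz_measurable [measurable]: "rotz \<in> borel_measurable borel"
  unfolding rotz_def[abs_def] by measurable

lemma rotx_measurable [measurable]: "rotx \<in> borel_measurable borel"
  unfolding rotx_def[abs_def] by measurable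

lemma zeta_measurable [measurable]: "zeta \<in> borel_measurable borel"
  unfolding zeta_def[abs_def] by measurable

lemma rotz_add: "rotz a ** rotz b = rotz (a + b)"
  by (simp add: rotz_def mat3_simps sin_add cos_add)

lemma rotx_add: "rotx a ** rotx b = rotx (a + b)"
  by (simp add: rotx_def mat3_simps sin_add cos_add)

lemma rotz_zeta: "rotz a *v zeta b = zeta (a + b)"
  by (simp add: rotz_def zeta_def mat3_simps sin_add cos_add)

lemma rotx_zeta_0: "rotx a *v zeta 0 = zeta 0"
  by (simp add: rotx_def zeta_def mat3_simps)

lemma rotx_pi_zeta: "rotx pi *v zeta a = zeta (- a)"
  by (simp add: rotx_def zeta_def mat3_simps)

lemma rotz_periodic: "rotz (a + 2 * pi) = rotz a"
  by (simp add: rotz_def)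

lemma rotx_periodic: "rotx (a + 2 * pi) = rotx a"
  by (simp add: rotx_def)

lemma zeta_periodic: "zeta (a + 2 * pi) = zeta a"
  by (simp add: zeta_def)

lemma rotz_0: "rotz 0 = mat 1"
  by (simp add: rotz_def mat3_simps mat_def)

lemma rotation_matrix_rotz: "rotation_matrix (rotz s)"
  by (simp add: rotation_matrix_def orthogonal_matrix_def det_3 rotz_def mat3_simps mat_def
    power2_eq_square[symmetric])

lemma rotation_matrix_rotx: "rotation_matrix (rotx s)"
  by (simp add: rotation_matrix_def orthogonal_matrix_def det_3 rotx_def mat3_simps mat_def
    power2_eq_square[symmetric])

lemma rotation_matrix_mult: "rotation_matrix A \<Longrightarrow> rotation_matrix B \<Longrightarrow> rotation_matrix (A ** B)"
  for A B :: "real^'n^'n"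
  by (simp add: rotation_matrix_def orthogonal_matrix_mul det_mul)

lemma rotation_matrix_transpose: "rotation_matrix (transpose A) \<longleftrightarrow> rotation_matrix A"
  for A :: "real^'n^'n"
  by (simp add: rotation_matrix_def det_transpose)

lemma rotation_matrix_cancel:
  fixes A B :: "real^'n^'n"
  assumes "rotation_matrix A"
  shows "transpose A ** (A ** B) = B" "A ** (transpose A ** B) = B"
    "transpose A *v (A *v x) = x" "A *v (transpose A *v x) = x"
  using assms by (simp_all add: rotation_matrix_def orthogonal_matrix_def matrix_mul_assoc
    matrix_vector_mul_assoc del: transpose_matrix_vector)

lemma rotation_matrix_inner:
  fixes A :: "real^'n^'n"
  assumes "rotation_matrix A"
  shows "(A *v x) \<bullet> (A *v y) = x \<bullet> y"
proof -
  have "orthogonal_transformation ((*v) A)"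
    using assms by (simp add: orthogonal_transformation_matrix rotation_matrix_def)
  then show ?thesis
    by (simp add: orthogonal_transformation_def)
qed

lemma rotation_matrix_norm: "rotation_matrix A \<Longrightarrow> norm (A *v x) = norm x"
  for A :: "real^'n^'n"
  by (simp add: norm_eq_sqrt_inner rotation_matrix_inner)

text \<open>The stabiliser of \<open>e3\<close>; hence two rotations with the same third axis differ
  by a factor \<open>rotz a\<close> on the right.\<close>

lemma rotation_matrix_fix_e3:
  assumes "rotation_matrix Q" "Q *v e3 = e3"
  obtains a where "0 \<le> a" "a < 2 * pi" "Q = rotz a"
proof -
  have o: "transpose Q ** Q = mat 1" "Q ** transpose Q = mat 1" and d: "det Q = 1"
    using assms by (auto simp: rotation_matrix_def orthogonal_matrix_def)
  have c3: "Q $ 1 $ 3 = 0" "Q $ 2 $ 3 = 0" "Q $ 3 $ 3 = 1"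
    using assms(2) by (auto simp: e3_def mat3_simps)
  have r3: "Q $ 3 $ 1 = 0" "Q $ 3 $ 2 = 0"
  proof -
    have "(Q $ 3 $ 1)\<^sup>2 + (Q $ 3 $ 2)\<^sup>2 + (Q $ 3 $ 3)\<^sup>2 = 1"
      using o(2) by (auto simp: mat3_simps mat_def power2_eq_square)
    then have "(Q $ 3 $ 1)\<^sup>2 + (Q $ 3 $ 2)\<^sup>2 = 0"
      using c3 by simp
    then show "Q $ 3 $ 1 = 0" "Q $ 3 $ 2 = 0"
      by (auto simp: sum_power2_eq_zero_iff)
  qed
  have 1: "(Q $ 1 $ 1)\<^sup>2 + (Q $ 2 $ 1)\<^sup>2 = 1" and 2: "Q $ 1 $ 1 * Q $ 1 $ 2 + Q $ 2 $ 1 * Q $ 2 $ 2 = 0"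
    using o(1) r3 by (auto simp: mat3_simps mat_def power2_eq_square)
  have 3: "Q $ 1 $ 1 * Q $ 2 $ 2 - Q $ 1 $ 2 * Q $ 2 $ 1 = 1"
    using d r3 c3 by (simp add: det_3)
  obtain a where a: "0 \<le> a" "a < 2 * pi" "Q $ 1 $ 1 = cos a" "Q $ 2 $ 1 = sin a"
    using sincos_total_2pi[OF 1] by blast
  have "c = - b" "d = a" if "a\<^sup>2 + b\<^sup>2 = 1" "a * c + b * d = 0" "a * d - c * b = 1" for a b c d :: real
    using that by algebra+
  from this[OF 1 2 3] have "Q $ 1 $ 2 = - Q $ 2 $ 1" "Q $ 2 $ 2 = Q $ 1 $ 1" .
  then have "Q = rotz a"
    using a c3 r3 by (simp add: rotz_def mat3_simps)
  with a that show ?thesis by blast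
qed

lemma spherical_coords: "rotz s *v (rotx p *v e3) = vector [sin s * sin p, - cos s * sin p, cos p]"
  by (simp add: rotz_def rotx_def e3_def mat3_simps)

section \<open>Spherical coordinates\<close>

lemma sets_sphere_unif [measurable_cong]: "sets sphere_unif = sets (restrict_space borel S2)"
  by (simp add: sphere_unif_def sphere_area_def)

lemma space_sphere_unif: "space sphere_unif = S2"
  by (simp add: sphere_unif_def sphere_area_def space_scale_measure space_restrict_space)

lemma nn_integral_sphere_unif_lborel:
  fixes g :: "real^3 \<Rightarrow> ennreal"
  assumes [measurable]: "g \<in> borel_measurable borel"
  shows "(\<integral>\<^sup>+x. g x \<partial>sphere_unif)
    = ennreal (1 / (4 * pi)) * (3 * (\<integral>\<^sup>+x. g (x /\<^sub>R norm x) * indicator (cball 0 1 - {0}) x \<partial>lborel))"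
proof -
  have g: "g \<in> borel_measurable (restrict_space borel S2)"
    by (rule measurable_restrict_space1) simp
  have m: "(\<lambda>x. g (x /\<^sub>R norm x)) \<in> borel_measurable (restrict_space lborel (cball 0 1 - {0}))"
    by (rule measurable_restrict_space1) measurable
  have "(\<integral>\<^sup>+x. g x \<partial>sphere_unif) = ennreal (1 / (4 * pi)) * (\<integral>\<^sup>+x. g x \<partial>sphere_area)"
    unfolding sphere_unif_def
    by (rule nn_integral_scale_measure) (simp add: sphere_area_def g)
  also have "(\<integral>\<^sup>+x. g x \<partial>sphere_area)
      = (\<integral>\<^sup>+x. g (x /\<^sub>R norm x) \<partial>scale_measure 3 (restrict_space lborel (cball 0 1 - {0})))"
    unfolding sphere_area_def by (rule nn_integral_distr[OF normalize_measurable]) (simp add: g)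
  also have "\<dots> = 3 * (\<integral>\<^sup>+x. g (x /\<^sub>R norm x) \<partial>restrict_space lborel (cball 0 1 - {0}))"
    by (rule nn_integral_scale_measure) (rule m)
  also have "(\<integral>\<^sup>+x. g (x /\<^sub>R norm x) \<partial>restrict_space lborel (cball 0 1 - {0}))
      = (\<integral>\<^sup>+x. g (x /\<^sub>R norm x) * indicator (cball 0 1 - {0}) x \<partial>lborel)"
    by (rule nn_integral_restrict_space) simp
  finally show ?thesis .
qed

text \<open>Radial part of signed spherical coordinates: \<open>q > 0\<close> sees a direction and
  \<open>q < 0\<close> its antipode. The factor 1/3 cancels the 3 of the cone formula.\<close>

lemma nn_integral_radial:
  "(\<integral>\<^sup>+q. ennreal (q\<^sup>2) * (a * indicator {0<..1} q + b * indicator {-1..<0} q) \<partial>lborel) = ennreal (1 / 3) * (a + b)"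
proof -
  have pos: "(\<integral>\<^sup>+q. ennreal (q\<^sup>2) * indicator {0<..1::real} q \<partial>lborel) = ennreal (1 / 3)"
  proof -
    have "(\<integral>\<^sup>+q. ennreal (q\<^sup>2) * indicator {0<..1::real} q \<partial>lborel) = (\<integral>\<^sup>+q. ennreal (q\<^sup>2) * indicator {0..1::real} q \<partial>lborel)"
      by (intro nn_integral_cong) (auto simp: indicator_def)
    also have "\<dots> = ennreal (1 ^ 3 / 3 - 0 ^ 3 / 3)"
      by (rule nn_integral_FTC_Icc[where F = "\<lambda>q. q ^ 3 / 3"])
        (auto intro!: derivative_eq_intros)
    finally show ?thesis by simp
  qed
  have neg: "(\<integral>\<^sup>+q. ennreal (q\<^sup>2) * indicator {-1..<0::real} q \<partial>lborel) = ennreal (1 / 3)"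
  proof -
    have "(\<integral>\<^sup>+q. ennreal (q\<^sup>2) * indicator {-1..<0::real} q \<partial>lborel) = (\<integral>\<^sup>+q. ennreal (q\<^sup>2) * indicator {-1..0::real} q \<partial>lborel)"
      by (intro nn_integral_cong) (auto simp: indicator_def)
    also have "\<dots> = ennreal (0 ^ 3 / 3 - (-1) ^ 3 / 3)"
      by (rule nn_integral_FTC_Icc[where F = "\<lambda>q. q ^ 3 / 3"])
        (auto intro!: derivative_eq_intros)
    finally show ?thesis by simp
  qed
  have "(\<integral>\<^sup>+q. ennreal (q\<^sup>2) * (a * indicator {0<..1} q + b * indicator {-1..<0} q) \<partial>lborel)
      = (\<integral>\<^sup>+q. a * (ennreal (q\<^sup>2) * indicator {0<..1} q) + b * (ennreal (q\<^sup>2) * indicator {-1..<0} q) \<partial>lborel)"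
    by (simp only: distrib_left mult.left_commute mult.assoc)
  also have "\<dots> = a * ennreal (1 / 3) + b * ennreal (1 / 3)"
    by (subst nn_integral_add) (simp_all add: nn_integral_cmult pos neg)
  also have "\<dots> = ennreal (1 / 3) * (a + b)"
    by (simp only: distrib_right[symmetric] mult.commute)
  finally show ?thesis .
qed

definition sph_pt :: "real \<Rightarrow> real \<Rightarrow> real^3" where
  "sph_pt s p = rotz s *v (rotx p *v e3)"

lemma sph_pt_eq: "sph_pt s p = vector [sin s * sin p, - cos s * sin p, cos p]"
  unfolding sph_pt_def by (rule spherical_coords)

lemma sph_pt_measurable [measurable (raw)]:
  assumes [measurable]: "f \<in> borel_measurable M" "g \<in> borel_measurable M"
  shows "(\<lambda>x. sph_pt (f x) (g x)) \<in> borel_measurable M"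
  unfolding sph_pt_eq by measurable

lemma norm_sph_pt: "norm (sph_pt s p) = 1"
proof -
  have "norm (sph_pt s p) = norm e3"
    by (simp add: sph_pt_def rotation_matrix_norm rotation_matrix_rotx rotation_matrix_rotz)
  also have "\<dots> = 1"
    by (simp add: e3_def norm_vec_def L2_set_def sum_3)
  finally show ?thesis .
qed

interpretation seg_lborel: pair_sigma_finite "seg a b" lborel for a b
  by (intro pair_sigma_finite.intro finite_measure.axioms(1) sigma_finite_lborel) simp

interpretation seg_seg: pair_sigma_finite "seg a b" "seg c d" for a b c d
  by (intro pair_sigma_finite.intro finite_measure.axioms(1)) simp_all

text \<open>Both angles run over a full turn, with \<open>|sin p|\<close>, so almost every point is
  covered twice; hence 1/(8 pi) in place of 1/(4 pi). Full turns keep the integrands periodic, which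
  the later shifts and reflections of angles exploit.\<close>

lemma nn_integral_sphere_unif:
  fixes g :: "real^3 \<Rightarrow> ennreal"
  assumes g [measurable]: "g \<in> borel_measurable borel"
  shows "(\<integral>\<^sup>+x. g x \<partial>sphere_unif)
    = ennreal (1 / (8 * pi)) * (\<integral>\<^sup>+s. \<integral>\<^sup>+p. ennreal \<bar>sin p\<bar> * g (sph_pt s p) \<partial>circ \<partial>circ)"
proof -
  let ?T = "seg (- pi/2) (pi/2)"
  define k where "k x = g (x /\<^sub>R norm x) * indicator (cball 0 1 - {0}) x" for x
  have [measurable]: "cball 0 1 - {0 :: real^3} \<in> sets borel"
    by (intro sets.Diff) auto
  have [measurable]: "k \<in> borel_measurable borel"
    unfolding k_def by measurable
  let ?n = "\<lambda>t u. vector [sin u * cos t, sin u * sin t, cos u] :: real^3"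
  define H where "H s = (\<integral>\<^sup>+p. ennreal \<bar>sin p\<bar> * g (sph_pt s p) \<partial>circ)" for s
  have [measurable]: "H \<in> borel_measurable borel"
    unfolding H_def by measurable
  \<comment> \<open>The quarter turn comes from the convention of \<open>sph_pt\<close>, whose
    azimuth is measured from the negative second axis.\<close>
  have n: "?n t u = sph_pt (t + pi/2) u" "- ?n t u = sph_pt (t + pi/2) (u + pi)" for t u
    by (simp_all add: sph_pt_eq vec_eq_iff forall_3 sin_add cos_add mult.commute)
  have "(\<integral>\<^sup>+x. k x \<partial>lborel) = (\<integral>\<^sup>+x. \<integral>\<^sup>+y. \<integral>\<^sup>+z. k (vector [x, y, z]) \<partial>lborel \<partial>lborel \<partial>lborel)"
    by (rule nn_integral_lborel_vec_3) simp
  also have "\<dots> = (\<integral>\<^sup>+x. \<integral>\<^sup>+z. \<integral>\<^sup>+y. k (vector [x, y, z]) \<partial>lborel \<partial>lborel \<partial>lborel)"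
    by (intro nn_integral_cong lborel_pair.Fubini') measurable
  also have "\<dots> = (\<integral>\<^sup>+z. \<integral>\<^sup>+x. \<integral>\<^sup>+y. k (vector [x, y, z]) \<partial>lborel \<partial>lborel \<partial>lborel)"
    by (rule lborel_pair.Fubini') measurable
  also have "\<dots> = (\<integral>\<^sup>+z. \<integral>\<^sup>+t. \<integral>\<^sup>+r. ennreal \<bar>r\<bar> * k (vector [r * cos t, r * sin t, z]) \<partial>lborel \<partial>?T \<partial>lborel)"
  proof (rule nn_integral_cong)
    fix z :: real
    have "(\<lambda>(x, y). k (vector [x, y, z])) \<in> borel_measurable (borel \<Otimes>\<^sub>M borel)"
      by measurable
    from nn_integral_polar[OF this, unfolded split]
    show "(\<integral>\<^sup>+x. \<integral>\<^sup>+y. k (vector [x, y, z]) \<partial>lborel \<partial>lborel)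
      = (\<integral>\<^sup>+t. \<integral>\<^sup>+r. ennreal \<bar>r\<bar> * k (vector [r * cos t, r * sin t, z]) \<partial>lborel \<partial>?T)" .
  qed
  also have "\<dots> = (\<integral>\<^sup>+t. \<integral>\<^sup>+z. \<integral>\<^sup>+r. ennreal \<bar>r\<bar> * k (vector [r * cos t, r * sin t, z]) \<partial>lborel \<partial>lborel \<partial>?T)"
    by (rule seg_lborel.Fubini') measurable
  \<comment> \<open>A second polar change, in the plane of \<open>z\<close> and the signed planar
    radius \<open>r\<close>; the two Jacobians together produce \<open>q^2 |sin u|\<close>.\<close>
  also have "\<dots> = (\<integral>\<^sup>+t. \<integral>\<^sup>+u. \<integral>\<^sup>+q. ennreal \<bar>q\<bar> * (ennreal \<bar>q * sin u\<bar> *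
      k (vector [q * sin u * cos t, q * sin u * sin t, q * cos u])) \<partial>lborel \<partial>?T \<partial>?T)"
  proof (rule nn_integral_cong)
    fix t :: real
    have "(\<lambda>(z, r). ennreal \<bar>r\<bar> * k (vector [r * cos t, r * sin t, z])) \<in> borel_measurable (borel \<Otimes>\<^sub>M borel)"
      by measurable
    from nn_integral_polar[OF this, unfolded split]
    show "(\<integral>\<^sup>+z. \<integral>\<^sup>+r. ennreal \<bar>r\<bar> * k (vector [r * cos t, r * sin t, z]) \<partial>lborel \<partial>lborel)
      = (\<integral>\<^sup>+u. \<integral>\<^sup>+q. ennreal \<bar>q\<bar> * (ennreal \<bar>q * sin u\<bar> *
      k (vector [q * sin u * cos t, q * sin u * sin t, q * cos u])) \<partial>lborel \<partial>?T)" .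
  qed
  also have "\<dots> = (\<integral>\<^sup>+t. \<integral>\<^sup>+u. ennreal (1 / 3) * (ennreal \<bar>sin u\<bar> * g (?n t u) + ennreal \<bar>sin u\<bar> * g (- ?n t u)) \<partial>?T \<partial>?T)"
  proof (intro nn_integral_cong)
    fix t u
    have "(\<integral>\<^sup>+q. ennreal \<bar>q\<bar> * (ennreal \<bar>q * sin u\<bar> *
        k (vector [q * sin u * cos t, q * sin u * sin t, q * cos u])) \<partial>lborel)
      = (\<integral>\<^sup>+q. ennreal \<bar>sin u\<bar> * (ennreal (q\<^sup>2) * (g (?n t u) * indicator {0<..1} q + g (- ?n t u) * indicator {-1..<0} q)) \<partial>lborel)"
    proof (intro nn_integral_cong)
      fix q :: real
      have v: "vector [q * sin u * cos t, q * sin u * sin t, q * cos u] = q *\<^sub>R ?n t u"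
        by (simp add: vec_eq_iff forall_3)
      have nn: "norm (?n t u) = 1"
        unfolding n by (rule norm_sph_pt)
      have "k (q *\<^sub>R ?n t u) = g (?n t u) * indicator {0<..1} q + g (- ?n t u) * indicator {-1..<0} q"
      proof -
        consider "q = 0" | "q > 0" | "q < 0" by linarith
        then show ?thesis
        proof cases
          case 2
          then have "(q *\<^sub>R ?n t u) /\<^sub>R norm (q *\<^sub>R ?n t u) = ?n t u"
            by (simp add: nn)
          with 2 show ?thesis
            using nn by (auto simp: k_def indicator_def)
        next
          case 3
          then have "(q *\<^sub>R ?n t u) /\<^sub>R norm (q *\<^sub>R ?n t u) = - ?n t u"
            by (simp add: nn)
          with 3 show ?thesis
            using nn by (auto simp: k_def indicator_def)
        qed (simp add: k_def)
      qed
      moreover have "ennreal \<bar>q\<bar> * ennreal \<bar>q * sin u\<bar> = ennreal \<bar>sin u\<bar> * ennreal (q\<^sup>2)"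
      proof -
        have "\<bar>q\<bar> * \<bar>q * sin u\<bar> = \<bar>sin u\<bar> * q\<^sup>2"
          by (simp add: abs_mult power2_eq_square)
        then show ?thesis
          by (metis abs_ge_zero ennreal_mult zero_le_power2)
      qed
      ultimately show "ennreal \<bar>q\<bar> * (ennreal \<bar>q * sin u\<bar> *
          k (vector [q * sin u * cos t, q * sin u * sin t, q * cos u]))
        = ennreal \<bar>sin u\<bar> * (ennreal (q\<^sup>2) * (g (?n t u) * indicator {0<..1} q + g (- ?n t u) * indicator {-1..<0} q))"
        by (simp only: v mult.assoc[symmetric])
    qed
    also have "\<dots> = ennreal \<bar>sin u\<bar> * (ennreal (1 / 3) * (g (?n t u) + g (- ?n t u)))"
      by (subst nn_integral_cmult) (simp_all only: nn_integral_radial, measurable)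
    finally show "(\<integral>\<^sup>+q. ennreal \<bar>q\<bar> * (ennreal \<bar>q * sin u\<bar> *
        k (vector [q * sin u * cos t, q * sin u * sin t, q * cos u])) \<partial>lborel)
      = ennreal (1 / 3) * (ennreal \<bar>sin u\<bar> * g (?n t u) + ennreal \<bar>sin u\<bar> * g (- ?n t u))"
      by (simp only: mult.left_commute distrib_left)
  qed
  \<comment> \<open>The antipode of the point at \<open>u\<close> is the point at
    \<open>u + pi\<close>, so the two half turns join into the full turn of
    \<open>H\<close>.\<close>
  also have "\<dots> = (\<integral>\<^sup>+t. ennreal (1 / 3) * H (t + pi/2) \<partial>?T)"
  proof (intro nn_integral_cong)
    fix t
    let ?a = "\<lambda>p. ennreal \<bar>sin p\<bar> * g (sph_pt (t + pi/2) p)"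
    have per: "?a (p + 2 * pi) = ?a p" for p
      by (simp add: sph_pt_def rotx_periodic)
    have "(\<integral>\<^sup>+u. ennreal (1 / 3) * (ennreal \<bar>sin u\<bar> * g (?n t u) + ennreal \<bar>sin u\<bar> * g (- ?n t u)) \<partial>?T)
        = ennreal (1 / 3) * (\<integral>\<^sup>+u. ?a u + ?a (u + pi) \<partial>?T)"
      unfolding n(2) unfolding n(1) by (subst nn_integral_cmult) simp_all
    also have "(\<integral>\<^sup>+u. ?a u + ?a (u + pi) \<partial>?T) = (\<integral>\<^sup>+u. ?a u \<partial>?T) + (\<integral>\<^sup>+u. ?a (u + pi) \<partial>?T)"
      by (rule nn_integral_add) measurable
    also have "(\<integral>\<^sup>+u. ?a (u + pi) \<partial>?T) = (\<integral>\<^sup>+u. ?a u \<partial>seg (- pi/2 + pi) (pi/2 + pi))"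
      by (rule nn_integral_seg_translate[where f = ?a]) measurable
    also have "(\<integral>\<^sup>+u. ?a u \<partial>?T) + \<dots> = (\<integral>\<^sup>+u. ?a u \<partial>seg (- pi/2) (- pi/2 + 2 * pi))"
      by (subst nn_integral_seg_split[where f = ?a and b = "pi/2" and c = "- pi/2 + 2 * pi"]) simp_all
    also have "\<dots> = H (t + pi/2)"
      unfolding H_def
      by (rule nn_integral_seg_shift[where f = ?a, OF _ per]) (measurable, use pi_ge_zero in \<open>linarith+\<close>)
    finally show "(\<integral>\<^sup>+u. ennreal (1 / 3) * (ennreal \<bar>sin u\<bar> * g (?n t u) + ennreal \<bar>sin u\<bar> * g (- ?n t u)) \<partial>?T)
      = ennreal (1 / 3) * H (t + pi/2)" .
  qed
  also have "\<dots> = ennreal (1 / 3) * (\<integral>\<^sup>+t. H (t + pi/2) \<partial>?T)"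
    by (rule nn_integral_cmult) measurable
  also have "(\<integral>\<^sup>+t. H (t + pi/2) \<partial>?T) = (\<integral>\<^sup>+t. H t \<partial>seg 0 pi)"
    using nn_integral_seg_translate[where f = H and t = "pi/2" and a = "- pi/2" and b = "pi/2"] by simp
  finally have I: "(\<integral>\<^sup>+x. k x \<partial>lborel) = ennreal (1 / 3) * (\<integral>\<^sup>+t. H t \<partial>seg 0 pi)" .
  have "H (s + pi) = H s" for s
  proof -
    let ?a = "\<lambda>p. ennreal \<bar>sin p\<bar> * g (sph_pt s p)"
    have "sph_pt (s + pi) p = sph_pt s (- p)" for p
      by (simp add: sph_pt_eq vec_eq_iff forall_3)
    then have "H (s + pi) = (\<integral>\<^sup>+p. ?a (- p) \<partial>circ)"
      by (simp add: H_def)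
    also have "\<dots> = H s"
      unfolding H_def
      by (rule nn_integral_circ_reflect[where f = ?a]) (measurable, simp add: sph_pt_def rotx_periodic)
    finally show ?thesis .
  qed
  then have "(\<integral>\<^sup>+s. H s \<partial>circ) = 2 * (\<integral>\<^sup>+t. H t \<partial>seg 0 pi)"
    by (intro nn_integral_circ_half) simp_all
  moreover have "ennreal (1 / (4 * pi)) * (3 * (ennreal (1 / 3) * X)) = ennreal (1 / (8 * pi)) * (2 * X)" for X
  proof -
    have 1: "3 * ennreal (1 / 3) = 1"
      using ennreal_mult[of 3 "1 / 3"] by simp
    have 2: "ennreal (1 / (8 * pi)) * 2 = ennreal (1 / (4 * pi))"
      using ennreal_mult[of "1 / (8 * pi)" 2] by simp
    show ?thesis
      unfolding mult.assoc[symmetric] 2 unfolding mult.assoc[of _ 3] 1 by simp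
  qed
  ultimately show ?thesis
    unfolding nn_integral_sphere_unif_lborel[OF g] k_def[symmetric] I H_def[symmetric] by simp
qed

section \<open>The uniform measure on rotations\<close>

lemma nn_integral_lborel_rotation:
  fixes U :: "real^3^3"
  assumes U: "rotation_matrix U" and [measurable]: "f \<in> borel_measurable borel"
  shows "(\<integral>\<^sup>+x. f (U *v x) \<partial>lborel) = (\<integral>\<^sup>+x. f x \<partial>lborel)"
proof -
  have m [measurable]: "(*v) U \<in> borel_measurable borel"
    by (rule borel_measurable_continuous_onI) (auto simp: matrix_vector_mult_def intro!: continuous_intros)
  have "lborel = distr lborel borel ((*v) U)"
  proof (rule lborel_eqI)
    fix l u :: "real^3" assume le: "\<And>b. b \<in> Basis \<Longrightarrow> l \<bullet> b \<le> u \<bullet> b"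
    let ?V = "(*v) (transpose U)"
    have V: "orthogonal_transformation ?V"
      using U by (simp add: orthogonal_transformation_matrix rotation_matrix_def del: transpose_matrix_vector)
    have eq: "(*v) U -` box l u = ?V ` box l u"
      by (auto simp: image_iff rotation_matrix_cancel[OF U] simp del: transpose_matrix_vector
        intro!: bexI[of _ "U *v x" for x])
    have "(*v) U -` box l u \<in> sets borel"
      using measurable_sets[OF m, of "box l u"] by simp
    then have "emeasure lborel ((*v) U -` box l u) = emeasure lebesgue (?V ` box l u)"
      unfolding eq by simp
    also have "\<dots> = ennreal (measure lebesgue (?V ` box l u))"
      by (intro emeasure_eq_measure2 measurable_orthogonal_image V lmeasurable_box)
    also have "measure lebesgue (?V ` box l u) = measure lebesgue (box l u)"
      by (intro measure_orthogonal_image V lmeasurable_box)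
    also have "ennreal (measure lebesgue (box l u)) = emeasure lebesgue (box l u)"
      by (rule emeasure_eq_measure2[symmetric, OF lmeasurable_box])
    also have "\<dots> = (\<Prod>b\<in>Basis. (u - l) \<bullet> b)"
      using le by simp
    finally show "emeasure (distr lborel borel ((*v) U)) (box l u) = (\<Prod>b\<in>Basis. (u - l) \<bullet> b)"
      by (subst emeasure_distr) simp_all
  qed simp
  then have "(\<integral>\<^sup>+x. f x \<partial>lborel) = (\<integral>\<^sup>+x. f x \<partial>distr lborel borel ((*v) U))"
    by (rule arg_cong)
  also have "\<dots> = (\<integral>\<^sup>+x. f (U *v x) \<partial>lborel)"
    by (rule nn_integral_distr) simp_all
  finally show ?thesis ..
qed

lemma nn_integral_sphere_unif_rotation:
  fixes g :: "real^3 \<Rightarrow> ennreal"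
  assumes U: "rotation_matrix U" and g [measurable]: "g \<in> borel_measurable borel"
  shows "(\<integral>\<^sup>+x. g (U *v x) \<partial>sphere_unif) = (\<integral>\<^sup>+x. g x \<partial>sphere_unif)"
proof -
  have [measurable]: "cball 0 1 - {0 :: real^3} \<in> sets borel"
    by (intro sets.Diff) auto
  let ?k = "\<lambda>x. g (x /\<^sub>R norm x) * indicator (cball 0 1 - {0}) x"
  have z: "U *v x = 0 \<longleftrightarrow> x = 0" for x
    using rotation_matrix_norm[OF U, of x] by (metis norm_eq_zero)
  have "(\<integral>\<^sup>+x. g (U *v (x /\<^sub>R norm x)) * indicator (cball 0 1 - {0}) x \<partial>lborel) = (\<integral>\<^sup>+x. ?k (U *v x) \<partial>lborel)"
    by (intro nn_integral_cong) (auto simp: rotation_matrix_norm[OF U] matrix_vector_mult_scaleR indicator_def z)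
  also have "\<dots> = (\<integral>\<^sup>+x. ?k x \<partial>lborel)"
    by (rule nn_integral_lborel_rotation[OF U]) measurable
  finally show ?thesis
    by (simp add: nn_integral_sphere_unif_lborel)
qed

text \<open>With \<open>p\<close> on a full turn almost every rotation is reached twice, and
  \<open>16 * pi\<^sup>2\<close> is the total mass \<open>2 pi * 4 * 2 pi\<close>. Invariance is not
  built in; it is proved in \<open>nn_integral_haar_left\<close> and
  \<open>nn_integral_haar_right\<close>.\<close>

definition haar :: "(real^3^3) measure" where
  "haar = distr (density (circ \<Otimes>\<^sub>M (circ \<Otimes>\<^sub>M circ)) (\<lambda>(s, p, c). ennreal (\<bar>sin p\<bar> / (16 * pi\<^sup>2)))) borel
    (\<lambda>(s, p, c). rotz s ** rotx p ** rotz c)"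

lemma sets_haar [measurable_cong, simp]: "sets haar = sets borel"
  by (simp add: haar_def)

lemma space_haar [simp]: "space haar = UNIV"
  by (simp add: haar_def)

text \<open>Integral over the rotations with the same third axis as \<open>R\<close>; by
  \<open>fibre_eq\<close> it depends, for rotations, on \<open>R *v e3\<close> alone.\<close>

definition fibre :: "(real^3^3 \<Rightarrow> ennreal) \<Rightarrow> real^3^3 \<Rightarrow> ennreal" where
  "fibre f R = (\<integral>\<^sup>+c. f (R ** rotz c) \<partial>circ)"

lemma fibre_measurable [measurable (raw)]:
  assumes [measurable]: "f \<in> borel_measurable borel" "A \<in> borel_measurable M"
  shows "(\<lambda>x. fibre f (A x)) \<in> borel_measurable M"
  unfolding fibre_def by measurable

lemma nn_integral_haar:
  assumes [measurable]: "f \<in> borel_measurable borel"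
  shows "(\<integral>\<^sup>+R. f R \<partial>haar) = (\<integral>\<^sup>+s. \<integral>\<^sup>+p. ennreal (\<bar>sin p\<bar> / (16 * pi\<^sup>2)) * fibre f (rotz s ** rotx p) \<partial>circ \<partial>circ)"
proof -
  have s: "sigma_finite_measure (circ \<Otimes>\<^sub>M circ)"
    by (intro finite_measure.axioms(1) finite_measure_pair_measure) simp_all
  have s': "sigma_finite_measure circ"
    by (intro finite_measure.axioms(1)) simp
  have "(\<integral>\<^sup>+R. f R \<partial>haar) = (\<integral>\<^sup>+x. (case x of (s, p, c) \<Rightarrow>
      ennreal (\<bar>sin p\<bar> / (16 * pi\<^sup>2)) * f (rotz s ** rotx p ** rotz c)) \<partial>(circ \<Otimes>\<^sub>M (circ \<Otimes>\<^sub>M circ)))"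
    unfolding haar_def
    by (subst nn_integral_distr, measurable) (subst nn_integral_density, measurable, simp add: case_prod_beta')
  also have "\<dots> = (\<integral>\<^sup>+s. \<integral>\<^sup>+x. (case x of (p, c) \<Rightarrow>
      ennreal (\<bar>sin p\<bar> / (16 * pi\<^sup>2)) * f (rotz s ** rotx p ** rotz c)) \<partial>(circ \<Otimes>\<^sub>M circ) \<partial>circ)"
    by (subst sigma_finite_measure.nn_integral_fst[OF s, symmetric]) (measurable, simp?)
  also have "\<dots> = (\<integral>\<^sup>+s. \<integral>\<^sup>+p. \<integral>\<^sup>+c. ennreal (\<bar>sin p\<bar> / (16 * pi\<^sup>2)) * f (rotz s ** rotx p ** rotz c) \<partial>circ \<partial>circ \<partial>circ)"
    by (subst sigma_finite_measure.nn_integral_fst[OF s', symmetric]) (measurable, simp?)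
  also have "\<dots> = (\<integral>\<^sup>+s. \<integral>\<^sup>+p. ennreal (\<bar>sin p\<bar> / (16 * pi\<^sup>2)) * fibre f (rotz s ** rotx p) \<partial>circ \<partial>circ)"
    unfolding fibre_def by (intro nn_integral_cong nn_integral_cmult) measurable
  finally show ?thesis .
qed

text \<open>\<open>haar\<close> lives on all matrices but is an image under products of rotations,
  so integrands need to agree on rotations only.\<close>

lemma nn_integral_haar_cong:
  assumes "f \<in> borel_measurable borel" "g \<in> borel_measurable borel" "\<And>R. rotation_matrix R \<Longrightarrow> f R = g R"
  shows "(\<integral>\<^sup>+R. f R \<partial>haar) = (\<integral>\<^sup>+R. g R \<partial>haar)"
  unfolding nn_integral_haar[OF assms(1)] nn_integral_haar[OF assms(2)] fibre_def
  by (simp add: assms(3) rotation_matrix_mult rotation_matrix_rotx rotation_matrix_rotz)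

lemma fibre_eq:
  assumes [measurable]: "f \<in> borel_measurable borel"
    and R: "rotation_matrix R" "rotation_matrix R'" "R *v e3 = R' *v e3"
  shows "fibre f R = fibre f R'"
proof -
  have "rotation_matrix (transpose R ** R')"
    using R by (simp add: rotation_matrix_mult rotation_matrix_transpose)
  moreover have "(transpose R ** R') *v e3 = e3"
    using R by (metis matrix_vector_mul_assoc rotation_matrix_cancel(3))
  ultimately obtain a where a: "0 \<le> a" "a < 2 * pi" "transpose R ** R' = rotz a"
    by (rule rotation_matrix_fix_e3)
  then have R': "R' = R ** rotz a"
    using rotation_matrix_cancel(2)[OF R(1), of R'] by simp
  have "fibre f R' = (\<integral>\<^sup>+c. f (R ** rotz (c + a)) \<partial>circ)"
    by (simp add: fibre_def R' matrix_mul_assoc[symmetric] rotz_add add.commute)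
  also have "\<dots> = fibre f R"
    unfolding fibre_def using a
    by (intro nn_integral_circ_translate[where f = "\<lambda>c. f (R ** rotz c)"]) (measurable, auto simp: rotz_periodic)
  finally show ?thesis ..
qed

text \<open>A measurable section of \<open>R \<mapsto> R *v e3\<close>, defined off the poles.\<close>

definition frame_of :: "real^3 \<Rightarrow> real^3^3" where
  "frame_of n = (let r = sqrt ((n $ 1)\<^sup>2 + (n $ 2)\<^sup>2) in
    vector [vector [- n $ 2 / r, - n $ 1 * n $ 3 / r, n $ 1], vector [n $ 1 / r, - n $ 2 * n $ 3 / r, n $ 2],
      vector [0, r, n $ 3]])"

lemma frame_of_measurable [measurable]: "frame_of \<in> borel_measurable borel"
  unfolding frame_of_def[abs_def] Let_def by measurable

lemma frame_of_rotation:
  assumes "norm n = 1" "(n $ 1)\<^sup>2 + (n $ 2)\<^sup>2 \<noteq> 0"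
  shows "rotation_matrix (frame_of n)" "frame_of n *v e3 = n"
proof -
  define r where "r = sqrt ((n $ 1)\<^sup>2 + (n $ 2)\<^sup>2)"
  have r2: "r\<^sup>2 = (n $ 1)\<^sup>2 + (n $ 2)\<^sup>2"
    by (simp add: r_def)
  have "(norm n)\<^sup>2 = (n $ 1)\<^sup>2 + (n $ 2)\<^sup>2 + (n $ 3)\<^sup>2"
    by (simp add: norm_vec_def L2_set_def sum_3)
  then have n3: "r\<^sup>2 + (n $ 3)\<^sup>2 = 1"
    using assms r2 by simp
  have r0: "r \<noteq> 0"
    using assms by (simp add: r_def)
  have 1: "(n $ 1 / r)\<^sup>2 + (- n $ 2 / r)\<^sup>2 = 1"
    using r2 r0 assms(2) by (simp add: power_divide add_divide_distrib[symmetric])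
  obtain s where s: "n $ 1 / r = sin s" "- n $ 2 / r = cos s"
    using sincos_total_2pi[of "- n $ 2 / r" "n $ 1 / r"] 1 by (metis add.commute)
  obtain p where p: "r = sin p" "n $ 3 = cos p"
    using sincos_total_2pi[of "n $ 3" r] n3 by (metis add.commute)
  have n12: "n $ 1 = sin s * sin p" "n $ 2 = - cos s * sin p"
    using s r0 unfolding p(1)[symmetric] by (auto simp: field_simps)
  \<comment> \<open>Off the poles the section is the Euler product with third angle 0 and
    \<open>sin p = r > 0\<close>.\<close>
  have "frame_of n = rotz s ** rotx p"
    unfolding frame_of_def Let_def r_def[symmetric] using r0
    by (simp add: rotz_def rotx_def mat3_simps n12 p)
  then show "rotation_matrix (frame_of n)" "frame_of n *v e3 = n"
    by (simp_all add: rotation_matrix_mult rotation_matrix_rotx rotation_matrix_rotz)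
      (simp add: matrix_vector_mul_assoc[symmetric] spherical_coords vec_eq_iff forall_3 n12 p)
qed

definition pole :: "real^3 \<Rightarrow> bool" where
  "pole n \<longleftrightarrow> (n $ 1)\<^sup>2 + (n $ 2)\<^sup>2 = 0"

lemma pole_sph_pt: "pole (sph_pt s p) \<longleftrightarrow> sin p = 0"
proof -
  have "(sin s * sin p)\<^sup>2 + (- cos s * sin p)\<^sup>2 = ((sin s)\<^sup>2 + (cos s)\<^sup>2) * (sin p)\<^sup>2"
    by algebra
  then show ?thesis
    by (simp add: pole_def sph_pt_eq)
qed

lemma nn_integral_pole: "(\<integral>\<^sup>+n. indicator {n. pole n} n \<partial>sphere_unif) = 0"
proof -
  have [measurable]: "{n. pole n} \<in> sets borel"
    unfolding pole_def by measurable
  have *: "ennreal \<bar>sin p\<bar> * indicator {n. pole n} (sph_pt s p) = 0" for s p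
    by (simp add: indicator_def pole_sph_pt)
  show ?thesis
    by (subst nn_integral_sphere_unif, measurable) (simp only: *, simp)
qed

lemma AE_not_pole: "AE n in sphere_unif. \<not> pole n"
proof (rule AE_I')
  let ?A = "{n. pole n} \<inter> S2"
  have B [measurable]: "{n. pole n} \<in> sets borel"
    unfolding pole_def by measurable
  have A: "?A \<in> sets sphere_unif"
    by (simp add: sets_sphere_unif sets_restrict_space_iff)
  have "emeasure sphere_unif ?A = (\<integral>\<^sup>+n. indicator {n. pole n} n \<partial>sphere_unif)"
    by (subst nn_integral_indicator[OF A, symmetric])
      (auto intro!: nn_integral_cong simp: space_sphere_unif indicator_def)
  also have "\<dots> = 0"
    by (rule nn_integral_pole)
  finally show "?A \<in> null_sets sphere_unif"
    using A by auto
  show "{n \<in> space sphere_unif. \<not> \<not> pole n} \<subseteq> ?A"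
    by (auto simp: space_sphere_unif)
qed

text \<open>Disintegration of \<open>haar\<close>: a uniform axis \<open>n\<close>, then a uniform
  angle in the fibre over it. As fibre integrals see only the axis, the section
  \<open>frame_of\<close> may replace the Euler frame; at the poles the weight
  \<open>|sin p|\<close> vanishes, so its values there do no harm.\<close>

lemma nn_integral_haar_frame_of:
  assumes U: "rotation_matrix U" and [measurable]: "f \<in> borel_measurable borel"
  shows "(\<integral>\<^sup>+R. f (U ** R) \<partial>haar) = ennreal (1 / (2 * pi)) * (\<integral>\<^sup>+n. fibre f (U ** frame_of n) \<partial>sphere_unif)"
proof -
  have eq: "ennreal (\<bar>sin p\<bar> / (16 * pi\<^sup>2)) * fibre (\<lambda>R. f (U ** R)) (rotz s ** rotx p)
      = ennreal (1 / (2 * pi)) * (ennreal (1 / (8 * pi)) * (ennreal \<bar>sin p\<bar> * fibre f (U ** frame_of (sph_pt s p))))" for s p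
  proof (cases "sin p = 0")
    case False
    have "(sph_pt s p $ 1)\<^sup>2 + (sph_pt s p $ 2)\<^sup>2 \<noteq> 0"
      using False pole_sph_pt[of s p] by (simp add: pole_def)
    note frame_of = frame_of_rotation[OF norm_sph_pt this]
    have "fibre (\<lambda>R. f (U ** R)) (rotz s ** rotx p) = fibre f (U ** (rotz s ** rotx p))"
      by (simp add: fibre_def matrix_mul_assoc)
    also have "\<dots> = fibre f (U ** frame_of (sph_pt s p))"
      using U frame_of
      by (intro fibre_eq)
        (simp_all add: rotation_matrix_mult rotation_matrix_rotx rotation_matrix_rotz
          matrix_vector_mul_assoc[symmetric] sph_pt_def)
    finally have *: "fibre (\<lambda>R. f (U ** R)) (rotz s ** rotx p) = fibre f (U ** frame_of (sph_pt s p))" .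
    have "ennreal (\<bar>sin p\<bar> / (16 * pi\<^sup>2)) = ennreal (1 / (2 * pi)) * (ennreal (1 / (8 * pi)) * ennreal \<bar>sin p\<bar>)"
      by (simp add: ennreal_mult[symmetric] power2_eq_square)
    then show ?thesis
      unfolding * by (simp only: mult.assoc)
  qed simp
  have "(\<integral>\<^sup>+R. f (U ** R) \<partial>haar) = (\<integral>\<^sup>+s. \<integral>\<^sup>+p. ennreal (1 / (2 * pi)) * (ennreal (1 / (8 * pi)) *
      (ennreal \<bar>sin p\<bar> * fibre f (U ** frame_of (sph_pt s p)))) \<partial>circ \<partial>circ)"
    by (subst nn_integral_haar, measurable) (simp only: eq)
  also have "\<dots> = ennreal (1 / (2 * pi)) * (ennreal (1 / (8 * pi)) * (\<integral>\<^sup>+s. \<integral>\<^sup>+p.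
      ennreal \<bar>sin p\<bar> * fibre f (U ** frame_of (sph_pt s p)) \<partial>circ \<partial>circ))"
    by (simp add: nn_integral_cmult)
  also have "\<dots> = ennreal (1 / (2 * pi)) * (\<integral>\<^sup>+n. fibre f (U ** frame_of n) \<partial>sphere_unif)"
    by (subst nn_integral_sphere_unif) (measurable, simp?)
  finally show ?thesis .
qed

text \<open>\<open>U ** frame_of n\<close> and \<open>frame_of (U *v n)\<close> share their third
  axis, so their fibre integrals agree when neither \<open>n\<close> nor \<open>U *v n\<close> is a
  pole; the rest is the rotation invariance of the sphere measure.\<close>

lemma nn_integral_haar_left:
  assumes U: "rotation_matrix U" and [measurable]: "f \<in> borel_measurable borel"
  shows "(\<integral>\<^sup>+R. f (U ** R) \<partial>haar) = (\<integral>\<^sup>+R. f R \<partial>haar)"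
proof -
  have I: "rotation_matrix (mat 1 :: real^3^3)"
    using rotation_matrix_rotz[of 0] by (simp add: rotz_0)
  have "AE n in sphere_unif. \<not> pole (U *v n)"
  proof -
    have [measurable]: "{n. pole n} \<in> sets borel"
      unfolding pole_def by measurable
    have "(\<integral>\<^sup>+n. indicator {n. pole n} (U *v n) \<partial>sphere_unif) = (\<integral>\<^sup>+n. indicator {n. pole n} n \<partial>sphere_unif)"
      by (rule nn_integral_sphere_unif_rotation[OF U]) measurable
    also have "\<dots> = 0"
      by (rule nn_integral_pole)
    finally have "AE n in sphere_unif. indicator {n. pole n} (U *v n) = (0 :: ennreal)"
      by (subst (asm) nn_integral_0_iff_AE) (auto intro!: measurable_restrict_space1 simp: measurable_cong_sets[OF sets_sphere_unif refl])
    then show ?thesis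
      by eventually_elim (auto simp: indicator_def split: if_splits)
  qed
  then have "AE n in sphere_unif. fibre f (U ** frame_of n) = fibre f (frame_of (U *v n))"
    using AE_not_pole AE_space
  proof eventually_elim
    case (elim n)
    then have n: "norm n = 1" "norm (U *v n) = 1"
      by (simp_all add: space_sphere_unif rotation_matrix_norm[OF U])
    show ?case
      using frame_of_rotation[OF n(1)] frame_of_rotation[OF n(2)] elim U unfolding pole_def
      by (intro fibre_eq) (simp_all add: rotation_matrix_mult matrix_vector_mul_assoc[symmetric])
  qed
  then have "(\<integral>\<^sup>+n. fibre f (U ** frame_of n) \<partial>sphere_unif) = (\<integral>\<^sup>+n. fibre f (frame_of (U *v n)) \<partial>sphere_unif)"
    by (rule nn_integral_cong_AE)
  also have "\<dots> = (\<integral>\<^sup>+n. fibre f (frame_of n) \<partial>sphere_unif)"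
    by (rule nn_integral_sphere_unif_rotation[OF U]) measurable
  finally show ?thesis
    using nn_integral_haar_frame_of[OF U, of f] nn_integral_haar_frame_of[OF I, of f] by simp
qed

lemma nn_integral_sin_seg: "(\<integral>\<^sup>+p. ennreal \<bar>sin p\<bar> \<partial>seg 0 pi) = 2"
proof -
  have "(\<integral>\<^sup>+p. ennreal \<bar>sin p\<bar> \<partial>seg 0 pi) = (\<integral>\<^sup>+p. ennreal (sin p) * indicator {0..pi} p \<partial>lborel)"
    by (subst nn_integral_seg) (auto intro!: nn_integral_cong simp: indicator_def sin_ge_zero)
  also have "\<dots> = ennreal (- cos pi - (- cos 0))"
  proof (rule nn_integral_FTC_Icc)
    show "((\<lambda>x. - cos x) has_real_derivative sin x) (at x)" for x :: real
      by (auto intro!: derivative_eq_intros)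
  qed (auto intro: sin_ge_zero)
  finally show ?thesis by simp
qed

lemma nn_integral_sin_circ: "(\<integral>\<^sup>+p. ennreal \<bar>sin p\<bar> \<partial>circ) = 4"
  by (subst nn_integral_circ_half) (simp_all add: nn_integral_sin_seg)

lemma emeasure_haar: "emeasure haar UNIV = 1"
proof -
  have f: "fibre (\<lambda>_. 1) R = ennreal (2 * pi)" for R
    by (simp add: fibre_def emeasure_seg)
  have c: "ennreal (\<bar>sin p\<bar> / (16 * pi\<^sup>2)) * ennreal (2 * pi) = ennreal (1 / (8 * pi)) * ennreal \<bar>sin p\<bar>" for p
    by (simp add: ennreal_mult[symmetric] power2_eq_square)
  have "emeasure haar UNIV = (\<integral>\<^sup>+R. 1 \<partial>haar)"
    by simp
  also have "\<dots> = (\<integral>\<^sup>+s. \<integral>\<^sup>+p. ennreal (1 / (8 * pi)) * ennreal \<bar>sin p\<bar> \<partial>circ \<partial>circ)"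
    by (subst nn_integral_haar, measurable) (simp only: f c)
  also have "\<dots> = ennreal (1 / (8 * pi)) * 4 * ennreal (2 * pi)"
    by (simp add: nn_integral_cmult nn_integral_sin_circ emeasure_seg)
  also have "\<dots> = 1"
    using ennreal_mult[of "1 / (8 * pi)" 4] ennreal_mult[of "1 / (8 * pi) * 4" "2 * pi"] by simp
  finally show ?thesis .
qed

interpretation haar: finite_measure haar
  by (rule finite_measureI) (simp add: emeasure_haar)

interpretation haar_haar: pair_sigma_finite haar haar ..

interpretation haar_seg: pair_sigma_finite haar "seg a b" for a b
  by (intro pair_sigma_finite.intro haar.sigma_finite_measure_axioms finite_measure.axioms(1)) simp

interpretation seg_haar: pair_sigma_finite "seg a b" haar for a b
  by (intro pair_sigma_finite.intro haar.sigma_finite_measure_axioms finite_measure.axioms(1)) simp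

lemmas borel_measurable_nn_integral_haar [measurable (raw)] = haar.borel_measurable_nn_integral

lemma nn_integral_haar_const: "(\<integral>\<^sup>+R. c \<partial>haar) = c"
  by (simp add: emeasure_haar)

text \<open>Both iterated integrals of \<open>f (transpose K ** R)\<close> are evaluated by left invariance.\<close>

lemma nn_integral_haar_transpose:
  assumes [measurable]: "f \<in> borel_measurable borel"
  shows "(\<integral>\<^sup>+R. f (transpose R) \<partial>haar) = (\<integral>\<^sup>+R. f R \<partial>haar)"
proof -
  have "(\<integral>\<^sup>+R. f R \<partial>haar) = (\<integral>\<^sup>+K. (\<integral>\<^sup>+R. f R \<partial>haar) \<partial>haar)"
    by (simp only: nn_integral_haar_const)
  also have "\<dots> = (\<integral>\<^sup>+K. \<integral>\<^sup>+R. f (transpose K ** R) \<partial>haar \<partial>haar)"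
    by (rule nn_integral_haar_cong, measurable)
      (rule nn_integral_haar_left[symmetric], simp_all add: rotation_matrix_transpose)
  also have "\<dots> = (\<integral>\<^sup>+R. \<integral>\<^sup>+K. f (transpose K ** R) \<partial>haar \<partial>haar)"
    by (rule haar_haar.Fubini') measurable
  also have "\<dots> = (\<integral>\<^sup>+R. (\<integral>\<^sup>+K. f (transpose K) \<partial>haar) \<partial>haar)"
  proof (rule nn_integral_haar_cong)
    fix R :: "real^3^3" assume R: "rotation_matrix R"
    have "(\<integral>\<^sup>+K. f (transpose K ** R) \<partial>haar) = (\<integral>\<^sup>+K. f (transpose (transpose R ** K)) \<partial>haar)"
      by (simp add: matrix_transpose_mul)
    also have "\<dots> = (\<integral>\<^sup>+K. f (transpose K) \<partial>haar)"
      using R by (intro nn_integral_haar_left[where f = "\<lambda>K. f (transpose K)"]) (simp_all add: rotation_matrix_transpose)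
    finally show "(\<integral>\<^sup>+K. f (transpose K ** R) \<partial>haar) = (\<integral>\<^sup>+K. f (transpose K) \<partial>haar)" .
  qed measurable
  also have "\<dots> = (\<integral>\<^sup>+K. f (transpose K) \<partial>haar)"
    by (rule nn_integral_haar_const)
  finally show ?thesis ..
qed

text \<open>Right multiplication is left multiplication seen through the transpose.\<close>

lemma nn_integral_haar_right:
  assumes V: "rotation_matrix V" and [measurable]: "f \<in> borel_measurable borel"
  shows "(\<integral>\<^sup>+R. f (R ** V) \<partial>haar) = (\<integral>\<^sup>+R. f R \<partial>haar)"
proof -
  have "(\<integral>\<^sup>+R. f (R ** V) \<partial>haar) = (\<integral>\<^sup>+R. f (transpose R ** V) \<partial>haar)"
    by (rule nn_integral_haar_transpose[where f = "\<lambda>R. f (R ** V)", symmetric]) measurable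
  also have "\<dots> = (\<integral>\<^sup>+R. f (transpose (transpose V ** R)) \<partial>haar)"
    by (simp add: matrix_transpose_mul)
  also have "\<dots> = (\<integral>\<^sup>+R. f (transpose R) \<partial>haar)"
    using V by (intro nn_integral_haar_left[where f = "\<lambda>R. f (transpose R)"]) (simp_all add: rotation_matrix_transpose)
  also have "\<dots> = (\<integral>\<^sup>+R. f R \<partial>haar)"
    by (rule nn_integral_haar_transpose) measurable
  finally show ?thesis .
qed

lemma nn_integral_haar_e3:
  assumes [measurable]: "g \<in> borel_measurable borel"
  shows "(\<integral>\<^sup>+R. g (R *v e3) \<partial>haar) = (\<integral>\<^sup>+n. g n \<partial>sphere_unif)"
proof -
  have f: "fibre (\<lambda>R. g (R *v e3)) R = ennreal (2 * pi) * g (R *v e3)" for R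
  proof -
    have "rotz c *v e3 = e3" for c
      by (simp add: rotz_def e3_def mat3_simps)
    then show ?thesis
      by (simp add: fibre_def emeasure_seg matrix_vector_mul_assoc[symmetric] mult.commute)
  qed
  have c: "ennreal (\<bar>sin p\<bar> / (16 * pi\<^sup>2)) * (ennreal (2 * pi) * X) = ennreal (1 / (8 * pi)) * (ennreal \<bar>sin p\<bar> * X)" for p X
    by (simp add: ennreal_mult[symmetric] power2_eq_square flip: mult.assoc)
  have "(\<integral>\<^sup>+R. g (R *v e3) \<partial>haar) = (\<integral>\<^sup>+s. \<integral>\<^sup>+p. ennreal (1 / (8 * pi)) * (ennreal \<bar>sin p\<bar> * g (sph_pt s p)) \<partial>circ \<partial>circ)"
    by (subst nn_integral_haar, measurable)
      (simp only: f c sph_pt_def matrix_vector_mul_assoc)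
  also have "\<dots> = (\<integral>\<^sup>+n. g n \<partial>sphere_unif)"
    by (subst nn_integral_sphere_unif, measurable) (simp add: nn_integral_cmult)
  finally show ?thesis .
qed

definition cyc :: "real^3^3" where
  "cyc = vector [vector [0, 0, 1], vector [1, 0, 0], vector [0, 1, 0]]"

lemma rotation_matrix_cyc: "rotation_matrix cyc"
  by (simp add: rotation_matrix_def orthogonal_matrix_def det_3 cyc_def mat3_simps mat_def)

lemma cyc_e3: "cyc *v e3 = zeta 0"
  by (simp add: cyc_def e3_def zeta_def mat3_simps)

text \<open>Moves the centre of the spherical coordinates from \<open>e3\<close> to
  \<open>zeta 0\<close>: \<open>p\<close> becomes the position along a great circle from
  \<open>zeta 0\<close>, and \<open>s\<close>, up to a quarter turn, its direction.\<close>

lemma cyc_sph_pt: "cyc *v sph_pt s p = rotx (s - pi/2) *v zeta p"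
  by (simp add: cyc_def sph_pt_eq rotx_def zeta_def mat3_simps sin_diff cos_diff)

lemma nn_integral_haar_zeta:
  assumes [measurable]: "g \<in> borel_measurable borel"
  shows "(\<integral>\<^sup>+R. g (R *v zeta 0) \<partial>haar) = (\<integral>\<^sup>+n. g n \<partial>sphere_unif)"
proof -
  have "(\<integral>\<^sup>+R. g (R *v zeta 0) \<partial>haar) = (\<integral>\<^sup>+R. g ((R ** cyc) *v e3) \<partial>haar)"
    by (simp add: matrix_vector_mul_assoc[symmetric] cyc_e3)
  also have "\<dots> = (\<integral>\<^sup>+R. g (R *v e3) \<partial>haar)"
    by (rule nn_integral_haar_right[where f = "\<lambda>R. g (R *v e3)", OF rotation_matrix_cyc]) measurable
  also have "\<dots> = (\<integral>\<^sup>+n. g n \<partial>sphere_unif)"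
    by (rule nn_integral_haar_e3) measurable
  finally show ?thesis .
qed

lemma finite_measure_sphere_unif: "finite_measure sphere_unif"
proof (rule finite_measureI)
  have "emeasure sphere_unif S2 = ennreal (1 / (4 * pi)) * ennreal (4 * pi)"
    unfolding sphere_unif_def emeasure_scale_measure emeasure_sphere_area_space ..
  then show "emeasure sphere_unif (space sphere_unif) \<noteq> \<infinity>"
    by (simp add: space_sphere_unif ennreal_mult[symmetric])
qed

lemma borel_measurable_sphere_unif:
  "f \<in> borel_measurable borel \<Longrightarrow> f \<in> borel_measurable sphere_unif"
  unfolding measurable_cong_sets[OF sets_sphere_unif refl] by (rule measurable_restrict_space1)

text \<open>Measurability in a parameter is inherited from \<open>haar\<close>, whose sigma-algebra
  is Borel, whereas \<open>sphere_unif\<close> lives on the restricted one.\<close>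

lemma nn_integral_sphere_unif_measurable [measurable (raw)]:
  fixes f :: "'a \<Rightarrow> real^3 \<Rightarrow> ennreal"
  assumes [measurable]: "(\<lambda>(x, y). f x y) \<in> borel_measurable (M \<Otimes>\<^sub>M borel)"
  shows "(\<lambda>x. \<integral>\<^sup>+y. f x y \<partial>sphere_unif) \<in> borel_measurable M"
proof -
  have "(\<integral>\<^sup>+y. f x y \<partial>sphere_unif) = (\<integral>\<^sup>+R. f x (R *v e3) \<partial>haar)" if "x \<in> space M" for x
    using that by (intro nn_integral_haar_e3[symmetric]) measurable
  then have "(\<lambda>x. \<integral>\<^sup>+y. f x y \<partial>sphere_unif) \<in> borel_measurable M
      \<longleftrightarrow> (\<lambda>x. \<integral>\<^sup>+R. f x (R *v e3) \<partial>haar) \<in> borel_measurable M"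
    by (rule measurable_cong)
  then show ?thesis by simp
qed

text \<open>A uniform pair is a uniform frame at the first point together with spherical coordinates
  of the second point about the first. The azimuth is a right factor \<open>rotx\<close> and
  disappears by right invariance; the distance keeps its density \<open>sin t / 2\<close>.\<close>

lemma nn_integral_sphere_pair:
  fixes g :: "real^3 \<Rightarrow> real^3 \<Rightarrow> ennreal"
  assumes [measurable]: "(\<lambda>(x, y). g x y) \<in> borel_measurable (borel \<Otimes>\<^sub>M borel)"
  shows "(\<integral>\<^sup>+x. \<integral>\<^sup>+y. g x y \<partial>sphere_unif \<partial>sphere_unif)
    = (\<integral>\<^sup>+t. ennreal (sin t / 2) * (\<integral>\<^sup>+R. g (R *v zeta 0) (R *v zeta t) \<partial>haar) \<partial>seg 0 pi)"
proof -
  define K where "K p = (\<integral>\<^sup>+R. g (R *v zeta 0) (R *v zeta p) \<partial>haar)" for p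
  have [measurable]: "K \<in> borel_measurable borel"
    unfolding K_def by measurable
  have per: "K (p + 2 * pi) = K p" for p
    by (simp add: K_def zeta_periodic)
  have rot: "(\<integral>\<^sup>+R. g (R *v zeta 0) (R *v (rotx a *v zeta p)) \<partial>haar) = K p" for a p
  proof -
    have "(\<integral>\<^sup>+R. g (R *v zeta 0) (R *v (rotx a *v zeta p)) \<partial>haar)
        = (\<integral>\<^sup>+R. g ((R ** rotx a) *v zeta 0) ((R ** rotx a) *v zeta p) \<partial>haar)"
      by (simp add: matrix_vector_mul_assoc[symmetric] rotx_zeta_0)
    also have "\<dots> = K p"
      unfolding K_def
      by (rule nn_integral_haar_right[where f = "\<lambda>R. g (R *v zeta 0) (R *v zeta p)", OF rotation_matrix_rotx]) measurable
    finally show ?thesis .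
  qed
  \<comment> \<open>A half turn about the base point exchanges \<open>zeta p\<close> and
    \<open>zeta (- p)\<close>; this folds the full turn onto \<open>[0, pi]\<close>.\<close>
  have even: "K (- p) = K p" for p
    using rot[of pi p] by (simp add: rotx_pi_zeta K_def)
  have "(\<integral>\<^sup>+x. \<integral>\<^sup>+y. g x y \<partial>sphere_unif \<partial>sphere_unif) = (\<integral>\<^sup>+R. \<integral>\<^sup>+y. g (R *v zeta 0) y \<partial>sphere_unif \<partial>haar)"
    by (rule nn_integral_haar_zeta[symmetric]) measurable
  also have "\<dots> = (\<integral>\<^sup>+R. \<integral>\<^sup>+s. \<integral>\<^sup>+p. ennreal (\<bar>sin p\<bar> / (8 * pi)) * g (R *v zeta 0) (R *v (rotx (s - pi/2) *v zeta p)) \<partial>circ \<partial>circ \<partial>haar)"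
  proof (rule nn_integral_haar_cong)
    fix R :: "real^3^3" assume R: "rotation_matrix R"
    have "(\<integral>\<^sup>+y. g (R *v zeta 0) y \<partial>sphere_unif) = (\<integral>\<^sup>+y. g (R *v zeta 0) ((R ** cyc) *v y) \<partial>sphere_unif)"
      using R rotation_matrix_cyc
      by (intro nn_integral_sphere_unif_rotation[symmetric] rotation_matrix_mult) measurable
    also have "\<dots> = ennreal (1 / (8 * pi)) * (\<integral>\<^sup>+s. \<integral>\<^sup>+p. ennreal \<bar>sin p\<bar> * g (R *v zeta 0) ((R ** cyc) *v sph_pt s p) \<partial>circ \<partial>circ)"
      by (rule nn_integral_sphere_unif) measurable
    also have "\<dots> = (\<integral>\<^sup>+s. \<integral>\<^sup>+p. ennreal (1 / (8 * pi)) * (ennreal \<bar>sin p\<bar> * g (R *v zeta 0) ((R ** cyc) *v sph_pt s p)) \<partial>circ \<partial>circ)"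
      by (simp add: nn_integral_cmult)
    also have "\<dots> = (\<integral>\<^sup>+s. \<integral>\<^sup>+p. ennreal (\<bar>sin p\<bar> / (8 * pi)) * g (R *v zeta 0) (R *v (rotx (s - pi/2) *v zeta p)) \<partial>circ \<partial>circ)"
      by (simp only: mult.assoc[symmetric] ennreal_mult[symmetric] matrix_vector_mul_assoc[symmetric] cyc_sph_pt)
        (simp add: ennreal_mult[symmetric])
    finally show "(\<integral>\<^sup>+y. g (R *v zeta 0) y \<partial>sphere_unif) = (\<integral>\<^sup>+s. \<integral>\<^sup>+p. ennreal (\<bar>sin p\<bar> / (8 * pi)) * g (R *v zeta 0) (R *v (rotx (s - pi/2) *v zeta p)) \<partial>circ \<partial>circ)" .
  qed measurable
  also have "\<dots> = (\<integral>\<^sup>+s. \<integral>\<^sup>+R. \<integral>\<^sup>+p. ennreal (\<bar>sin p\<bar> / (8 * pi)) * g (R *v zeta 0) (R *v (rotx (s - pi/2) *v zeta p)) \<partial>circ \<partial>haar \<partial>circ)"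
    by (rule seg_haar.Fubini') measurable
  also have "\<dots> = (\<integral>\<^sup>+s. \<integral>\<^sup>+p. \<integral>\<^sup>+R. ennreal (\<bar>sin p\<bar> / (8 * pi)) * g (R *v zeta 0) (R *v (rotx (s - pi/2) *v zeta p)) \<partial>haar \<partial>circ \<partial>circ)"
    by (intro nn_integral_cong seg_haar.Fubini') measurable
  also have "\<dots> = (\<integral>\<^sup>+s. \<integral>\<^sup>+p. ennreal (\<bar>sin p\<bar> / (8 * pi)) * K p \<partial>circ \<partial>circ)"
    by (simp add: nn_integral_cmult rot)
  also have "\<dots> = ennreal (2 * pi) * (\<integral>\<^sup>+p. ennreal (\<bar>sin p\<bar> / (8 * pi)) * K p \<partial>circ)"
    by (simp add: emeasure_seg mult.commute)
  also have "(\<integral>\<^sup>+p. ennreal (\<bar>sin p\<bar> / (8 * pi)) * K p \<partial>circ) = 2 * (\<integral>\<^sup>+p. ennreal (\<bar>sin p\<bar> / (8 * pi)) * K p \<partial>seg 0 pi)"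
    by (rule nn_integral_circ_even) (simp_all add: per even)
  also have "ennreal (2 * pi) * \<dots> = ennreal (4 * pi) * (\<integral>\<^sup>+p. ennreal (\<bar>sin p\<bar> / (8 * pi)) * K p \<partial>seg 0 pi)"
  proof -
    have "ennreal (2 * pi) * 2 = ennreal (4 * pi)"
      using ennreal_mult[of "2 * pi" 2] by simp
    then show ?thesis
      by (simp only: mult.assoc[symmetric])
  qed
  also have "\<dots> = (\<integral>\<^sup>+p. ennreal (4 * pi) * (ennreal (\<bar>sin p\<bar> / (8 * pi)) * K p) \<partial>seg 0 pi)"
    by (rule nn_integral_cmult[symmetric]) measurable
  also have "\<dots> = (\<integral>\<^sup>+p. ennreal (sin p / 2) * K p \<partial>seg 0 pi)"
  proof (rule nn_integral_cong_AE)
    show "AE p in seg 0 pi. ennreal (4 * pi) * (ennreal (\<bar>sin p\<bar> / (8 * pi)) * K p) = ennreal (sin p / 2) * K p"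
      using AE_seg[of 0 pi]
    proof eventually_elim
      case (elim p)
      then have "\<bar>sin p\<bar> = sin p"
        by (simp add: sin_ge_zero)
      then show ?case
        by (simp add: mult.assoc[symmetric] ennreal_mult[symmetric])
    qed
  qed
  finally show ?thesis
    by (simp add: K_def)
qed

section \<open>Crossing arcs\<close>

lemma AE_lborel_imp_seg: "AE x in lborel. P x \<Longrightarrow> AE x in seg a b. P x"
  unfolding seg_def by (subst AE_density) (simp_all add: eventually_mono)

lemma zeta_eq: "zeta a = cos a *\<^sub>R zeta 0 + sin a *\<^sub>R zeta (pi/2)"
  by (simp add: zeta_def vec_eq_iff forall_3)

lemma zeta_inner: "zeta a \<bullet> zeta b = cos (a - b)"
  by (simp add: zeta_def inner_vec_def sum_3 cos_diff)

lemma norm_zeta: "norm (zeta a) = 1"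
  by (simp add: norm_eq_sqrt_inner zeta_inner)

lemma zeta_eq_iff: "zeta a = zeta b \<longleftrightarrow> cos a = cos b \<and> sin a = sin b"
  by (simp add: zeta_def vec_eq_iff forall_3)

lemma zeta_inj:
  assumes "a \<in> {0..<pi}" "b \<in> {0..<pi}" "zeta a = zeta b"
  shows "a = b"
proof -
  have "cos a = cos b" using assms(3) by (simp add: zeta_eq_iff)
  then show ?thesis
    using assms cos_inj_pi[of a b] by auto
qed

lemma rotation_matrix_inj: "rotation_matrix R \<Longrightarrow> R *v x = R *v y \<longleftrightarrow> x = y" for R :: "real^'n^'n"
  using rotation_matrix_cancel(3)[of R x] rotation_matrix_cancel(3)[of R y] by fastforce

lemma sph_dist_rotation:
  assumes "rotation_matrix R" "t \<in> {0..pi}"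
  shows "sph_dist (R *v zeta a) (R *v zeta (a + t)) = t"
  using assms by (simp add: sph_dist_def rotation_matrix_inner zeta_inner arccos_cos)

lemma arc_interior_rotation:
  assumes R: "rotation_matrix R" and t: "t \<in> {0<..<pi}"
  shows "arc_interior (R *v zeta 0) (R *v zeta t) = (\<lambda>a. R *v zeta a) ` {0<..<t}"
proof -
  let ?x = "R *v zeta 0" and ?y = "R *v zeta t" and ?u = "R *v zeta (pi/2)"
  have s: "sin t > 0"
    using t by (intro sin_gt_zero) auto
  have comb: "R *v zeta a = cos a *\<^sub>R ?x + sin a *\<^sub>R ?u" for a
    by (subst zeta_eq) (simp only: matrix_vector_right_distrib matrix_vector_mult_scaleR)
  have d: "sph_dist ?x ?y = t"
    using sph_dist_rotation[OF R, of t 0] t by simp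
  \<comment> \<open>\<open>0 < t < pi\<close> makes \<open>sin t\<close> nonzero, so the tangent
    vector in \<open>gc_arc\<close> is forced.\<close>
  have v: "v = ?u" if "cos t *\<^sub>R ?x + sin t *\<^sub>R v = ?y" for v
    using that s comb[of t] by simp
  have u: "norm ?u = 1" "?x \<bullet> ?u = 0" "cos t *\<^sub>R ?x + sin t *\<^sub>R ?u = ?y"
    using R comb[of t] by (simp_all add: rotation_matrix_norm rotation_matrix_inner norm_zeta zeta_inner)
  have "gc_arc ?x ?y = (\<lambda>a. R *v zeta a) ` {0..t}"
  proof
    show "gc_arc ?x ?y \<subseteq> (\<lambda>a. R *v zeta a) ` {0..t}"
    proof
      fix z assume "z \<in> gc_arc ?x ?y"
      then obtain s w where w: "z = cos s *\<^sub>R ?x + sin s *\<^sub>R w" "cos t *\<^sub>R ?x + sin t *\<^sub>R w = ?y"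
          "0 \<le> s" "s \<le> t"
        unfolding gc_arc_def d by blast
      then have "z = R *v zeta s"
        unfolding v[OF w(2)] by (simp only: comb[of s])
      then show "z \<in> (\<lambda>a. R *v zeta a) ` {0..t}"
        using w by auto
    qed
    show "(\<lambda>a. R *v zeta a) ` {0..t} \<subseteq> gc_arc ?x ?y"
    proof
      fix z assume "z \<in> (\<lambda>a. R *v zeta a) ` {0..t}"
      then obtain a where a: "z = R *v zeta a" "0 \<le> a" "a \<le> t"
        by auto
      then have "z = cos a *\<^sub>R ?x + sin a *\<^sub>R ?u"
        by (simp only: comb[of a])
      with u a(2,3) show "z \<in> gc_arc ?x ?y"
        unfolding gc_arc_def d by blast
    qed
  qed
  moreover have "R *v zeta a \<noteq> ?x" "R *v zeta a \<noteq> ?y" if "a \<in> {0<..<t}" for a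
    using zeta_inj[of a 0] zeta_inj[of a t] that t by (auto simp: rotation_matrix_inj[OF R])
  moreover have "{0..t} = insert 0 (insert t {0<..<t})"
    using t by auto
  ultimately show ?thesis
    unfolding arc_interior_def by auto
qed

text \<open>The position \<open>s\<close> on the circle falls inside the arc of length
  \<open>t\<close>, see \<open>hit_iff\<close>. The trigonometric form is periodic in
  \<open>s\<close> and visibly Borel.\<close>

definition hit :: "real \<Rightarrow> real \<Rightarrow> bool" where
  "hit t s \<longleftrightarrow> 0 < sin s \<and> cos t < cos s"

lemma hit_iff:
  assumes t: "t \<in> {0<..<pi}"
  shows "hit t s \<longleftrightarrow> (\<exists>a\<in>{0<..<t}. zeta a = zeta s)"
proof
  assume h: "hit t s"
  let ?a = "arccos (cos s)"
  have c: "cos ?a = cos s"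
    by simp
  have "sin ?a = sqrt (1 - (cos s)\<^sup>2)"
    by (simp add: sin_arccos_abs)
  also have "\<dots> = sin s"
    using h by (simp add: hit_def cos_squared_eq)
  finally have z: "zeta ?a = zeta s"
    using c by (simp add: zeta_eq_iff)
  have a: "0 \<le> ?a" "?a \<le> pi"
    by (simp_all add: arccos_lbound arccos_ubound)
  have "?a < t"
    using h t a c cos_mono_less_eq[of t ?a] by (simp add: hit_def)
  moreover have "?a \<noteq> 0"
    using h z by (auto simp: hit_def zeta_eq_iff)
  ultimately show "\<exists>a\<in>{0<..<t}. zeta a = zeta s"
    using a z by (intro bexI[of _ ?a]) auto
next
  assume "\<exists>a\<in>{0<..<t}. zeta a = zeta s"
  then obtain a where a: "0 < a" "a < t" "cos a = cos s" "sin a = sin s"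
    by (auto simp: zeta_eq_iff)
  then show "hit t s"
    using t sin_gt_zero[of a] cos_mono_less_eq[of t a] by (auto simp: hit_def)
qed

lemma hit_measurable [measurable (raw)]:
  assumes [measurable]: "f \<in> borel_measurable M" "g \<in> borel_measurable M"
  shows "Measurable.pred M (\<lambda>x. hit (f x) (g x))"
  unfolding hit_def by measurable

lemma hit_periodic: "hit t (s + 2 * pi) = hit t s"
  by (simp add: hit_def)

text \<open>An arc shorter than \<open>pi\<close> cannot contain two antipodal points, so at most
  one of the two meeting points of the great circles counts.\<close>

lemma not_hit_antipode: "hit t s \<Longrightarrow> \<not> hit t' (s + pi)"
  by (simp add: hit_def)

lemma zeta_rotate: "zeta (a - s) = zeta b \<longleftrightarrow> zeta a = zeta (b + s)"
proof -
  have "zeta (a - s) = zeta b \<longleftrightarrow> rotz s *v zeta (a - s) = rotz s *v zeta b"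
    by (rule rotation_matrix_inj[OF rotation_matrix_rotz, symmetric])
  then show ?thesis
    by (simp add: rotz_zeta add.commute)
qed

text \<open>Two distinct great circles meet in an antipodal pair. After removing
  \<open>rotz s\<close>, the third coordinate \<open>sin p * sin (b + c)\<close> must vanish, which
  leaves \<open>a - s\<close> and \<open>b + c\<close> both at 0 or both at \<open>pi\<close>,
  modulo full turns.\<close>

lemma zeta_meets:
  assumes p: "sin p \<noteq> 0"
  shows "zeta a = (rotz s ** rotx p ** rotz c) *v zeta b \<longleftrightarrow>
    (zeta a = zeta s \<and> zeta b = zeta (- c)) \<or> (zeta a = zeta (s + pi) \<and> zeta b = zeta (- c + pi))"
proof -
  have "zeta a = (rotz s ** rotx p ** rotz c) *v zeta b \<longleftrightarrow> rotz s *v zeta (a - s) = rotz s *v (rotx p *v zeta (b + c))"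
    by (simp add: matrix_vector_mul_assoc[symmetric] rotz_zeta add.commute)
  also have "\<dots> \<longleftrightarrow> zeta (a - s) = rotx p *v zeta (b + c)"
    by (rule rotation_matrix_inj[OF rotation_matrix_rotz])
  also have "\<dots> \<longleftrightarrow> cos (a - s) = cos (b + c) \<and> sin (a - s) = 0 \<and> sin (b + c) = 0"
    using p by (auto simp: zeta_def rotx_def mat3_simps)
  also have "\<dots> \<longleftrightarrow> (zeta (a - s) = zeta 0 \<and> zeta (b - (- c)) = zeta 0) \<or> (zeta (a - s) = zeta pi \<and> zeta (b - (- c)) = zeta pi)"
  proof -
    have "cos (b + c) = 1 \<or> cos (b + c) = -1" if "sin (b + c) = 0"
      using that sin_cos_squared_add[of "b + c"] by (simp add: power2_eq_1_iff)
    then show ?thesis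
      by (auto simp: zeta_eq_iff)
  qed
  also have "\<dots> \<longleftrightarrow> (zeta a = zeta s \<and> zeta b = zeta (- c)) \<or> (zeta a = zeta (s + pi) \<and> zeta b = zeta (- c + pi))"
    by (simp only: zeta_rotate add_0 add.commute)
  finally show ?thesis .
qed

text \<open>\<open>s\<close> and \<open>- c\<close> are the positions of one meeting point on the
  first and on the second circle; the other meeting point is half a turn further on both.\<close>

lemma arcs_cross_iff:
  fixes s p c t t' :: real
  assumes R: "rotation_matrix R" and t: "t \<in> {0<..<pi}" "t' \<in> {0<..<pi}" and p: "sin p \<noteq> 0"
  defines "S \<equiv> R ** (rotz s ** rotx p ** rotz c)"
  shows "arcs_cross (R *v zeta 0) (R *v zeta t) (S *v zeta 0) (S *v zeta t') \<longleftrightarrow>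
    (hit t s \<and> hit t' (- c)) \<or> (hit t (s + pi) \<and> hit t' (- c + pi))"
proof -
  have S: "rotation_matrix S"
    using R by (simp add: S_def rotation_matrix_mult rotation_matrix_rotx rotation_matrix_rotz)
  have anti: "Q *v zeta 0 \<noteq> - (Q *v zeta r)" if "rotation_matrix Q" "r \<in> {0<..<pi}" for Q r
  proof
    assume "Q *v zeta 0 = - (Q *v zeta r)"
    then have "(Q *v zeta 0) \<bullet> (Q *v zeta r) = - ((Q *v zeta r) \<bullet> (Q *v zeta r))"
      by simp
    then have "cos r = cos pi"
      by (simp add: rotation_matrix_inner that zeta_inner)
    then show False
      using that cos_inj_pi[of r pi] by auto
  qed
  have "arcs_cross (R *v zeta 0) (R *v zeta t) (S *v zeta 0) (S *v zeta t') \<longleftrightarrow>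
      (\<exists>a\<in>{0<..<t}. \<exists>b\<in>{0<..<t'}. R *v zeta a = S *v zeta b)"
    using anti[OF R t(1)] anti[OF S t(2)]
    by (auto simp: arcs_cross_def arc_interior_rotation[OF R t(1)] arc_interior_rotation[OF S t(2)])
  also have "\<dots> \<longleftrightarrow> (\<exists>a\<in>{0<..<t}. \<exists>b\<in>{0<..<t'}. zeta a = (rotz s ** rotx p ** rotz c) *v zeta b)"
    unfolding S_def matrix_vector_mul_assoc[of R "rotz s ** rotx p ** rotz c", symmetric] rotation_matrix_inj[OF R] ..
  also have "\<dots> \<longleftrightarrow> (hit t s \<and> hit t' (- c)) \<or> (hit t (s + pi) \<and> hit t' (- c + pi))"
    unfolding zeta_meets[OF p] hit_iff[OF t(1)] hit_iff[OF t(2)] by blast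
  finally show ?thesis .
qed

lemma nn_integral_hit:
  assumes t: "t \<in> {0<..<pi}" and [measurable]: "f \<in> borel_measurable borel"
  shows "(\<integral>\<^sup>+s. of_bool (hit t s) * f s \<partial>circ) = (\<integral>\<^sup>+s. of_bool (s \<le> t) * f s \<partial>seg 0 pi)"
proof -
  have *: "hit t s \<longleftrightarrow> s < t" if "s \<in> {0<..<2 * pi}" "s \<noteq> pi" for s
  proof (cases "s < pi")
    case True
    then show ?thesis
      using that t sin_gt_zero[of s] cos_mono_less_eq[of t s] by (auto simp: hit_def)
  next
    case False
    then have "sin s < 0"
      using that by (intro sin_lt_zero) auto
    then show ?thesis
      using False t by (auto simp: hit_def)
  qed
  have "(\<integral>\<^sup>+s. of_bool (hit t s) * f s \<partial>circ) = (\<integral>\<^sup>+s. of_bool (s \<le> t) * f s \<partial>circ)"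
  proof (rule nn_integral_cong_AE)
    have "AE s in circ. s \<noteq> t" "AE s in circ. s \<noteq> pi"
      by (intro AE_lborel_imp_seg AE_lborel_singleton)+
    then show "AE s in circ. of_bool (hit t s) * f s = of_bool (s \<le> t) * f s"
      using AE_seg_open[of 0 "2 * pi"]
      by eventually_elim (use * in auto)
  qed
  also have "\<dots> = (\<integral>\<^sup>+s. of_bool (s \<le> t) * f s \<partial>seg 0 pi) + (\<integral>\<^sup>+s. of_bool (s \<le> t) * f s \<partial>seg pi (2 * pi))"
    by (rule nn_integral_seg_split) auto
  also have "(\<integral>\<^sup>+s. of_bool (s \<le> t) * f s \<partial>seg pi (2 * pi)) = 0"
  proof (subst nn_integral_0_iff_AE, measurable)
    show "AE s in seg pi (2 * pi). of_bool (s \<le> t) * f s = 0"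
      using AE_seg[of pi "2 * pi"] by eventually_elim (use t in auto)
  qed
  finally show ?thesis by simp
qed

section \<open>Measurability of the crossing relation\<close>

text \<open>Crossing asks for the existence of a common point, and projections of Borel sets need
  not be Borel; projections of compact sets are compact. So arc interiors are exhausted by compact
  sets: a distance of at least \<open>inverse (real (Suc n))\<close> replaces being different from
  the ends, and \<open>arccos\<close> is replaced by continuous expressions in
  \<open>x \<bullet> y\<close>.\<close>

definition arc_pts :: "nat \<Rightarrow> ((real^3) \<times> (real^3) \<times> (real^3)) set" where
  "arc_pts n = {(x, y, z). norm x = 1 \<and> norm y = 1 \<and> inverse (real (Suc n)) \<le> dist z x \<and> inverse (real (Suc n)) \<le> dist z y \<and>
    (\<exists>v s. norm v = 1 \<and> x \<bullet> v = 0 \<and> (x \<bullet> y) *\<^sub>R x + sqrt (1 - (x \<bullet> y)\<^sup>2) *\<^sub>R v = y \<and>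
      s \<in> {0..pi} \<and> x \<bullet> y \<le> cos s \<and> z = cos s *\<^sub>R x + sin s *\<^sub>R v)}"

lemma compact_arc_pts: "compact (arc_pts n)"
proof -
  let ?D = "{(x, y, z, v, s). inverse (real (Suc n)) \<le> dist z x \<and> inverse (real (Suc n)) \<le> dist z y \<and> x \<bullet> v = 0 \<and>
    (x \<bullet> y) *\<^sub>R x + sqrt (1 - (x \<bullet> y)\<^sup>2) *\<^sub>R v = y \<and> x \<bullet> y \<le> cos s \<and> z = cos s *\<^sub>R x + sin s *\<^sub>R v}"
  let ?C = "sphere 0 1 \<times> sphere 0 1 \<times> cball 0 2 \<times> sphere 0 1 \<times> {0..pi}
    :: ((real^3) \<times> (real^3) \<times> (real^3) \<times> (real^3) \<times> real) set"
  have "closed ?D"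
    unfolding case_prod_beta'
    by (intro closed_Collect_conj closed_Collect_eq closed_Collect_le continuous_intros)
  then have "compact (?C \<inter> ?D)"
    by (intro compact_Int_closed compact_Times) auto
  then have "compact ((\<lambda>(x, y, z, v, s). (x, y, z)) ` (?C \<inter> ?D))"
    unfolding case_prod_beta' by (intro compact_continuous_image continuous_intros)
  moreover have "(\<lambda>(x, y, z, v, s). (x, y, z)) ` (?C \<inter> ?D) = arc_pts n"
  proof
    show "arc_pts n \<subseteq> (\<lambda>(x, y, z, v, s). (x, y, z)) ` (?C \<inter> ?D)"
    proof
      fix q assume "q \<in> arc_pts n"
      then obtain x y z v s where q: "q = (x, y, z)" "(x, y, z, v, s) \<in> ?D"
        and n: "norm x = 1" "norm y = 1" "norm v = 1" "s \<in> {0..pi}"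
        unfolding arc_pts_def by blast
      have "norm z \<le> norm (cos s *\<^sub>R x) + norm (sin s *\<^sub>R v)"
      proof -
        have "z = cos s *\<^sub>R x + sin s *\<^sub>R v"
          using q(2) by blast
        then show ?thesis
          by (simp only: norm_triangle_ineq)
      qed
      also have "\<dots> \<le> 1 + 1"
        using n by (intro add_mono) auto
      finally have "(x, y, z, v, s) \<in> ?C"
        using n by simp
      then show "q \<in> (\<lambda>(x, y, z, v, s). (x, y, z)) ` (?C \<inter> ?D)"
        using q by (intro image_eqI[of _ _ "(x, y, z, v, s)"] IntI) (simp_all only: split)
    qed
    show "(\<lambda>(x, y, z, v, s). (x, y, z)) ` (?C \<inter> ?D) \<subseteq> arc_pts n"
    proof
      fix q assume "q \<in> (\<lambda>(x, y, z, v, s). (x, y, z)) ` (?C \<inter> ?D)"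
      then obtain w where w: "w \<in> ?C" "w \<in> ?D" "q = (\<lambda>(x, y, z, v, s). (x, y, z)) w"
        by blast
      obtain x y z v s where "w = (x, y, z, v, s)"
        by (cases w rule: prod_cases5)
      with w have q: "q = (x, y, z)" "(x, y, z, v, s) \<in> ?D" "(x, y, z, v, s) \<in> ?C"
        by (simp_all only: split)
      then have "norm x = 1" "norm y = 1" "norm v = 1" "s \<in> {0..pi}"
        by simp_all
      with q(2) show "q \<in> arc_pts n"
        unfolding q(1) arc_pts_def by blast
    qed
  qed
  ultimately show ?thesis by simp
qed

lemma arc_interior_iff_arc_pts:
  assumes x: "norm x = 1" and y: "norm y = 1"
  shows "z \<in> arc_interior x y \<longleftrightarrow> (\<exists>n. (x, y, z) \<in> arc_pts n)"
proof -
  have "\<bar>x \<bullet> y\<bar> \<le> 1"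
    using Cauchy_Schwarz_ineq2[of x y] x y by simp
  then have xy: "-1 \<le> x \<bullet> y" "x \<bullet> y \<le> 1"
    by auto
  have d: "cos (sph_dist x y) = x \<bullet> y" "sin (sph_dist x y) = sqrt (1 - (x \<bullet> y)\<^sup>2)"
    "0 \<le> sph_dist x y" "sph_dist x y \<le> pi"
    using xy by (auto simp: sph_dist_def sin_arccos arccos_lbound arccos_ubound)
  have le: "0 \<le> s \<and> s \<le> sph_dist x y \<longleftrightarrow> s \<in> {0..pi} \<and> x \<bullet> y \<le> cos s" for s
    using cos_mono_le_eq[of "sph_dist x y" s] d by auto
  have ne: "z \<noteq> x \<and> z \<noteq> y \<longleftrightarrow> (\<exists>n. inverse (real (Suc n)) \<le> dist z x \<and> inverse (real (Suc n)) \<le> dist z y)"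
  proof
    assume "z \<noteq> x \<and> z \<noteq> y"
    then have "0 < min (dist z x) (dist z y)"
      by simp
    from reals_Archimedean[OF this] obtain n where "inverse (real (Suc n)) < min (dist z x) (dist z y)"
      by blast
    then show "\<exists>n. inverse (real (Suc n)) \<le> dist z x \<and> inverse (real (Suc n)) \<le> dist z y"
      by (intro exI[of _ n]) simp
  next
    assume "\<exists>n. inverse (real (Suc n)) \<le> dist z x \<and> inverse (real (Suc n)) \<le> dist z y"
    then obtain n where "inverse (real (Suc n)) \<le> dist z x" "inverse (real (Suc n)) \<le> dist z y"
      by blast
    moreover have "0 < inverse (real (Suc n))"
      by simp
    ultimately have "0 < dist z x" "0 < dist z y"
      by linarith+
    then show "z \<noteq> x \<and> z \<noteq> y" by auto
  qed
  have "z \<in> arc_interior x y \<longleftrightarrow> (z \<noteq> x \<and> z \<noteq> y) \<and> (\<exists>v s. norm v = 1 \<and> x \<bullet> v = 0 \<and>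
      (x \<bullet> y) *\<^sub>R x + sqrt (1 - (x \<bullet> y)\<^sup>2) *\<^sub>R v = y \<and>
      (0 \<le> s \<and> s \<le> sph_dist x y) \<and> z = cos s *\<^sub>R x + sin s *\<^sub>R v)"
    unfolding arc_interior_def gc_arc_def d(1,2) by blast
  then show ?thesis
    unfolding le ne arc_pts_def using x y by auto
qed

text \<open>A countable union of compact projections, cut by the open conditions that exclude
  antipodal pairs. The norm conditions, already part of \<open>arc_pts\<close>, allow work with
  Borel sets of the whole space.\<close>

lemma arcs_cross_measurable [measurable]:
  "Measurable.pred (borel \<Otimes>\<^sub>M borel \<Otimes>\<^sub>M borel \<Otimes>\<^sub>M borel) (\<lambda>(x1, x2, x3, x4).
    norm x1 = 1 \<and> norm x2 = 1 \<and> norm x3 = 1 \<and> norm x4 = 1 \<and> arcs_cross x1 x2 x3 x4)"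
proof -
  let ?F = "\<lambda>n m. {(x1, x2, x3, x4, z). (x1, x2, z) \<in> arc_pts n \<and> (x3, x4, z) \<in> arc_pts m}"
  let ?G = "\<lambda>n m. (\<lambda>(x1, x2, x3, x4, z). (x1, x2, x3, x4)) ` ?F n m"
  have "compact (?F n m)" for n m
  proof -
    have "closed (?F n m)"
    proof -
      let ?p = "\<lambda>(x1, x2, x3, x4, z). (x1, x2, z)"
      let ?q = "\<lambda>(x1, x2, x3, x4, z). (x3, x4, z)"
      have "closed (?p -` arc_pts n :: ((real^3) \<times> (real^3) \<times> (real^3) \<times> (real^3) \<times> (real^3)) set)"
        "closed (?q -` arc_pts m :: ((real^3) \<times> (real^3) \<times> (real^3) \<times> (real^3) \<times> (real^3)) set)"
        unfolding case_prod_beta'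
        by (intro continuous_closed_vimage compact_imp_closed compact_arc_pts allI continuous_intros)+
      moreover have "?F n m = ?p -` arc_pts n \<inter> ?q -` arc_pts m"
        by auto
      ultimately show ?thesis
        by (simp only: closed_Int)
    qed
    moreover have "bounded (?F n m)"
    proof -
      obtain b where b: "\<And>p. p \<in> arc_pts n \<Longrightarrow> norm p \<le> b"
        using compact_imp_bounded[OF compact_arc_pts] unfolding bounded_iff by blast
      have "?F n m \<subseteq> cball 0 1 \<times> cball 0 1 \<times> cball 0 1 \<times> cball 0 1 \<times> cball 0 b"
      proof
        fix q assume "q \<in> ?F n m"
        then obtain x1 x2 x3 x4 z where q: "q = (x1, x2, x3, x4, z)" "(x1, x2, z) \<in> arc_pts n" "(x3, x4, z) \<in> arc_pts m"
          by blast
        have "norm z \<le> norm (x2, z)" "norm (x2, z) \<le> norm (x1, x2, z)"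
          by (rule norm_snd_le)+
        then have "norm z \<le> b"
          using b[OF q(2)] by linarith
        then show "q \<in> cball 0 1 \<times> cball 0 1 \<times> cball 0 1 \<times> cball 0 1 \<times> cball 0 b"
          using q unfolding arc_pts_def by simp
      qed
      then show ?thesis
        by (rule bounded_subset[rotated]) (intro bounded_Times bounded_cball)
    qed
    ultimately show ?thesis
      by (simp only: compact_eq_bounded_closed)
  qed
  then have "compact (?G n m)" for n m
    by (intro compact_continuous_image) (auto simp: case_prod_beta' intro!: continuous_intros)
  then have [measurable]: "?G n m \<in> sets (borel \<Otimes>\<^sub>M borel \<Otimes>\<^sub>M borel \<Otimes>\<^sub>M borel)" for n m
    unfolding borel_prod by (intro borel_compact)
  have eq: "(norm x1 = 1 \<and> norm x2 = 1 \<and> norm x3 = 1 \<and> norm x4 = 1 \<and> arcs_cross x1 x2 x3 x4)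
    \<longleftrightarrow> x1 \<noteq> - x2 \<and> x3 \<noteq> - x4 \<and> (\<exists>n m. (x1, x2, x3, x4) \<in> ?G n m)" (is "?l \<longleftrightarrow> ?r") for x1 x2 x3 x4
  proof
    assume l: ?l
    then obtain z where z: "z \<in> arc_interior x1 x2" "z \<in> arc_interior x3 x4"
      unfolding arcs_cross_def by blast
    then obtain n m where "(x1, x2, z) \<in> arc_pts n" "(x3, x4, z) \<in> arc_pts m"
      using l by (auto simp: arc_interior_iff_arc_pts)
    then have "(x1, x2, x3, x4) \<in> ?G n m"
      by (intro image_eqI[of _ _ "(x1, x2, x3, x4, z)"]) simp_all
    with l show ?r unfolding arcs_cross_def by blast
  next
    assume r: ?r
    then obtain n m z where z: "(x1, x2, z) \<in> arc_pts n" "(x3, x4, z) \<in> arc_pts m"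
      by auto
    then have n: "norm x1 = 1" "norm x2 = 1" "norm x3 = 1" "norm x4 = 1"
      unfolding arc_pts_def by simp_all
    then have "z \<in> arc_interior x1 x2 \<inter> arc_interior x3 x4"
      using z by (auto simp: arc_interior_iff_arc_pts)
    with r n show ?l unfolding arcs_cross_def by blast
  qed
  show ?thesis
    unfolding eq by measurable
qed

section \<open>The crossing integral in terms of frames\<close>

text \<open>The norm conditions make this Borel on the whole space, by
  \<open>arcs_cross_measurable\<close>; on the sphere they hold automatically.\<close>

definition cross_ind :: "real^3 \<Rightarrow> real^3 \<Rightarrow> real^3 \<Rightarrow> real^3 \<Rightarrow> ennreal" where
  "cross_ind x1 x2 x3 x4 = of_bool (norm x1 = 1 \<and> norm x2 = 1 \<and> norm x3 = 1 \<and> norm x4 = 1 \<and> arcs_cross x1 x2 x3 x4)"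

lemma cross_ind_measurable [measurable (raw)]:
  assumes [measurable]: "f1 \<in> borel_measurable M" "f2 \<in> borel_measurable M"
    "f3 \<in> borel_measurable M" "f4 \<in> borel_measurable M"
  shows "(\<lambda>x. cross_ind (f1 x) (f2 x) (f3 x) (f4 x)) \<in> borel_measurable M"
proof -
  let ?N = "borel \<Otimes>\<^sub>M borel \<Otimes>\<^sub>M borel \<Otimes>\<^sub>M borel :: ((real^3) \<times> (real^3) \<times> (real^3) \<times> (real^3)) measure"
  have p: "(\<lambda>x. (f1 x, f2 x, f3 x, f4 x)) \<in> M \<rightarrow>\<^sub>M ?N"
    by (intro measurable_Pair assms)
  have "(\<lambda>q. of_bool (case q of (x1, x2, x3, x4) \<Rightarrow>
      norm x1 = 1 \<and> norm x2 = 1 \<and> norm x3 = 1 \<and> norm x4 = 1 \<and> arcs_cross x1 x2 x3 x4) :: ennreal)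
    \<in> borel_measurable ?N"
    by (rule measurable_compose[OF arcs_cross_measurable measurable_of_bool])
  from measurable_compose[OF p this] show ?thesis
    unfolding cross_ind_def split .
qed

lemma cross_ind_rotation:
  fixes s p c t t' :: real
  assumes R: "rotation_matrix R" and t: "t \<in> {0<..<pi}" "t' \<in> {0<..<pi}" and p: "sin p \<noteq> 0"
  defines "S \<equiv> R ** (rotz s ** rotx p ** rotz c)"
  shows "cross_ind (R *v zeta 0) (R *v zeta t) (S *v zeta 0) (S *v zeta t')
    = of_bool (hit t s) * of_bool (hit t' (- c)) + of_bool (hit t (s + pi)) * of_bool (hit t' (- c + pi))"
proof -
  have S: "rotation_matrix S"
    using R by (simp add: S_def rotation_matrix_mult rotation_matrix_rotx rotation_matrix_rotz)
  show ?thesis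
    unfolding cross_ind_def using arcs_cross_iff[OF R t p, of s c] not_hit_antipode[of t s t]
    by (auto simp: S_def[symmetric] rotation_matrix_norm[OF R] rotation_matrix_norm[OF S] norm_zeta)
qed

text \<open>The substitution \<open>(s, p, c) \<mapsto> (s + \<pi>, - p, c - \<pi>)\<close> preserves the rotation and exchanges the
  two points in which the great circles meet.\<close>

lemma rotz_rotx_rotz_antipode: "rotz (s + pi) ** rotx (- p) ** rotz (c - pi) = rotz s ** rotx p ** rotz c"
  by (simp add: rotz_def rotx_def mat3_simps)

text \<open>For a fixed first arc, left invariance expresses the second frame relative to
  \<open>R\<close>. Its Euler angles are the position of a meeting point on the first arc, the
  crossing angle, and minus the position on the second arc. The two antipodal meeting points
  contribute equally, which doubles \<open>1/(16 pi^2)\<close>.\<close>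

lemma nn_integral_crossing_arc:
  fixes V :: "real^3^3 \<Rightarrow> ennreal"
  assumes R: "rotation_matrix R" and t: "t \<in> {0<..<pi}" "t' \<in> {0<..<pi}"
    and V [measurable]: "V \<in> borel_measurable borel"
  shows "(\<integral>\<^sup>+S. V S * cross_ind (R *v zeta 0) (R *v zeta t) (S *v zeta 0) (S *v zeta t') \<partial>haar)
    = (\<integral>\<^sup>+s. of_bool (s \<le> t) * (\<integral>\<^sup>+p. ennreal (\<bar>sin p\<bar> / (8 * pi\<^sup>2)) *
        (\<integral>\<^sup>+c. of_bool (c \<le> t') * V (R ** (rotz s ** rotx p ** rotz (- c))) \<partial>seg 0 pi) \<partial>circ) \<partial>seg 0 pi)"
proof -
  let ?T = "\<lambda>s p c. rotz s ** rotx p ** rotz c"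
  let ?X = "\<lambda>S. V S * cross_ind (R *v zeta 0) (R *v zeta t) (S *v zeta 0) (S *v zeta t')"
  let ?k = "\<lambda>p. ennreal (\<bar>sin p\<bar> / (16 * pi\<^sup>2))"
  define G where "G s p c = of_bool (hit t s) * (of_bool (hit t' (- c)) * V (R ** ?T s p c))" for s p c
  have [measurable (raw)]: "(\<lambda>x. G (f x) (g x) (h x)) \<in> borel_measurable M"
    if [measurable]: "f \<in> borel_measurable M" "g \<in> borel_measurable M" "h \<in> borel_measurable M"
    for f g h and M :: "'c measure"
    unfolding G_def by measurable
  have Gp: "G (s + 2 * pi) p c = G s p c" "G s (p + 2 * pi) c = G s p c" "G s p (c + 2 * pi) = G s p c" for s p c
  proof -
    have "hit t' (- c - 2 * pi) = hit t' (- c)"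
      using hit_periodic[of t' "- c - 2 * pi"] by simp
    then show "G (s + 2 * pi) p c = G s p c" "G s (p + 2 * pi) c = G s p c" "G s p (c + 2 * pi) = G s p c"
      by (simp_all add: G_def hit_periodic rotz_periodic rotx_periodic)
  qed
  have split: "?k p * ?X (R ** ?T s p c) = ?k p * (G s p c + G (s + pi) (- p) (c - pi))" for s p c
  proof (cases "sin p = 0")
    case False
    have "G (s + pi) (- p) (c - pi) = of_bool (hit t (s + pi)) * (of_bool (hit t' (- c + pi)) * V (R ** ?T s p c))"
      by (simp add: G_def rotz_rotx_rotz_antipode)
    then show ?thesis
      by (simp add: cross_ind_rotation[OF R t False] G_def distrib_left mult_ac)
  qed simp
  have "(\<integral>\<^sup>+S. ?X S \<partial>haar) = (\<integral>\<^sup>+S. ?X (R ** S) \<partial>haar)"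
    by (rule nn_integral_haar_left[OF R, symmetric]) measurable
  also have "\<dots> = (\<integral>\<^sup>+s. \<integral>\<^sup>+p. ?k p * (\<integral>\<^sup>+c. ?X (R ** ?T s p c) \<partial>circ) \<partial>circ \<partial>circ)"
    by (subst nn_integral_haar, measurable) (simp only: fibre_def)
  also have "\<dots> = (\<integral>\<^sup>+s. \<integral>\<^sup>+p. \<integral>\<^sup>+c. ?k p * ?X (R ** ?T s p c) \<partial>circ \<partial>circ \<partial>circ)"
    by (intro nn_integral_cong nn_integral_cmult[symmetric]) measurable
  also have "\<dots> = (\<integral>\<^sup>+s. \<integral>\<^sup>+p. \<integral>\<^sup>+c. ?k p * (G s p c + G (s + pi) (- p) (c - pi)) \<partial>circ \<partial>circ \<partial>circ)"
    by (simp only: split)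
  also have "\<dots> = (\<integral>\<^sup>+s. \<integral>\<^sup>+p. ?k p * (\<integral>\<^sup>+c. G s p c \<partial>circ) + ?k p * (\<integral>\<^sup>+c. G (s + pi) (- p) c \<partial>circ) \<partial>circ \<partial>circ)"
  proof (intro nn_integral_cong)
    fix s p
    have "(\<integral>\<^sup>+c. G (s + pi) (- p) (c + - pi) \<partial>circ) = (\<integral>\<^sup>+c. G (s + pi) (- p) c \<partial>circ)"
      by (rule nn_integral_circ_translate[where f = "G (s + pi) (- p)"]) (measurable, simp_all add: Gp)
    then have t: "(\<integral>\<^sup>+c. G (s + pi) (- p) (c - pi) \<partial>circ) = (\<integral>\<^sup>+c. G (s + pi) (- p) c \<partial>circ)"
      by (simp only: add_uminus_conv_diff)
    have "(\<integral>\<^sup>+c. ?k p * (G s p c + G (s + pi) (- p) (c - pi)) \<partial>circ)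
        = ?k p * (\<integral>\<^sup>+c. G s p c + G (s + pi) (- p) (c - pi) \<partial>circ)"
      by (rule nn_integral_cmult) measurable
    also have "(\<integral>\<^sup>+c. G s p c + G (s + pi) (- p) (c - pi) \<partial>circ)
        = (\<integral>\<^sup>+c. G s p c \<partial>circ) + (\<integral>\<^sup>+c. G (s + pi) (- p) (c - pi) \<partial>circ)"
      by (rule nn_integral_add) measurable
    finally show "(\<integral>\<^sup>+c. ?k p * (G s p c + G (s + pi) (- p) (c - pi)) \<partial>circ)
        = ?k p * (\<integral>\<^sup>+c. G s p c \<partial>circ) + ?k p * (\<integral>\<^sup>+c. G (s + pi) (- p) c \<partial>circ)"
      by (simp only: t distrib_left)
  qed
  also have "\<dots> = (\<integral>\<^sup>+s. (\<integral>\<^sup>+p. ?k p * (\<integral>\<^sup>+c. G s p c \<partial>circ) \<partial>circ) + (\<integral>\<^sup>+p. ?k p * (\<integral>\<^sup>+c. G (s + pi) p c \<partial>circ) \<partial>circ) \<partial>circ)"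
  proof (rule nn_integral_cong)
    fix s
    have "(\<integral>\<^sup>+p. ?k (- p) * (\<integral>\<^sup>+c. G (s + pi) (- p) c \<partial>circ) \<partial>circ) = (\<integral>\<^sup>+p. ?k p * (\<integral>\<^sup>+c. G (s + pi) p c \<partial>circ) \<partial>circ)"
      by (rule nn_integral_circ_reflect[where f = "\<lambda>p. ?k p * (\<integral>\<^sup>+c. G (s + pi) p c \<partial>circ)"]) (measurable, simp add: Gp)
    then have r: "(\<integral>\<^sup>+p. ?k p * (\<integral>\<^sup>+c. G (s + pi) (- p) c \<partial>circ) \<partial>circ) = (\<integral>\<^sup>+p. ?k p * (\<integral>\<^sup>+c. G (s + pi) p c \<partial>circ) \<partial>circ)"
      by (simp only: sin_minus abs_minus_cancel)
    show "(\<integral>\<^sup>+p. ?k p * (\<integral>\<^sup>+c. G s p c \<partial>circ) + ?k p * (\<integral>\<^sup>+c. G (s + pi) (- p) c \<partial>circ) \<partial>circ)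
        = (\<integral>\<^sup>+p. ?k p * (\<integral>\<^sup>+c. G s p c \<partial>circ) \<partial>circ) + (\<integral>\<^sup>+p. ?k p * (\<integral>\<^sup>+c. G (s + pi) p c \<partial>circ) \<partial>circ)"
      unfolding r[symmetric] by (rule nn_integral_add) measurable
  qed
  also have "\<dots> = (\<integral>\<^sup>+s. \<integral>\<^sup>+p. ?k p * (\<integral>\<^sup>+c. G s p c \<partial>circ) \<partial>circ \<partial>circ) + (\<integral>\<^sup>+s. \<integral>\<^sup>+p. ?k p * (\<integral>\<^sup>+c. G s p c \<partial>circ) \<partial>circ \<partial>circ)"
  proof -
    \<comment> \<open>Last part of the substitution \<open>(s + pi, - p, c - pi)\<close>, after
      \<open>c\<close> and \<open>p\<close> above: shifting \<open>s\<close> back shows that both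
      alternatives integrate to the same value.\<close>
    have e: "(\<integral>\<^sup>+s. \<integral>\<^sup>+p. ?k p * (\<integral>\<^sup>+c. G (s + pi) p c \<partial>circ) \<partial>circ \<partial>circ) = (\<integral>\<^sup>+s. \<integral>\<^sup>+p. ?k p * (\<integral>\<^sup>+c. G s p c \<partial>circ) \<partial>circ \<partial>circ)"
      by (rule nn_integral_circ_translate[where f = "\<lambda>s. \<integral>\<^sup>+p. ?k p * (\<integral>\<^sup>+c. G s p c \<partial>circ) \<partial>circ"])
        (measurable, simp_all add: Gp)
    show ?thesis
      by (subst nn_integral_add, measurable) (simp only: e)
  qed
  also have "\<dots> = 2 * (\<integral>\<^sup>+s. \<integral>\<^sup>+p. ?k p * (\<integral>\<^sup>+c. G s p c \<partial>circ) \<partial>circ \<partial>circ)"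
    by (rule mult_2[symmetric])
  also have "\<dots> = (\<integral>\<^sup>+s. 2 * (\<integral>\<^sup>+p. ?k p * (\<integral>\<^sup>+c. G s p c \<partial>circ) \<partial>circ) \<partial>circ)"
    by (rule nn_integral_cmult[symmetric]) measurable
  also have "\<dots> = (\<integral>\<^sup>+s. \<integral>\<^sup>+p. 2 * (?k p * (\<integral>\<^sup>+c. G s p c \<partial>circ)) \<partial>circ \<partial>circ)"
    by (intro nn_integral_cong nn_integral_cmult[symmetric]) measurable
  also have "\<dots> = (\<integral>\<^sup>+s. of_bool (hit t s) * (\<integral>\<^sup>+p. ennreal (\<bar>sin p\<bar> / (8 * pi\<^sup>2)) *
      (\<integral>\<^sup>+c. of_bool (c \<le> t') * V (R ** ?T s p (- c)) \<partial>seg 0 pi) \<partial>circ) \<partial>circ)"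
  proof (rule nn_integral_cong)
    fix s
    have k2: "2 * ?k p = ennreal (\<bar>sin p\<bar> / (8 * pi\<^sup>2))" for p
      using ennreal_mult[of 2 "\<bar>sin p\<bar> / (16 * pi\<^sup>2)"] by simp
    have c: "(\<integral>\<^sup>+c. G s p c \<partial>circ) = of_bool (hit t s) * (\<integral>\<^sup>+c. of_bool (c \<le> t') * V (R ** ?T s p (- c)) \<partial>seg 0 pi)" for p
    proof -
      have "(\<integral>\<^sup>+c. G s p c \<partial>circ) = (\<integral>\<^sup>+c. G s p (- c) \<partial>circ)"
        by (rule nn_integral_circ_reflect[where f = "G s p", symmetric]) (measurable, simp add: Gp)
      also have "\<dots> = of_bool (hit t s) * (\<integral>\<^sup>+c. of_bool (hit t' c) * V (R ** ?T s p (- c)) \<partial>circ)"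
        unfolding G_def minus_minus by (rule nn_integral_cmult) measurable
      also have "(\<integral>\<^sup>+c. of_bool (hit t' c) * V (R ** ?T s p (- c)) \<partial>circ) = (\<integral>\<^sup>+c. of_bool (c \<le> t') * V (R ** ?T s p (- c)) \<partial>seg 0 pi)"
        by (rule nn_integral_hit[OF t(2)]) measurable
      finally show ?thesis .
    qed
    have "(\<integral>\<^sup>+p. 2 * (?k p * (\<integral>\<^sup>+c. G s p c \<partial>circ)) \<partial>circ) = (\<integral>\<^sup>+p. of_bool (hit t s) * (ennreal (\<bar>sin p\<bar> / (8 * pi\<^sup>2)) *
      (\<integral>\<^sup>+c. of_bool (c \<le> t') * V (R ** ?T s p (- c)) \<partial>seg 0 pi)) \<partial>circ)"
      by (intro nn_integral_cong) (simp only: mult.assoc[symmetric] k2, simp only: c, simp only: mult_ac)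
    also have "\<dots> = of_bool (hit t s) * (\<integral>\<^sup>+p. ennreal (\<bar>sin p\<bar> / (8 * pi\<^sup>2)) *
      (\<integral>\<^sup>+c. of_bool (c \<le> t') * V (R ** ?T s p (- c)) \<partial>seg 0 pi) \<partial>circ)"
      by (rule nn_integral_cmult) measurable
    finally show "(\<integral>\<^sup>+p. 2 * (?k p * (\<integral>\<^sup>+c. G s p c \<partial>circ)) \<partial>circ) = \<dots>" .
  qed
  also have "\<dots> = (\<integral>\<^sup>+s. of_bool (s \<le> t) * (\<integral>\<^sup>+p. ennreal (\<bar>sin p\<bar> / (8 * pi\<^sup>2)) *
      (\<integral>\<^sup>+c. of_bool (c \<le> t') * V (R ** ?T s p (- c)) \<partial>seg 0 pi) \<partial>circ) \<partial>seg 0 pi)"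
    by (rule nn_integral_hit[OF t(1)]) measurable
  finally show ?thesis .
qed

text \<open>The \<open>F\<close> of the overview: \<open>R\<close> stands for the point
  \<open>R *v zeta 0\<close> with its direction, and \<open>s\<close> is the distance of this point
  from the start of the arc of length \<open>t\<close>.\<close>

definition through :: "(real^3 \<Rightarrow> real^3 \<Rightarrow> ennreal) \<Rightarrow> real^3^3 \<Rightarrow> ennreal" where
  "through W R = (\<integral>\<^sup>+t. ennreal (sin t) *
    (\<integral>\<^sup>+s. of_bool (s \<le> t) * W (R *v zeta (- s)) (R *v zeta (t - s)) \<partial>seg 0 pi) \<partial>seg 0 pi)"

lemma through_measurable [measurable (raw)]:
  assumes [measurable]: "(\<lambda>(x, y). W x y) \<in> borel_measurable (borel \<Otimes>\<^sub>M borel)" "A \<in> borel_measurable M"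
  shows "(\<lambda>x. through W (A x)) \<in> borel_measurable M"
  unfolding through_def by measurable

text \<open>Both arcs are re-centred at their crossing point: there the frames differ by
  \<open>rotx p\<close> alone, and each arc contributes a factor \<open>through\<close>. The
  constant is \<open>1/2 * 1/(8 pi^2) * 1/2\<close>, from the two length densities and
  \<open>nn_integral_crossing_arc\<close>.\<close>

lemma crossing_formula:
  fixes W :: "real^3 \<Rightarrow> real^3 \<Rightarrow> ennreal"
  assumes W [measurable]: "(\<lambda>(x, y). W x y) \<in> borel_measurable (borel \<Otimes>\<^sub>M borel)"
  shows "(\<integral>\<^sup>+x1. \<integral>\<^sup>+x2. \<integral>\<^sup>+x3. \<integral>\<^sup>+x4. W x1 x2 * (W x3 x4 * cross_ind x1 x2 x3 x4)
      \<partial>sphere_unif \<partial>sphere_unif \<partial>sphere_unif \<partial>sphere_unif)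
    = ennreal (1 / (32 * pi\<^sup>2)) * (\<integral>\<^sup>+R. \<integral>\<^sup>+p. ennreal \<bar>sin p\<bar> * (through W R * through W (R ** rotx p)) \<partial>circ \<partial>haar)"
proof -
  let ?P = "seg 0 pi"
  let ?h = "\<lambda>t. ennreal (sin t / 2)"
  let ?k = "\<lambda>p. ennreal (\<bar>sin p\<bar> / (8 * pi\<^sup>2))"
  define J where "J x1 x2 = (\<integral>\<^sup>+x3. \<integral>\<^sup>+x4. W x3 x4 * cross_ind x1 x2 x3 x4 \<partial>sphere_unif \<partial>sphere_unif)" for x1 x2
  have J_m [measurable]: "(\<lambda>(x, y). J x y) \<in> borel_measurable (borel \<Otimes>\<^sub>M borel)"
    unfolding J_def by measurable
  \<comment> \<open>Everything that concerns the second arc once the crossing point and the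
    direction of the first arc are given.\<close>
  define B where "B R = (\<integral>\<^sup>+p. ?k p * (ennreal (1 / 2) * through W (R ** rotx p)) \<partial>circ)" for R
  have B_m [measurable]: "B \<in> borel_measurable borel"
    unfolding B_def by measurable
  have J: "J (R *v zeta 0) (R *v zeta t) = (\<integral>\<^sup>+s. of_bool (s \<le> t) * B (R ** rotz s) \<partial>?P)"
    if R: "rotation_matrix R" and t: "t \<in> {0<..<pi}" for R t
  proof -
    let ?Q = "\<lambda>R t' p. \<integral>\<^sup>+c. of_bool (c \<le> t') * W (R *v (rotx p *v zeta (- c))) (R *v (rotx p *v zeta (t' - c))) \<partial>?P"
    have "J (R *v zeta 0) (R *v zeta t) = (\<integral>\<^sup>+t'. ?h t' * (\<integral>\<^sup>+S. W (S *v zeta 0) (S *v zeta t') *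
        cross_ind (R *v zeta 0) (R *v zeta t) (S *v zeta 0) (S *v zeta t') \<partial>haar) \<partial>?P)"
      unfolding J_def by (rule nn_integral_sphere_pair) measurable
    also have "\<dots> = (\<integral>\<^sup>+t'. ?h t' * (\<integral>\<^sup>+s. of_bool (s \<le> t) * (\<integral>\<^sup>+p. ?k p * ?Q (R ** rotz s) t' p \<partial>circ) \<partial>?P) \<partial>?P)"
    proof (rule nn_integral_cong_AE)
      show "AE t' in ?P. ?h t' * (\<integral>\<^sup>+S. W (S *v zeta 0) (S *v zeta t') *
          cross_ind (R *v zeta 0) (R *v zeta t) (S *v zeta 0) (S *v zeta t') \<partial>haar)
        = ?h t' * (\<integral>\<^sup>+s. of_bool (s \<le> t) * (\<integral>\<^sup>+p. ?k p * ?Q (R ** rotz s) t' p \<partial>circ) \<partial>?P)"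
        using AE_seg_open[of 0 pi]
      proof eventually_elim
        case (elim t')
        have "(\<integral>\<^sup>+S. W (S *v zeta 0) (S *v zeta t') * cross_ind (R *v zeta 0) (R *v zeta t) (S *v zeta 0) (S *v zeta t') \<partial>haar)
          = (\<integral>\<^sup>+s. of_bool (s \<le> t) * (\<integral>\<^sup>+p. ?k p * (\<integral>\<^sup>+c. of_bool (c \<le> t') *
            W ((R ** (rotz s ** rotx p ** rotz (- c))) *v zeta 0) ((R ** (rotz s ** rotx p ** rotz (- c))) *v zeta t') \<partial>?P) \<partial>circ) \<partial>?P)"
          by (rule nn_integral_crossing_arc[where V = "\<lambda>S. W (S *v zeta 0) (S *v zeta t')", OF R t elim]) measurable
        also have "\<dots> = (\<integral>\<^sup>+s. of_bool (s \<le> t) * (\<integral>\<^sup>+p. ?k p * ?Q (R ** rotz s) t' p \<partial>circ) \<partial>?P)"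
          by (simp add: matrix_vector_mul_assoc[symmetric] rotz_zeta)
        finally show ?case by simp
      qed
    qed
    also have "\<dots> = (\<integral>\<^sup>+t'. \<integral>\<^sup>+s. ?h t' * (of_bool (s \<le> t) * (\<integral>\<^sup>+p. ?k p * ?Q (R ** rotz s) t' p \<partial>circ)) \<partial>?P \<partial>?P)"
      by (intro nn_integral_cong nn_integral_cmult[symmetric]) measurable
    also have "\<dots> = (\<integral>\<^sup>+s. \<integral>\<^sup>+t'. ?h t' * (of_bool (s \<le> t) * (\<integral>\<^sup>+p. ?k p * ?Q (R ** rotz s) t' p \<partial>circ)) \<partial>?P \<partial>?P)"
      by (rule seg_seg.Fubini') measurable
    also have "\<dots> = (\<integral>\<^sup>+s. of_bool (s \<le> t) * B (R ** rotz s) \<partial>?P)"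
    proof (rule nn_integral_cong)
      fix s
      let ?R = "R ** rotz s"
      have "(\<integral>\<^sup>+t'. ?h t' * (of_bool (s \<le> t) * (\<integral>\<^sup>+p. ?k p * ?Q ?R t' p \<partial>circ)) \<partial>?P)
          = (\<integral>\<^sup>+t'. of_bool (s \<le> t) * (\<integral>\<^sup>+p. ?k p * (?h t' * ?Q ?R t' p) \<partial>circ) \<partial>?P)"
      proof (rule nn_integral_cong)
        fix t'
        have "(\<integral>\<^sup>+p. ?k p * (?h t' * ?Q ?R t' p) \<partial>circ) = (\<integral>\<^sup>+p. ?h t' * (?k p * ?Q ?R t' p) \<partial>circ)"
          by (simp only: mult_ac)
        also have "\<dots> = ?h t' * (\<integral>\<^sup>+p. ?k p * ?Q ?R t' p \<partial>circ)"
          by (rule nn_integral_cmult) measurable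
        finally show "?h t' * (of_bool (s \<le> t) * (\<integral>\<^sup>+p. ?k p * ?Q ?R t' p \<partial>circ))
          = of_bool (s \<le> t) * (\<integral>\<^sup>+p. ?k p * (?h t' * ?Q ?R t' p) \<partial>circ)"
          by (simp only: mult.left_commute)
      qed
      also have "\<dots> = of_bool (s \<le> t) * (\<integral>\<^sup>+t'. \<integral>\<^sup>+p. ?k p * (?h t' * ?Q ?R t' p) \<partial>circ \<partial>?P)"
        by (rule nn_integral_cmult) measurable
      also have "(\<integral>\<^sup>+t'. \<integral>\<^sup>+p. ?k p * (?h t' * ?Q ?R t' p) \<partial>circ \<partial>?P) = (\<integral>\<^sup>+p. \<integral>\<^sup>+t'. ?k p * (?h t' * ?Q ?R t' p) \<partial>?P \<partial>circ)"
        by (rule seg_seg.Fubini') measurable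
      also have "\<dots> = B ?R"
        unfolding B_def
      proof (rule nn_integral_cong)
        fix p
        have h: "?h t' = ennreal (1 / 2) * ennreal (sin t')" for t'
          using ennreal_mult'[of "1 / 2" "sin t'"] by simp
        have "(\<integral>\<^sup>+t'. ?k p * (?h t' * ?Q ?R t' p) \<partial>?P) = ?k p * (\<integral>\<^sup>+t'. ennreal (1 / 2) * (ennreal (sin t') * ?Q ?R t' p) \<partial>?P)"
          unfolding h mult.assoc by (rule nn_integral_cmult) measurable
        also have "(\<integral>\<^sup>+t'. ennreal (1 / 2) * (ennreal (sin t') * ?Q ?R t' p) \<partial>?P)
            = ennreal (1 / 2) * (\<integral>\<^sup>+t'. ennreal (sin t') * ?Q ?R t' p \<partial>?P)"
          by (rule nn_integral_cmult) measurable
        also have "(\<integral>\<^sup>+t'. ennreal (sin t') * ?Q ?R t' p \<partial>?P) = through W (?R ** rotx p)"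
          by (simp add: through_def matrix_vector_mul_assoc[symmetric])
        finally show "(\<integral>\<^sup>+t'. ?k p * (?h t' * ?Q ?R t' p) \<partial>?P) = ?k p * (ennreal (1 / 2) * through W (?R ** rotx p))" .
      qed
      finally show "(\<integral>\<^sup>+t'. ?h t' * (of_bool (s \<le> t) * (\<integral>\<^sup>+p. ?k p * ?Q ?R t' p \<partial>circ)) \<partial>?P)
        = of_bool (s \<le> t) * B ?R" .
    qed
    finally show ?thesis .
  qed
  have inner: "(\<integral>\<^sup>+R. W (R *v zeta 0) (R *v zeta t) * J (R *v zeta 0) (R *v zeta t) \<partial>haar)
      = (\<integral>\<^sup>+R. (\<integral>\<^sup>+s. of_bool (s \<le> t) * W (R *v zeta (- s)) (R *v zeta (t - s)) \<partial>?P) * B R \<partial>haar)"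
    if t: "t \<in> {0<..<pi}" for t
  proof -
    have "(\<integral>\<^sup>+R. W (R *v zeta 0) (R *v zeta t) * J (R *v zeta 0) (R *v zeta t) \<partial>haar)
        = (\<integral>\<^sup>+R. \<integral>\<^sup>+s. W (R *v zeta 0) (R *v zeta t) * (of_bool (s \<le> t) * B (R ** rotz s)) \<partial>?P \<partial>haar)"
    proof (rule nn_integral_haar_cong)
      fix R :: "real^3^3" assume R: "rotation_matrix R"
      show "W (R *v zeta 0) (R *v zeta t) * J (R *v zeta 0) (R *v zeta t)
        = (\<integral>\<^sup>+s. W (R *v zeta 0) (R *v zeta t) * (of_bool (s \<le> t) * B (R ** rotz s)) \<partial>?P)"
        unfolding J[OF R t] by (rule nn_integral_cmult[symmetric]) measurable
    qed measurable
    also have "\<dots> = (\<integral>\<^sup>+s. \<integral>\<^sup>+R. W (R *v zeta 0) (R *v zeta t) * (of_bool (s \<le> t) * B (R ** rotz s)) \<partial>haar \<partial>?P)"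
      by (rule seg_haar.Fubini') measurable
    also have "\<dots> = (\<integral>\<^sup>+s. \<integral>\<^sup>+R. W (R *v zeta (- s)) (R *v zeta (t - s)) * (of_bool (s \<le> t) * B R) \<partial>haar \<partial>?P)"
    proof (rule nn_integral_cong)
      fix s
      \<comment> \<open>Right translation by \<open>rotz (- s)\<close> moves the base of the frame
        from the start of the first arc to the crossing point. Afterwards \<open>B R\<close> depends
        on neither \<open>s\<close> nor \<open>t\<close>, and the integral over \<open>s\<close> is
        the inner one of \<open>through\<close>.\<close>
      have "(\<integral>\<^sup>+R. W (R *v zeta 0) (R *v zeta t) * (of_bool (s \<le> t) * B (R ** rotz s)) \<partial>haar)
          = (\<integral>\<^sup>+R. W ((R ** rotz (- s)) *v zeta 0) ((R ** rotz (- s)) *v zeta t) * (of_bool (s \<le> t) * B (R ** rotz (- s) ** rotz s)) \<partial>haar)"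
        by (rule nn_integral_haar_right[OF rotation_matrix_rotz,
          where f = "\<lambda>R. W (R *v zeta 0) (R *v zeta t) * (of_bool (s \<le> t) * B (R ** rotz s))", symmetric]) measurable
      also have "\<dots> = (\<integral>\<^sup>+R. W (R *v zeta (- s)) (R *v zeta (t - s)) * (of_bool (s \<le> t) * B R) \<partial>haar)"
        by (simp add: matrix_mul_assoc[symmetric] rotz_add rotz_0 matrix_vector_mul_assoc[symmetric] rotz_zeta)
      finally show "(\<integral>\<^sup>+R. W (R *v zeta 0) (R *v zeta t) * (of_bool (s \<le> t) * B (R ** rotz s)) \<partial>haar) = \<dots>" .
    qed
    also have "\<dots> = (\<integral>\<^sup>+R. \<integral>\<^sup>+s. W (R *v zeta (- s)) (R *v zeta (t - s)) * (of_bool (s \<le> t) * B R) \<partial>?P \<partial>haar)"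
      by (rule haar_seg.Fubini') measurable
    also have "\<dots> = (\<integral>\<^sup>+R. \<integral>\<^sup>+s. (of_bool (s \<le> t) * W (R *v zeta (- s)) (R *v zeta (t - s))) * B R \<partial>?P \<partial>haar)"
      by (simp only: mult_ac)
    also have "\<dots> = (\<integral>\<^sup>+R. (\<integral>\<^sup>+s. of_bool (s \<le> t) * W (R *v zeta (- s)) (R *v zeta (t - s)) \<partial>?P) * B R \<partial>haar)"
      by (intro nn_integral_cong nn_integral_multc) measurable
    finally show ?thesis .
  qed
  have "(\<integral>\<^sup>+x1. \<integral>\<^sup>+x2. \<integral>\<^sup>+x3. \<integral>\<^sup>+x4. W x1 x2 * (W x3 x4 * cross_ind x1 x2 x3 x4)
      \<partial>sphere_unif \<partial>sphere_unif \<partial>sphere_unif \<partial>sphere_unif)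
    = (\<integral>\<^sup>+x1. \<integral>\<^sup>+x2. W x1 x2 * J x1 x2 \<partial>sphere_unif \<partial>sphere_unif)"
  proof (intro nn_integral_cong)
    fix x1 x2
    have "(\<integral>\<^sup>+x3. \<integral>\<^sup>+x4. W x1 x2 * (W x3 x4 * cross_ind x1 x2 x3 x4) \<partial>sphere_unif \<partial>sphere_unif)
        = (\<integral>\<^sup>+x3. W x1 x2 * (\<integral>\<^sup>+x4. W x3 x4 * cross_ind x1 x2 x3 x4 \<partial>sphere_unif) \<partial>sphere_unif)"
      by (intro nn_integral_cong nn_integral_cmult borel_measurable_sphere_unif) measurable
    also have "\<dots> = W x1 x2 * J x1 x2"
      unfolding J_def by (intro nn_integral_cmult borel_measurable_sphere_unif) measurable
    finally show "(\<integral>\<^sup>+x3. \<integral>\<^sup>+x4. W x1 x2 * (W x3 x4 * cross_ind x1 x2 x3 x4) \<partial>sphere_unif \<partial>sphere_unif) = W x1 x2 * J x1 x2" .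
  qed
  also have "\<dots> = (\<integral>\<^sup>+t. ?h t * (\<integral>\<^sup>+R. W (R *v zeta 0) (R *v zeta t) * J (R *v zeta 0) (R *v zeta t) \<partial>haar) \<partial>?P)"
    by (rule nn_integral_sphere_pair) measurable
  also have "\<dots> = (\<integral>\<^sup>+t. ?h t * (\<integral>\<^sup>+R. (\<integral>\<^sup>+s. of_bool (s \<le> t) * W (R *v zeta (- s)) (R *v zeta (t - s)) \<partial>?P) * B R \<partial>haar) \<partial>?P)"
  proof (rule nn_integral_cong_AE)
    show "AE t in ?P. ?h t * (\<integral>\<^sup>+R. W (R *v zeta 0) (R *v zeta t) * J (R *v zeta 0) (R *v zeta t) \<partial>haar)
      = ?h t * (\<integral>\<^sup>+R. (\<integral>\<^sup>+s. of_bool (s \<le> t) * W (R *v zeta (- s)) (R *v zeta (t - s)) \<partial>?P) * B R \<partial>haar)"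
      using AE_seg_open[of 0 pi] by eventually_elim (simp only: inner)
  qed
  also have "\<dots> = (\<integral>\<^sup>+t. \<integral>\<^sup>+R. ?h t * ((\<integral>\<^sup>+s. of_bool (s \<le> t) * W (R *v zeta (- s)) (R *v zeta (t - s)) \<partial>?P) * B R) \<partial>haar \<partial>?P)"
    by (intro nn_integral_cong nn_integral_cmult[symmetric]) measurable
  also have "\<dots> = (\<integral>\<^sup>+R. \<integral>\<^sup>+t. ?h t * ((\<integral>\<^sup>+s. of_bool (s \<le> t) * W (R *v zeta (- s)) (R *v zeta (t - s)) \<partial>?P) * B R) \<partial>?P \<partial>haar)"
    by (rule haar_seg.Fubini') measurable
  also have "\<dots> = (\<integral>\<^sup>+R. ennreal (1 / 2) * through W R * B R \<partial>haar)"
  proof (rule nn_integral_cong)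
    fix R :: "real^3^3"
    let ?Z = "\<lambda>t. \<integral>\<^sup>+s. of_bool (s \<le> t) * W (R *v zeta (- s)) (R *v zeta (t - s)) \<partial>?P"
    have h: "?h t * (?Z t * B R) = ennreal (1 / 2) * (ennreal (sin t) * ?Z t) * B R" for t
      using ennreal_mult'[of "1 / 2" "sin t"] by (simp add: mult.assoc)
    have "(\<integral>\<^sup>+t. ?h t * (?Z t * B R) \<partial>?P) = (\<integral>\<^sup>+t. ennreal (1 / 2) * (ennreal (sin t) * ?Z t) \<partial>?P) * B R"
      unfolding h by (rule nn_integral_multc) measurable
    also have "(\<integral>\<^sup>+t. ennreal (1 / 2) * (ennreal (sin t) * ?Z t) \<partial>?P) = ennreal (1 / 2) * through W R"
      unfolding through_def by (rule nn_integral_cmult) measurable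
    finally show "(\<integral>\<^sup>+t. ?h t * (?Z t * B R) \<partial>?P) = ennreal (1 / 2) * through W R * B R" .
  qed
  also have "\<dots> = (\<integral>\<^sup>+R. ennreal (1 / (32 * pi\<^sup>2)) * (\<integral>\<^sup>+p. ennreal \<bar>sin p\<bar> * (through W R * through W (R ** rotx p)) \<partial>circ) \<partial>haar)"
  proof (rule nn_integral_cong)
    fix R :: "real^3^3"
    have c: "ennreal (1 / 2) * (?k p * ennreal (1 / 2)) = ennreal (1 / (32 * pi\<^sup>2)) * ennreal \<bar>sin p\<bar>" for p
    proof -
      have h: "0 \<le> (1 / 2 :: real)"
        by simp
      show ?thesis
        unfolding ennreal_mult''[OF h, symmetric] ennreal_mult'[OF h, symmetric]
          ennreal_mult''[OF abs_ge_zero, symmetric] by simp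
    qed
    have "ennreal (1 / 2) * through W R * B R = (\<integral>\<^sup>+p. ennreal (1 / 2) * through W R * (?k p * (ennreal (1 / 2) * through W (R ** rotx p))) \<partial>circ)"
      unfolding B_def by (rule nn_integral_cmult[symmetric]) measurable
    also have "\<dots> = (\<integral>\<^sup>+p. (ennreal (1 / 2) * (?k p * ennreal (1 / 2))) * (through W R * through W (R ** rotx p)) \<partial>circ)"
      by (simp only: mult_ac)
    also have "\<dots> = (\<integral>\<^sup>+p. ennreal (1 / (32 * pi\<^sup>2)) * (ennreal \<bar>sin p\<bar> * (through W R * through W (R ** rotx p))) \<partial>circ)"
      unfolding c mult.assoc ..
    also have "\<dots> = ennreal (1 / (32 * pi\<^sup>2)) * (\<integral>\<^sup>+p. ennreal \<bar>sin p\<bar> * (through W R * through W (R ** rotx p)) \<partial>circ)"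
      by (rule nn_integral_cmult) measurable
    finally show "ennreal (1 / 2) * through W R * B R = \<dots>" .
  qed
  also have "\<dots> = ennreal (1 / (32 * pi\<^sup>2)) * (\<integral>\<^sup>+R. \<integral>\<^sup>+p. ennreal \<bar>sin p\<bar> * (through W R * through W (R ** rotx p)) \<partial>circ \<partial>haar)"
    by (rule nn_integral_cmult) measurable
  finally show ?thesis .
qed

section \<open>Averaging over the pencil of arcs through a point\<close>

lemma nn_integral_seg_le:
  assumes [measurable]: "f \<in> borel_measurable borel" and t: "0 \<le> t" "t \<le> b"
  shows "(\<integral>\<^sup>+s. of_bool (s \<le> t) * f s \<partial>seg 0 b) = (\<integral>\<^sup>+s. f s \<partial>seg 0 t)"
  by (simp add: nn_integral_seg)
    (intro nn_integral_cong, use t in \<open>auto simp: indicator_def\<close>)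

lemma nn_integral_seg_flip:
  assumes f [measurable]: "f \<in> borel_measurable borel" and t: "0 \<le> t" "t \<le> b"
  shows "(\<integral>\<^sup>+s. of_bool (s \<le> t) * f (t - s) \<partial>seg 0 b) = (\<integral>\<^sup>+s. of_bool (s \<le> t) * f s \<partial>seg 0 b)"
proof -
  have "(\<integral>\<^sup>+s. of_bool (s \<le> t) * f (t - s) \<partial>seg 0 b) = (\<integral>\<^sup>+s. f (t - s) \<partial>seg 0 t)"
    by (rule nn_integral_seg_le[where f = "\<lambda>s. f (t - s)", OF _ t]) measurable
  also have "\<dots> = (\<integral>\<^sup>+s. f (- s + t) \<partial>seg 0 t)"
    by (simp add: add.commute)
  also have "\<dots> = (\<integral>\<^sup>+s. f (s + t) \<partial>seg (- t) 0)"
    using nn_integral_seg_reflect[where f = "\<lambda>s. f (s + t)" and a = 0 and b = t] by simp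
  also have "\<dots> = (\<integral>\<^sup>+s. f s \<partial>seg 0 t)"
    using nn_integral_seg_translate[OF f, where a = "- t" and b = 0 and t = t] by simp
  also have "\<dots> = (\<integral>\<^sup>+s. of_bool (s \<le> t) * f s \<partial>seg 0 b)"
    by (rule nn_integral_seg_le[OF f t, symmetric])
  finally show ?thesis .
qed

lemma nn_integral_of_bool_le: "0 \<le> t \<Longrightarrow> t \<le> b \<Longrightarrow> (\<integral>\<^sup>+s. of_bool (s \<le> t) \<partial>seg 0 b) = ennreal t"
  using nn_integral_seg_le[of "\<lambda>_. 1" t b] by (simp add: emeasure_seg)

lemma nn_integral_seg_eq_integral:
  fixes f :: "real \<Rightarrow> real"
  assumes [measurable]: "f \<in> borel_measurable borel" and f: "\<And>x. x \<in> {a..b} \<Longrightarrow> 0 \<le> f x" "\<And>x. x \<in> {a..b} \<Longrightarrow> f x \<le> M"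
  shows "(\<integral>\<^sup>+x. ennreal (f x) \<partial>seg a b) = ennreal (\<integral>x. f x \<partial>seg a b)"
proof (rule nn_integral_eq_integral)
  show "integrable (seg a b) f"
  proof (rule integrable_seg[where M = M])
    show "\<bar>f x\<bar> \<le> M" if "x \<in> {a..b}" for x
      using f[OF that] by simp
  qed measurable
  show "AE x in seg a b. 0 \<le> f x"
    using AE_seg[of a b] by (rule eventually_mono) (rule f)
qed

context
  fixes W :: "real^3 \<Rightarrow> real^3 \<Rightarrow> real"
  assumes W_meas [measurable]: "(\<lambda>(x, y). W x y) \<in> borel_measurable (borel \<Otimes>\<^sub>M borel)"
    and W_ge: "\<And>x y. 0 \<le> W x y" and W_le: "\<And>x y. W x y \<le> 1" and W_sym: "\<And>x y. W x y = W y x"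
begin

private abbreviation "F \<equiv> through (\<lambda>x y. ennreal (W x y))"

definition slab :: "real^3^3 \<Rightarrow> real \<Rightarrow> ennreal" where
  "slab R t = (\<integral>\<^sup>+s. of_bool (s \<le> t) * ennreal (W (R *v zeta (- s)) (R *v zeta (t - s))) \<partial>seg 0 pi)"

text \<open>The mean of \<open>W\<close> over the arcs of length \<open>t\<close> through the given
  point and direction; the division by \<open>t\<close> is the \<open>1/\<theta>\<close> of the
  overview. The default 0 keeps the values in \<open>[0, 1]\<close> for all \<open>t\<close>, as
  \<open>bathtub_tangent\<close> demands.\<close>

definition arc_density :: "real^3^3 \<Rightarrow> real \<Rightarrow> real" where
  "arc_density R t = (if 0 < t \<and> t \<le> pi then enn2real (slab R t) / t else 0)"

lemma slab_measurable [measurable (raw)]: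
  assumes [measurable]: "A \<in> borel_measurable M" "f \<in> borel_measurable M"
  shows "(\<lambda>x. slab (A x) (f x)) \<in> borel_measurable M"
  unfolding slab_def by measurable

lemma arc_density_measurable [measurable (raw)]:
  assumes [measurable]: "A \<in> borel_measurable M" "f \<in> borel_measurable M"
  shows "(\<lambda>x. arc_density (A x) (f x)) \<in> borel_measurable M"
  unfolding arc_density_def by measurable

lemma slab_le: "0 \<le> t \<Longrightarrow> t \<le> pi \<Longrightarrow> slab R t \<le> ennreal t"
proof -
  assume t: "0 \<le> t" "t \<le> pi"
  have "slab R t \<le> (\<integral>\<^sup>+s. of_bool (s \<le> t) \<partial>seg 0 pi)"
    unfolding slab_def
    by (intro nn_integral_mono) (use W_le in \<open>auto simp: of_bool_def\<close>)
  then show ?thesis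
    using t by (simp add: nn_integral_of_bool_le)
qed

lemma slab_eq: "0 < t \<Longrightarrow> t \<le> pi \<Longrightarrow> slab R t = ennreal (t * arc_density R t)"
proof -
  assume t: "0 < t" "t \<le> pi"
  then have "slab R t < top"
    using slab_le[of t R] by (auto intro: le_less_trans)
  then show ?thesis
    using t by (simp add: arc_density_def)
qed

lemma arc_density_nonneg: "0 \<le> arc_density R t"
  by (simp add: arc_density_def)

lemma arc_density_le: "arc_density R t \<le> 1"
proof (cases "0 < t \<and> t \<le> pi")
  case True
  then have "enn2real (slab R t) \<le> t"
    using slab_le[of t R] by (intro enn2real_leI) auto
  then show ?thesis
    using True by (simp add: arc_density_def)
qed (auto simp: arc_density_def)

definition through_real :: "real^3^3 \<Rightarrow> real" where
  "through_real R = (\<integral>t. t * sin t * arc_density R t \<partial>seg 0 pi)"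

text \<open>The \<open>m\<close> of the overview. Its companion \<open>through_real\<close> is
  \<open>F\<close> as a real number, where the factor \<open>t\<close> is restored.\<close>

definition through_weight :: "real^3^3 \<Rightarrow> real" where
  "through_weight R = (\<integral>t. sin t * arc_density R t \<partial>seg 0 pi)"

lemma through_real_measurable [measurable (raw)]:
  assumes [measurable]: "A \<in> borel_measurable M"
  shows "(\<lambda>x. through_real (A x)) \<in> borel_measurable M"
  unfolding through_real_def by measurable

lemma through_weight_measurable [measurable (raw)]:
  assumes [measurable]: "A \<in> borel_measurable M"
  shows "(\<lambda>x. through_weight (A x)) \<in> borel_measurable M"
  unfolding through_weight_def by measurable

lemma sin_arc_density: "t \<in> {0..pi} \<Longrightarrow> 0 \<le> sin t * arc_density R t" "t \<in> {0..pi} \<Longrightarrow> sin t * arc_density R t \<le> 1"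
proof -
  assume t: "t \<in> {0..pi}"
  then show "0 \<le> sin t * arc_density R t"
    by (auto intro!: mult_nonneg_nonneg sin_ge_zero arc_density_nonneg)
  show "sin t * arc_density R t \<le> 1"
    using mult_mono[of "sin t" 1 "arc_density R t" 1] arc_density_le[of R t] arc_density_nonneg[of R t] by simp
qed

lemma nn_integral_sin_arc_density: "(\<integral>\<^sup>+t. ennreal (sin t * arc_density R t) \<partial>seg 0 pi) = ennreal (through_weight R)"
  unfolding through_weight_def by (rule nn_integral_seg_eq_integral) (measurable, auto intro: sin_arc_density)

lemma through_eq: "F R = ennreal (through_real R)"
proof -
  have "F R = (\<integral>\<^sup>+t. ennreal (sin t) * slab R t \<partial>seg 0 pi)"
    by (simp add: through_def slab_def)
  also have "\<dots> = (\<integral>\<^sup>+t. ennreal (t * sin t * arc_density R t) \<partial>seg 0 pi)"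
  proof (rule nn_integral_cong_AE)
    show "AE t in seg 0 pi. ennreal (sin t) * slab R t = ennreal (t * sin t * arc_density R t)"
      using AE_seg_open[of 0 pi]
    proof eventually_elim
      case (elim t)
      then have "0 \<le> sin t" "slab R t = ennreal (t * arc_density R t)"
        by (auto intro: sin_ge_zero slab_eq)
      then show ?case
        using elim arc_density_nonneg[of R t] by (simp add: ennreal_mult[symmetric] mult_ac)
    qed
  qed
  also have "\<dots> = ennreal (through_real R)"
    unfolding through_real_def
  proof (rule nn_integral_seg_eq_integral)
    fix t :: real assume t: "t \<in> {0..pi}"
    show "0 \<le> t * sin t * arc_density R t" "t * sin t * arc_density R t \<le> pi"
      using t sin_arc_density[OF t, of R] mult_mono[of t pi "sin t * arc_density R t" 1] by (auto simp: mult.assoc)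
  qed measurable
  finally show ?thesis .
qed

lemma through_real_nonneg: "0 \<le> through_real R"
  unfolding through_real_def
proof (rule integral_nonneg_AE)
  show "AE t in seg 0 pi. 0 \<le> t * sin t * arc_density R t"
    using AE_seg[of 0 pi] by (rule eventually_mono) (use sin_arc_density in \<open>auto simp: mult.assoc\<close>)
qed

lemma through_real_le: "through_real R \<le> pi * pi"
proof -
  have "through_real R \<le> (\<integral>t. pi \<partial>seg 0 pi)"
    unfolding through_real_def
  proof (rule integral_mono_AE)
    show "AE t in seg 0 pi. t * sin t * arc_density R t \<le> pi"
      using AE_seg[of 0 pi]
    proof eventually_elim
      case (elim t)
      then show ?case
        using sin_arc_density[OF elim, of R] mult_mono[of t pi "sin t * arc_density R t" 1] by (auto simp: mult.assoc)
    qed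
    show "integrable (seg 0 pi) (\<lambda>t. t * sin t * arc_density R t)"
    proof (rule integrable_seg)
      show "\<bar>t * sin t * arc_density R t\<bar> \<le> pi" if "t \<in> {0..pi}" for t
      proof -
        have "0 \<le> t * (sin t * arc_density R t)" "t * (sin t * arc_density R t) \<le> pi * 1"
          using that sin_arc_density[OF that, of R] mult_mono[of t pi "sin t * arc_density R t" 1] by auto
        then show ?thesis
          by (simp only: mult.assoc abs_of_nonneg mult_1_right)
      qed
    qed measurable
  qed (simp add: finite_measure.integrable_const)
  then show ?thesis
    by (simp only: integral_seg_const[OF pi_ge_zero] diff_zero)
qed

lemma through_weight_bounds: "0 \<le> through_weight R" "through_weight R \<le> pi"
proof -
  have i: "integrable (seg 0 pi) (\<lambda>t. sin t * arc_density R t)"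
  proof (rule integrable_seg[where M = 1])
    show "\<bar>sin t * arc_density R t\<bar> \<le> 1" if "t \<in> {0..pi}" for t
      using sin_arc_density[OF that, of R] by simp
  qed measurable
  show "0 \<le> through_weight R"
    unfolding through_weight_def
    by (rule integral_nonneg_AE, rule eventually_mono[OF AE_seg[of 0 pi]]) (rule sin_arc_density)
  have "through_weight R \<le> (\<integral>t. 1 \<partial>seg 0 pi)"
    unfolding through_weight_def
    by (rule integral_mono_AE[OF i], simp add: finite_measure.integrable_const,
      rule eventually_mono[OF AE_seg[of 0 pi]]) (rule sin_arc_density)
  then show "through_weight R \<le> pi"
    by (simp only: integral_seg_const[OF pi_ge_zero]) simp
qed

text \<open>A half turn about the point reverses each arc: the ends are exchanged and
  \<open>s\<close> becomes \<open>t - s\<close>, which \<open>W_sym\<close> absorbs. Thus directions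
  have period \<open>pi\<close>, and half circles suffice.\<close>

lemma through_rotx_pi: "F (R ** rotx pi) = F R"
proof -
  have "slab (R ** rotx pi) t = slab R t" if t: "t \<in> {0..pi}" for t
  proof -
    let ?g = "\<lambda>s. ennreal (W (R *v zeta (- s)) (R *v zeta (t - s)))"
    have "slab (R ** rotx pi) t = (\<integral>\<^sup>+s. of_bool (s \<le> t) * ?g (t - s) \<partial>seg 0 pi)"
      by (simp add: slab_def matrix_vector_mul_assoc[symmetric] rotx_pi_zeta W_sym)
    also have "\<dots> = slab R t"
      unfolding slab_def by (rule nn_integral_seg_flip[where f = ?g]) (measurable, use t in auto)
    finally show ?thesis .
  qed
  then show ?thesis
    unfolding through_def slab_def[symmetric]
    by (intro nn_integral_cong_AE eventually_mono[OF AE_seg[of 0 pi]]) simp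
qed

definition pencil_energy :: "real^3^3 \<Rightarrow> real" where
  "pencil_energy R = (\<integral>u. \<integral>v. through_real (R ** rotx u) * through_real (R ** rotx v) * \<bar>sin (u - v)\<bar> \<partial>seg 0 pi \<partial>seg 0 pi)"

lemma pencil_energy_measurable [measurable]: "pencil_energy \<in> borel_measurable borel"
  unfolding pencil_energy_def[abs_def] by measurable

lemma nn_integral_pencil_energy:
  "(\<integral>\<^sup>+u. \<integral>\<^sup>+v. ennreal \<bar>sin (v - u)\<bar> * (F (R ** rotx u) * F (R ** rotx v)) \<partial>seg 0 pi \<partial>seg 0 pi) = ennreal (pencil_energy R)"
proof -
  let ?g = "\<lambda>u v. through_real (R ** rotx u) * through_real (R ** rotx v) * \<bar>sin (u - v)\<bar>"
  have g0: "0 \<le> ?g u v" for u v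
    by (intro mult_nonneg_nonneg through_real_nonneg) auto
  have g1: "?g u v \<le> (pi * pi) * (pi * pi) * 1" for u v
    by (intro mult_mono through_real_le through_real_nonneg mult_nonneg_nonneg) auto
  have e: "ennreal \<bar>sin (v - u)\<bar> * (F (R ** rotx u) * F (R ** rotx v)) = ennreal (?g u v)" for u v
  proof -
    have "\<bar>sin (v - u)\<bar> = \<bar>sin (u - v)\<bar>"
      using sin_minus[of "u - v"] by simp
    then show ?thesis
      by (simp add: through_eq ennreal_mult through_real_nonneg mult_ac)
  qed
  have inner: "(\<integral>\<^sup>+v. ennreal (?g u v) \<partial>seg 0 pi) = ennreal (\<integral>v. ?g u v \<partial>seg 0 pi)" for u
    by (rule nn_integral_seg_eq_integral[OF _ g0 g1]) measurable
  have h1: "(\<integral>v. ?g u v \<partial>seg 0 pi) \<le> pi * ((pi * pi) * (pi * pi) * 1)" for u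
  proof -
    have "(\<integral>v. ?g u v \<partial>seg 0 pi) \<le> (\<integral>v. (pi * pi) * (pi * pi) * 1 \<partial>seg 0 pi)"
    proof (rule Bochner_Integration.integral_mono[OF _ _ g1])
      show "integrable (seg 0 pi) (?g u)"
        by (rule integrable_seg[where M = "(pi * pi) * (pi * pi) * 1"]) (measurable, simp only: abs_of_nonneg[OF g0] g1)
    qed (simp add: finite_measure.integrable_const)
    then show ?thesis
      by (simp only: integral_seg_const[OF pi_ge_zero] diff_zero)
  qed
  have "(\<integral>\<^sup>+u. \<integral>\<^sup>+v. ennreal (?g u v) \<partial>seg 0 pi \<partial>seg 0 pi) = (\<integral>\<^sup>+u. ennreal (\<integral>v. ?g u v \<partial>seg 0 pi) \<partial>seg 0 pi)"
    by (simp only: inner)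
  also have "\<dots> = ennreal (\<integral>u. \<integral>v. ?g u v \<partial>seg 0 pi \<partial>seg 0 pi)"
    by (rule nn_integral_seg_eq_integral[OF _ _ h1]) (measurable, intro Bochner_Integration.integral_nonneg g0)
  finally show ?thesis
    by (simp only: e pencil_energy_def)
qed

text \<open>Averaging over the rotations about the common point of the two arcs.\<close>

lemma nn_integral_through_circle:
  "ennreal (2 * pi) * (\<integral>\<^sup>+R. \<integral>\<^sup>+p. ennreal \<bar>sin p\<bar> * (F R * F (R ** rotx p)) \<partial>circ \<partial>haar)
    = 4 * (\<integral>\<^sup>+R. ennreal (pencil_energy R) \<partial>haar)"
proof -
  let ?Z = "\<integral>\<^sup>+R. \<integral>\<^sup>+p. ennreal \<bar>sin p\<bar> * (F R * F (R ** rotx p)) \<partial>circ \<partial>haar"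
  have per: "F (R ** rotx (u + pi)) = F (R ** rotx u)" for R u
    using through_rotx_pi[of "R ** rotx u"] by (simp add: matrix_mul_assoc[symmetric] rotx_add)
  have per2: "F (R ** rotx (u + 2 * pi)) = F (R ** rotx u)" for R u
    by (simp only: rotx_periodic)
  have sper: "\<bar>sin (x + pi - y)\<bar> = \<bar>sin (x - y)\<bar>" "\<bar>sin (x - (y + pi))\<bar> = \<bar>sin (x - y)\<bar>"
    "\<bar>sin (x + 2 * pi - y)\<bar> = \<bar>sin (x - y)\<bar>" for x y :: real
    using sin_periodic_pi[of "x - y"] sin_periodic_pi[of "x - y - pi"] sin_periodic[of "x - y"]
    by (simp_all add: algebra_simps)
  have "ennreal (2 * pi) * ?Z = (\<integral>\<^sup>+u. ?Z \<partial>circ)"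
    by (simp add: emeasure_seg mult.commute)
  also have "\<dots> = (\<integral>\<^sup>+u. \<integral>\<^sup>+R. \<integral>\<^sup>+p. ennreal \<bar>sin p\<bar> * (F (R ** rotx u) * F (R ** rotx (p + u))) \<partial>circ \<partial>haar \<partial>circ)"
  proof (rule nn_integral_cong)
    fix u
    have "?Z = (\<integral>\<^sup>+R. \<integral>\<^sup>+p. ennreal \<bar>sin p\<bar> * (F (R ** rotx u) * F (R ** rotx u ** rotx p)) \<partial>circ \<partial>haar)"
      by (rule nn_integral_haar_right[OF rotation_matrix_rotx, symmetric,
        where f = "\<lambda>R. \<integral>\<^sup>+p. ennreal \<bar>sin p\<bar> * (F R * F (R ** rotx p)) \<partial>circ"]) measurable
    then show "?Z = (\<integral>\<^sup>+R. \<integral>\<^sup>+p. ennreal \<bar>sin p\<bar> * (F (R ** rotx u) * F (R ** rotx (p + u))) \<partial>circ \<partial>haar)"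
      by (simp only: matrix_mul_assoc[symmetric] rotx_add add.commute)
  qed
  also have "\<dots> = (\<integral>\<^sup>+R. \<integral>\<^sup>+u. \<integral>\<^sup>+p. ennreal \<bar>sin p\<bar> * (F (R ** rotx u) * F (R ** rotx (p + u))) \<partial>circ \<partial>circ \<partial>haar)"
    by (rule haar_seg.Fubini') measurable
  also have "\<dots> = (\<integral>\<^sup>+R. \<integral>\<^sup>+u. \<integral>\<^sup>+v. ennreal \<bar>sin (v - u)\<bar> * (F (R ** rotx u) * F (R ** rotx v)) \<partial>circ \<partial>circ \<partial>haar)"
  proof (rule nn_integral_cong, rule nn_integral_cong_AE)
    fix R
    show "AE u in circ. (\<integral>\<^sup>+p. ennreal \<bar>sin p\<bar> * (F (R ** rotx u) * F (R ** rotx (p + u))) \<partial>circ)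
      = (\<integral>\<^sup>+v. ennreal \<bar>sin (v - u)\<bar> * (F (R ** rotx u) * F (R ** rotx v)) \<partial>circ)"
      using AE_seg[of 0 "2 * pi"]
    proof eventually_elim
      case (elim u)
      have "(\<integral>\<^sup>+p. ennreal \<bar>sin (p + u - u)\<bar> * (F (R ** rotx u) * F (R ** rotx (p + u))) \<partial>circ)
        = (\<integral>\<^sup>+v. ennreal \<bar>sin (v - u)\<bar> * (F (R ** rotx u) * F (R ** rotx v)) \<partial>circ)"
        by (rule nn_integral_circ_translate[where f = "\<lambda>v. ennreal \<bar>sin (v - u)\<bar> * (F (R ** rotx u) * F (R ** rotx v))"])
          (measurable, simp only: per2 sper, use elim in simp)
      then show ?case
        by (simp only: add_diff_cancel_right')
    qed
  qed
  \<comment> \<open>The 4 comes from folding both full turns onto half turns by the period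
    \<open>pi\<close>.\<close>
  also have "\<dots> = (\<integral>\<^sup>+R. 4 * ennreal (pencil_energy R) \<partial>haar)"
  proof (rule nn_integral_cong)
    fix R
    have "(\<integral>\<^sup>+u. \<integral>\<^sup>+v. ennreal \<bar>sin (v - u)\<bar> * (F (R ** rotx u) * F (R ** rotx v)) \<partial>circ \<partial>circ)
        = (\<integral>\<^sup>+u. 2 * (\<integral>\<^sup>+v. ennreal \<bar>sin (v - u)\<bar> * (F (R ** rotx u) * F (R ** rotx v)) \<partial>seg 0 pi) \<partial>circ)"
    proof (rule nn_integral_cong)
      fix u
      show "(\<integral>\<^sup>+v. ennreal \<bar>sin (v - u)\<bar> * (F (R ** rotx u) * F (R ** rotx v)) \<partial>circ)
        = 2 * (\<integral>\<^sup>+v. ennreal \<bar>sin (v - u)\<bar> * (F (R ** rotx u) * F (R ** rotx v)) \<partial>seg 0 pi)"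
        by (rule nn_integral_circ_half) (measurable, simp only: per sper)
    qed
    also have "\<dots> = 2 * (\<integral>\<^sup>+u. \<integral>\<^sup>+v. ennreal \<bar>sin (v - u)\<bar> * (F (R ** rotx u) * F (R ** rotx v)) \<partial>seg 0 pi \<partial>circ)"
      by (rule nn_integral_cmult) measurable
    also have "(\<integral>\<^sup>+u. \<integral>\<^sup>+v. ennreal \<bar>sin (v - u)\<bar> * (F (R ** rotx u) * F (R ** rotx v)) \<partial>seg 0 pi \<partial>circ)
        = 2 * (\<integral>\<^sup>+u. \<integral>\<^sup>+v. ennreal \<bar>sin (v - u)\<bar> * (F (R ** rotx u) * F (R ** rotx v)) \<partial>seg 0 pi \<partial>seg 0 pi)"
      by (rule nn_integral_circ_half) (measurable, simp only: per sper)
    also have "2 * \<dots> = 4 * ennreal (pencil_energy R)"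
      unfolding nn_integral_pencil_energy by (simp only: mult.assoc[symmetric]) simp
    finally show "(\<integral>\<^sup>+u. \<integral>\<^sup>+v. ennreal \<bar>sin (v - u)\<bar> * (F (R ** rotx u) * F (R ** rotx v)) \<partial>circ \<partial>circ) = 4 * ennreal (pencil_energy R)" .
  qed
  also have "\<dots> = 4 * (\<integral>\<^sup>+R. ennreal (pencil_energy R) \<partial>haar)"
    by (rule nn_integral_cmult) measurable
  finally show ?thesis .
qed

text \<open>By right invariance under \<open>rotz\<close> the position \<open>s\<close> on the arc
  is immaterial, so the mean of \<open>slab\<close> is \<open>t\<close> times a mean of
  \<open>W\<close>, and \<open>t\<close> cancels. The 2 undoes the half in the density
  \<open>sin t / 2\<close>.\<close>

lemma nn_integral_through_weight:
  "(\<integral>\<^sup>+R. ennreal (through_weight R) \<partial>haar) = 2 * (\<integral>\<^sup>+x. \<integral>\<^sup>+y. ennreal (W x y) \<partial>sphere_unif \<partial>sphere_unif)"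
proof -
  let ?P = "seg 0 pi"
  define K where "K t = (\<integral>\<^sup>+R. ennreal (W (R *v zeta 0) (R *v zeta t)) \<partial>haar)" for t
  have [measurable]: "K \<in> borel_measurable borel"
    unfolding K_def by measurable
  have slabK: "(\<integral>\<^sup>+R. slab R t \<partial>haar) = ennreal t * K t" if t: "t \<in> {0..pi}" for t
  proof -
    have r: "(\<integral>\<^sup>+R. ennreal (W (R *v zeta (- s)) (R *v zeta (t - s))) \<partial>haar) = K t" for s
    proof -
      have "K t = (\<integral>\<^sup>+R. ennreal (W ((R ** rotz (- s)) *v zeta 0) ((R ** rotz (- s)) *v zeta t)) \<partial>haar)"
        unfolding K_def
        by (rule nn_integral_haar_right[OF rotation_matrix_rotz, symmetric,
          where f = "\<lambda>R. ennreal (W (R *v zeta 0) (R *v zeta t))"]) measurable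
      then show ?thesis
        by (simp add: matrix_vector_mul_assoc[symmetric] rotz_zeta)
    qed
    have "(\<integral>\<^sup>+R. slab R t \<partial>haar)
        = (\<integral>\<^sup>+s. \<integral>\<^sup>+R. of_bool (s \<le> t) * ennreal (W (R *v zeta (- s)) (R *v zeta (t - s))) \<partial>haar \<partial>?P)"
      unfolding slab_def by (rule seg_haar.Fubini') measurable
    also have "\<dots> = (\<integral>\<^sup>+s. of_bool (s \<le> t) * K t \<partial>?P)"
    proof (rule nn_integral_cong)
      fix s
      show "(\<integral>\<^sup>+R. of_bool (s \<le> t) * ennreal (W (R *v zeta (- s)) (R *v zeta (t - s))) \<partial>haar) = of_bool (s \<le> t) * K t"
        unfolding r[of s, symmetric] by (rule nn_integral_cmult) measurable
    qed
    also have "\<dots> = (\<integral>\<^sup>+s. of_bool (s \<le> t) \<partial>?P) * K t"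
      by (rule nn_integral_multc) measurable
    finally show ?thesis
      using t by (simp add: nn_integral_of_bool_le)
  qed
  have "(\<integral>\<^sup>+R. ennreal (through_weight R) \<partial>haar) = (\<integral>\<^sup>+R. \<integral>\<^sup>+t. ennreal (sin t * arc_density R t) \<partial>?P \<partial>haar)"
    by (simp only: nn_integral_sin_arc_density)
  also have "\<dots> = (\<integral>\<^sup>+t. \<integral>\<^sup>+R. ennreal (sin t * arc_density R t) \<partial>haar \<partial>?P)"
    by (rule seg_haar.Fubini') measurable
  also have "\<dots> = (\<integral>\<^sup>+t. 2 * (ennreal (sin t / 2) * K t) \<partial>?P)"
  proof (rule nn_integral_cong_AE)
    show "AE t in ?P. (\<integral>\<^sup>+R. ennreal (sin t * arc_density R t) \<partial>haar) = 2 * (ennreal (sin t / 2) * K t)"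
      using AE_seg_open[of 0 pi]
    proof eventually_elim
      case (elim t)
      then have s: "0 \<le> sin t" and t: "0 < t" "t \<le> pi" "t \<in> {0..pi}"
        by (auto intro: sin_ge_zero)
      have e: "ennreal (sin t * arc_density R t) = ennreal (sin t / t) * slab R t" for R
        using s t arc_density_nonneg[of R t] by (simp add: slab_eq ennreal_mult[symmetric])
      have "(\<integral>\<^sup>+R. ennreal (sin t * arc_density R t) \<partial>haar) = ennreal (sin t / t) * (\<integral>\<^sup>+R. slab R t \<partial>haar)"
        unfolding e by (rule nn_integral_cmult) measurable
      also have "\<dots> = ennreal (sin t / t) * ennreal t * K t"
        by (simp only: slabK[OF t(3)] mult.assoc)
      also have "ennreal (sin t / t) * ennreal t = ennreal (sin t)"
        using s t by (simp add: ennreal_mult[symmetric])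
      also have "ennreal (sin t) = 2 * ennreal (sin t / 2)"
        using s ennreal_mult[of 2 "sin t / 2"] by simp
      finally show ?case
        by (simp only: mult.assoc)
    qed
  qed
  also have "\<dots> = 2 * (\<integral>\<^sup>+t. ennreal (sin t / 2) * K t \<partial>?P)"
    by (rule nn_integral_cmult) measurable
  also have "(\<integral>\<^sup>+t. ennreal (sin t / 2) * K t \<partial>?P) = (\<integral>\<^sup>+x. \<integral>\<^sup>+y. ennreal (W x y) \<partial>sphere_unif \<partial>sphere_unif)"
    unfolding K_def by (rule nn_integral_sphere_pair[symmetric]) measurable
  finally show ?thesis .
qed

text \<open>The estimate at one point, with the same tangent point \<open>t\<close> for every
  \<open>R\<close>. The term with \<open>1 - cos t\<close> stands on the right so that both sides
  can be integrated as nonnegative quantities.\<close>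

lemma pencil_energy_lower_bound:
  assumes t: "0 < t" "t \<le> pi"
  shows "2 * pi * (psi t)\<^sup>2 + 4 * t * psi t * (\<integral>u. through_weight (R ** rotx u) \<partial>seg 0 pi)
    \<le> pencil_energy R + 4 * t * psi t * (pi * (1 - cos t))"
proof -
  define c where "c = root 3 (psi t)"
  have c: "0 < c" "c ^ 3 = psi t"
    using psi_pos[OF t] by (auto simp: c_def)
  have i: "integrable (seg 0 pi) (\<lambda>u. through_weight (R ** rotx u))"
    by (rule integrable_seg[where M = pi]) (measurable, use through_weight_bounds in auto)
  have "2 * pi * (c ^ 3)\<^sup>2 + 4 * t * c ^ 3 * (\<integral>u. through_weight (R ** rotx u) - (1 - cos t) \<partial>seg 0 pi) \<le> pencil_energy R"
    unfolding pencil_energy_def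
  proof (rule sin_kernel_lower_bound[where M = "pi * pi + pi + 2"])
    show "through_real (R ** rotx u) \<le> pi * pi + pi + 2" for u
      using through_real_le[of "R ** rotx u"] by (simp add: add_increasing2)
    show "\<bar>through_weight (R ** rotx u) - (1 - cos t)\<bar> \<le> pi * pi + pi + 2" for u
    proof -
      have "\<bar>through_weight (R ** rotx u) - (1 - cos t)\<bar> \<le> pi + 2"
        using through_weight_bounds[of "R ** rotx u"] cos_ge_minus_one[of t] cos_le_one[of t] by linarith
      moreover have "0 \<le> pi * pi" by simp
      ultimately show ?thesis by linarith
    qed
    show "c\<^sup>2 + 2 * t / (3 * c) * (through_weight (R ** rotx u) - (1 - cos t)) \<le> (root 3 (through_real (R ** rotx u)))\<^sup>2" for u
      unfolding through_weight_def through_real_def by (rule bathtub_tangent[OF _ arc_density_nonneg arc_density_le t c]) measurable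
  qed (measurable, simp_all add: through_real_nonneg c)
  also have "(\<integral>u. through_weight (R ** rotx u) - (1 - cos t) \<partial>seg 0 pi) = (\<integral>u. through_weight (R ** rotx u) \<partial>seg 0 pi) - pi * (1 - cos t)"
    by (subst Bochner_Integration.integral_diff[OF i finite_measure.integrable_const[OF finite_measure_seg]])
      (simp only: integral_seg_const[OF pi_ge_zero] diff_zero)
  finally show ?thesis
    unfolding c(2) by (simp add: right_diff_distrib)
qed

text \<open>The hypothesis on the edge density gives \<open>through_weight\<close> the mean
  \<open>1 - cos t\<close>; hence the two linear terms have equal finite integrals and
  cancel.\<close>

lemma nn_integral_pencil_energy_lower_bound:
  assumes t: "0 < t" "t \<le> pi"
    and e: "(\<integral>\<^sup>+x. \<integral>\<^sup>+y. ennreal (W x y) \<partial>sphere_unif \<partial>sphere_unif) = ennreal ((1 - cos t) / 2)"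
  shows "ennreal (2 * pi * (psi t)\<^sup>2) \<le> (\<integral>\<^sup>+R. ennreal (pencil_energy R) \<partial>haar)"
proof -
  let ?a = "4 * t * psi t"
  have a: "0 \<le> ?a" "0 \<le> 1 - cos t"
    using t psi_pos[OF t] by auto
  have ii0: "0 \<le> pencil_energy R" for R
    unfolding pencil_energy_def by (intro Bochner_Integration.integral_nonneg mult_nonneg_nonneg through_real_nonneg) auto
  have mm_int: "(\<integral>\<^sup>+u. ennreal (through_weight (R ** rotx u)) \<partial>seg 0 pi) = ennreal (\<integral>u. through_weight (R ** rotx u) \<partial>seg 0 pi)" for R
    by (rule nn_integral_seg_eq_integral[OF _ through_weight_bounds]) measurable
  have mm_int0: "0 \<le> (\<integral>u. through_weight (R ** rotx u) \<partial>seg 0 pi)" for R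
    by (intro Bochner_Integration.integral_nonneg through_weight_bounds)
  have mm_total: "(\<integral>\<^sup>+R. \<integral>\<^sup>+u. ennreal (through_weight (R ** rotx u)) \<partial>seg 0 pi \<partial>haar) = ennreal (pi * (1 - cos t))"
  proof -
    have "(\<integral>\<^sup>+R. \<integral>\<^sup>+u. ennreal (through_weight (R ** rotx u)) \<partial>seg 0 pi \<partial>haar) = (\<integral>\<^sup>+u. \<integral>\<^sup>+R. ennreal (through_weight (R ** rotx u)) \<partial>haar \<partial>seg 0 pi)"
      by (rule seg_haar.Fubini') measurable
    also have "\<dots> = (\<integral>\<^sup>+u. (\<integral>\<^sup>+R. ennreal (through_weight R) \<partial>haar) \<partial>seg 0 pi)"
      by (intro nn_integral_cong nn_integral_haar_right[where f = "\<lambda>R. ennreal (through_weight R)"] rotation_matrix_rotx) measurable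
    also have "\<dots> = ennreal (1 - cos t) * ennreal pi"
    proof -
      have x: "2 * ((1 - cos t) / 2) = 1 - cos t"
        by simp
      have "ennreal (2 * ((1 - cos t) / 2)) = ennreal 2 * ennreal ((1 - cos t) / 2)"
        using a by (intro ennreal_mult) auto
      from this[unfolded x ennreal_numeral, symmetric] show ?thesis
        by (simp add: nn_integral_through_weight e emeasure_seg)
    qed
    finally show ?thesis
      using a by (simp add: ennreal_mult mult.commute)
  qed
  have "ennreal (2 * pi * (psi t)\<^sup>2) + ennreal ?a * ennreal (pi * (1 - cos t))
      = (\<integral>\<^sup>+R. ennreal (2 * pi * (psi t)\<^sup>2) + ennreal ?a * (\<integral>\<^sup>+u. ennreal (through_weight (R ** rotx u)) \<partial>seg 0 pi) \<partial>haar)"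
    unfolding mm_total[symmetric]
    by (subst nn_integral_add, measurable) (subst nn_integral_cmult, measurable, simp only: nn_integral_haar_const)
  also have "\<dots> \<le> (\<integral>\<^sup>+R. ennreal (pencil_energy R) + ennreal (?a * (pi * (1 - cos t))) \<partial>haar)"
  proof (rule nn_integral_mono)
    fix R
    have "ennreal (2 * pi * (psi t)\<^sup>2) + ennreal ?a * (\<integral>\<^sup>+u. ennreal (through_weight (R ** rotx u)) \<partial>seg 0 pi)
        = ennreal (2 * pi * (psi t)\<^sup>2 + ?a * (\<integral>u. through_weight (R ** rotx u) \<partial>seg 0 pi))"
      unfolding mm_int using a mm_int0[of R] by (simp add: ennreal_mult ennreal_plus)
    also have "\<dots> \<le> ennreal (pencil_energy R + ?a * (pi * (1 - cos t)))"
      by (intro ennreal_leI pencil_energy_lower_bound t)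
    also have "\<dots> = ennreal (pencil_energy R) + ennreal (?a * (pi * (1 - cos t)))"
      using a ii0[of R] by (intro ennreal_plus) auto
    finally show "ennreal (2 * pi * (psi t)\<^sup>2) + ennreal ?a * (\<integral>\<^sup>+u. ennreal (through_weight (R ** rotx u)) \<partial>seg 0 pi)
      \<le> ennreal (pencil_energy R) + ennreal (?a * (pi * (1 - cos t)))" .
  qed
  also have "\<dots> = (\<integral>\<^sup>+R. ennreal (pencil_energy R) \<partial>haar) + ennreal (?a * (pi * (1 - cos t)))"
    by (subst nn_integral_add, measurable) (simp only: nn_integral_haar_const)
  also have "ennreal (?a * (pi * (1 - cos t))) = ennreal ?a * ennreal (pi * (1 - cos t))"
    using a by (intro ennreal_mult) auto
  finally show ?thesis
    by (simp add: ennreal_add_left_cancel_le ennreal_mult_eq_top_iff add.commute[of _ "ennreal ?a * _"])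
qed

end

section \<open>The crossing inequality\<close>

text \<open>A kernel is constrained on the sphere only; composing it with this map gives a Borel
  kernel on the whole space with the same values on the sphere. The point \<open>zeta 0\<close> is
  an arbitrary choice.\<close>

definition sphere_proj :: "real^3 \<Rightarrow> real^3" where
  "sphere_proj x = (if norm x = 1 then x else zeta 0)"

lemma sphere_proj_S2: "sphere_proj x \<in> S2"
  by (simp add: sphere_proj_def norm_zeta)

lemma sphere_proj_eq: "x \<in> S2 \<Longrightarrow> sphere_proj x = x"
  by (simp add: sphere_proj_def)

lemma sphere_proj_measurable: "sphere_proj \<in> borel \<rightarrow>\<^sub>M sphere_unif"
proof -
  have "sphere_proj \<in> borel_measurable borel"
    unfolding sphere_proj_def[abs_def] by measurable
  then have "sphere_proj \<in> borel \<rightarrow>\<^sub>M restrict_space borel S2"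
    by (intro measurable_restrict_space2) (use sphere_proj_S2 in auto)
  then show ?thesis
    by (simp add: measurable_cong_sets[OF refl sets_sphere_unif])
qed

lemma sphere_unif_id_measurable: "(\<lambda>x. x) \<in> sphere_unif \<rightarrow>\<^sub>M borel"
  by (rule borel_measurable_sphere_unif) simp

lemma measurable_id_pair:
  assumes "(\<lambda>x. x) \<in> A \<rightarrow>\<^sub>M A'" "(\<lambda>x. x) \<in> B \<rightarrow>\<^sub>M B'"
  shows "(\<lambda>x. x) \<in> A \<Otimes>\<^sub>M B \<rightarrow>\<^sub>M A' \<Otimes>\<^sub>M B'"
  using measurable_Pair[OF measurable_compose[OF measurable_fst assms(1)] measurable_compose[OF measurable_snd assms(2)]]
  by simp

interpretation sphere_unif: finite_measure sphere_unif
  by (rule finite_measure_sphere_unif)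

lemma sym_kernel_sphere_proj:
  assumes "sym_kernel w"
  shows "(\<lambda>(x, y). w (sphere_proj x) (sphere_proj y)) \<in> borel_measurable (borel \<Otimes>\<^sub>M borel)"
    and "0 \<le> w (sphere_proj x) (sphere_proj y)" "w (sphere_proj x) (sphere_proj y) \<le> 1" "w (sphere_proj x) (sphere_proj y) = w (sphere_proj y) (sphere_proj x)"
proof -
  have w: "(\<lambda>(x, y). w x y) \<in> borel_measurable (sphere_unif \<Otimes>\<^sub>M sphere_unif)"
    using assms by (simp add: sym_kernel_def)
  have "(\<lambda>p. (sphere_proj (fst p), sphere_proj (snd p))) \<in> borel \<Otimes>\<^sub>M borel \<rightarrow>\<^sub>M sphere_unif \<Otimes>\<^sub>M sphere_unif"
    by (intro measurable_Pair measurable_compose[OF measurable_fst sphere_proj_measurable]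
      measurable_compose[OF measurable_snd sphere_proj_measurable])
  from measurable_compose[OF this w] show "(\<lambda>(x, y). w (sphere_proj x) (sphere_proj y)) \<in> borel_measurable (borel \<Otimes>\<^sub>M borel)"
    by (simp add: case_prod_beta')
  show "0 \<le> w (sphere_proj x) (sphere_proj y)" "w (sphere_proj x) (sphere_proj y) \<le> 1" "w (sphere_proj x) (sphere_proj y) = w (sphere_proj y) (sphere_proj x)"
    using assms sphere_proj_S2[of x] sphere_proj_S2[of y] unfolding sym_kernel_def by auto
qed

lemma edge_density_nn_integral:
  assumes w: "sym_kernel w"
  shows "(\<integral>\<^sup>+x. \<integral>\<^sup>+y. ennreal (w (sphere_proj x) (sphere_proj y)) \<partial>sphere_unif \<partial>sphere_unif) = ennreal (edge_density w)"
    and "0 \<le> edge_density w"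
proof -
  let ?W = "\<lambda>x y. w (sphere_proj x) (sphere_proj y)"
  note [measurable] = sym_kernel_sphere_proj(1)[OF w]
  note W = sym_kernel_sphere_proj(2,3)[OF w]
  have m1: "?W x \<in> borel_measurable sphere_unif" for x
    by (rule borel_measurable_sphere_unif) measurable
  have i1: "integrable sphere_unif (?W x)" for x
    by (rule sphere_unif.integrable_const_bound[where B = 1]) (use W m1 in auto)
  have n1: "(\<integral>\<^sup>+y. ennreal (?W x y) \<partial>sphere_unif) = ennreal (\<integral>y. ?W x y \<partial>sphere_unif)" for x
    by (rule nn_integral_eq_integral[OF i1]) (use W in auto)
  have m2: "(\<lambda>x. \<integral>y. ?W x y \<partial>sphere_unif) \<in> borel_measurable sphere_unif"
  proof -
    have "(\<lambda>x. \<integral>\<^sup>+y. ennreal (?W x y) \<partial>sphere_unif) \<in> borel_measurable borel"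
      by measurable
    then have "(\<lambda>x. enn2real (\<integral>\<^sup>+y. ennreal (?W x y) \<partial>sphere_unif)) \<in> borel_measurable borel"
      by measurable
    moreover have "enn2real (\<integral>\<^sup>+y. ennreal (?W x y) \<partial>sphere_unif) = (\<integral>y. ?W x y \<partial>sphere_unif)" for x
      unfolding n1 using W by (intro enn2real_ennreal Bochner_Integration.integral_nonneg)
    ultimately show ?thesis
      by (intro borel_measurable_sphere_unif) simp
  qed
  have b: "0 \<le> (\<integral>y. ?W x y \<partial>sphere_unif)" "(\<integral>y. ?W x y \<partial>sphere_unif) \<le> measure sphere_unif (space sphere_unif)" for x
  proof -
    show "0 \<le> (\<integral>y. ?W x y \<partial>sphere_unif)"
      by (intro Bochner_Integration.integral_nonneg W)
    have "(\<integral>y. ?W x y \<partial>sphere_unif) \<le> (\<integral>y. 1 \<partial>sphere_unif)"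
      by (rule Bochner_Integration.integral_mono[OF i1]) (simp, rule W)
    then show "(\<integral>y. ?W x y \<partial>sphere_unif) \<le> measure sphere_unif (space sphere_unif)"
      by simp
  qed
  have i2: "integrable sphere_unif (\<lambda>x. \<integral>y. ?W x y \<partial>sphere_unif)"
    by (rule sphere_unif.integrable_const_bound[where B = "measure sphere_unif (space sphere_unif)"])
      (use b m2 in auto)
  have "edge_density w = (\<integral>x. \<integral>y. ?W x y \<partial>sphere_unif \<partial>sphere_unif)"
    unfolding edge_density_def
    by (intro Bochner_Integration.integral_cong refl) (simp add: space_sphere_unif sphere_proj_def)
  moreover have "(\<integral>\<^sup>+x. \<integral>\<^sup>+y. ennreal (?W x y) \<partial>sphere_unif \<partial>sphere_unif)
      = ennreal (\<integral>x. \<integral>y. ?W x y \<partial>sphere_unif \<partial>sphere_unif)"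
    unfolding n1 by (rule nn_integral_eq_integral[OF i2]) (use b in auto)
  moreover have "0 \<le> (\<integral>x. \<integral>y. ?W x y \<partial>sphere_unif \<partial>sphere_unif)"
    by (intro Bochner_Integration.integral_nonneg b)
  ultimately show "(\<integral>\<^sup>+x. \<integral>\<^sup>+y. ennreal (?W x y) \<partial>sphere_unif \<partial>sphere_unif) = ennreal (edge_density w)"
    "0 \<le> edge_density w"
    by simp_all
qed

text \<open>The integrand is bounded and the measure finite, so the Bochner integral over the
  product can be read as an iterated nonnegative integral, the form that
  \<open>crossing_formula\<close> evaluates.\<close>

lemma Cr_nn_integral:
  assumes w: "sym_kernel w"
  shows "ennreal (Cr w) = (\<integral>\<^sup>+x1. \<integral>\<^sup>+x2. \<integral>\<^sup>+x3. \<integral>\<^sup>+x4. ennreal (w (sphere_proj x1) (sphere_proj x2)) *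
      (ennreal (w (sphere_proj x3) (sphere_proj x4)) * cross_ind x1 x2 x3 x4) \<partial>sphere_unif \<partial>sphere_unif \<partial>sphere_unif \<partial>sphere_unif)"
    and "0 \<le> Cr w"
proof -
  let ?W = "\<lambda>x y. w (sphere_proj x) (sphere_proj y)"
  let ?S = sphere_unif
  let ?M2 = "?S \<Otimes>\<^sub>M ?S" and ?M3 = "?S \<Otimes>\<^sub>M ?S \<Otimes>\<^sub>M ?S" and ?M4 = "?S \<Otimes>\<^sub>M ?S \<Otimes>\<^sub>M ?S \<Otimes>\<^sub>M ?S"
  let ?N4 = "borel \<Otimes>\<^sub>M borel \<Otimes>\<^sub>M borel \<Otimes>\<^sub>M borel :: ((real^3) \<times> (real^3) \<times> (real^3) \<times> (real^3)) measure"
  note [measurable] = sym_kernel_sphere_proj(1)[OF w]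
  note W = sym_kernel_sphere_proj(2,3)[OF w]
  have f2: "finite_measure ?M2"
    by (intro finite_measure_pair_measure finite_measure_sphere_unif)
  have f3: "finite_measure ?M3"
    by (intro finite_measure_pair_measure finite_measure_sphere_unif)
  have f4: "finite_measure ?M4"
    by (intro finite_measure_pair_measure finite_measure_sphere_unif)
  define G where "G = (\<lambda>(x1, x2, x3, x4). ennreal (?W x1 x2) * (ennreal (?W x3 x4) * cross_ind x1 x2 x3 x4))"
  have G_N: "G \<in> borel_measurable ?N4"
    unfolding G_def by measurable
  note ids = sphere_unif_id_measurable measurable_id_pair
  have G4: "G \<in> borel_measurable ?M4"
    by (rule measurable_compose[OF _ G_N]) (intro ids)
  have G3: "(\<lambda>q. G (x1, q)) \<in> borel_measurable ?M3" for x1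
    by (rule measurable_compose[OF _ G_N]) (intro measurable_Pair measurable_const ids, simp)
  have G2: "(\<lambda>q. G (x1, x2, q)) \<in> borel_measurable ?M2" for x1 x2
    by (rule measurable_compose[OF _ G_N]) (intro measurable_Pair measurable_const ids, simp_all)
  define h where "h q = enn2real (G q)" for q
  have h: "h (x1, x2, x3, x4) = ?W x1 x2 * (?W x3 x4 * of_bool (norm x1 = 1 \<and> norm x2 = 1 \<and> norm x3 = 1 \<and> norm x4 = 1
      \<and> arcs_cross x1 x2 x3 x4))" for x1 x2 x3 x4
    using W by (simp add: h_def G_def cross_ind_def enn2real_mult)
  have G: "G (x1, x2, x3, x4) = ennreal (h (x1, x2, x3, x4))" for x1 x2 x3 x4
    unfolding h using W by (simp add: G_def cross_ind_def of_bool_def ennreal_mult)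
  have h_m: "h \<in> borel_measurable ?M4"
    unfolding h_def[abs_def] using G4 by measurable
  have h0: "0 \<le> h q" for q
    by (simp add: h_def)
  have h1: "h q \<le> 1" for q
  proof -
    obtain x1 x2 x3 x4 where q: "q = (x1, x2, x3, x4)"
      by (cases q rule: prod_cases4)
    show ?thesis
      unfolding q h using W by (auto simp: of_bool_def intro!: mult_le_one)
  qed
  have i: "integrable ?M4 h"
    by (rule finite_measure.integrable_const_bound[OF f4, where B = 1]) (use h0 h1 h_m in auto)
  have Cr: "Cr w = (\<integral>q. h q \<partial>?M4)"
    unfolding Cr_def
  proof (intro Bochner_Integration.integral_cong refl)
    fix q assume "q \<in> space ?M4"
    then show "(case q of (x1, x2, x3, x4) \<Rightarrow> w x1 x2 * w x3 x4 * of_bool (arcs_cross x1 x2 x3 x4)) = h q"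
      by (auto simp: space_pair_measure space_sphere_unif h sphere_proj_def)
  qed
  then show "0 \<le> Cr w"
    using h0 by simp
  have "ennreal (Cr w) = (\<integral>\<^sup>+q. ennreal (h q) \<partial>?M4)"
    unfolding Cr by (rule nn_integral_eq_integral[symmetric, OF i]) (use h0 in auto)
  also have "\<dots> = (\<integral>\<^sup>+q. G q \<partial>?M4)"
    by (intro nn_integral_cong) (auto simp: G)
  also have "\<dots> = (\<integral>\<^sup>+x1. \<integral>\<^sup>+q. G (x1, q) \<partial>?M3 \<partial>?S)"
    by (rule sigma_finite_measure.nn_integral_fst[OF finite_measure.axioms(1)[OF f3] G4, symmetric])
  also have "\<dots> = (\<integral>\<^sup>+x1. \<integral>\<^sup>+x2. \<integral>\<^sup>+q. G (x1, x2, q) \<partial>?M2 \<partial>?S \<partial>?S)"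
    by (intro nn_integral_cong sigma_finite_measure.nn_integral_fst[OF finite_measure.axioms(1)[OF f2] G3, symmetric])
  also have "\<dots> = (\<integral>\<^sup>+x1. \<integral>\<^sup>+x2. \<integral>\<^sup>+x3. \<integral>\<^sup>+x4. G (x1, x2, x3, x4) \<partial>?S \<partial>?S \<partial>?S \<partial>?S)"
    by (intro nn_integral_cong sphere_unif.nn_integral_fst[OF G2, symmetric])
  finally show "ennreal (Cr w) = (\<integral>\<^sup>+x1. \<integral>\<^sup>+x2. \<integral>\<^sup>+x3. \<integral>\<^sup>+x4. ennreal (?W x1 x2) *
      (ennreal (?W x3 x4) * cross_ind x1 x2 x3 x4) \<partial>?S \<partial>?S \<partial>?S \<partial>?S)"
    by (simp only: G_def split)
qed

lemma psi_sq_le_Cr: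
  assumes w: "sym_kernel w" and t: "0 < t" "t \<le> pi" and e: "cos t = 1 - 2 * edge_density w"
  shows "(psi t)\<^sup>2 / (8 * pi\<^sup>2) \<le> Cr w"
proof -
  let ?W = "\<lambda>x y. w (sphere_proj x) (sphere_proj y)"
  note W = sym_kernel_sphere_proj[OF w]
  let ?Z = "\<integral>\<^sup>+R. \<integral>\<^sup>+p. ennreal \<bar>sin p\<bar> * (through (\<lambda>x y. ennreal (?W x y)) R * through (\<lambda>x y. ennreal (?W x y)) (R ** rotx p)) \<partial>circ \<partial>haar"
  have e': "(\<integral>\<^sup>+x. \<integral>\<^sup>+y. ennreal (?W x y) \<partial>sphere_unif \<partial>sphere_unif) = ennreal ((1 - cos t) / 2)"
    unfolding edge_density_nn_integral(1)[OF w] using e by simp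
  have "(\<lambda>(x, y). ennreal (?W x y)) \<in> borel_measurable (borel \<Otimes>\<^sub>M borel)"
    using W(1) by measurable
  note cf = crossing_formula[OF this]
  have k: "0 \<le> 1 / (32 * pi\<^sup>2)" "0 \<le> 4 * (2 * pi * (psi t)\<^sup>2)" "0 \<le> 2 * pi" "0 \<le> 2 * pi * (psi t)\<^sup>2"
    by simp_all
  \<comment> \<open>Both sides carry the factor \<open>2 * pi\<close> of
    \<open>nn_integral_through_circle\<close>; dividing it out leaves
    \<open>4 (psi t)^2 / (32 pi^2)\<close>.\<close>
  have "ennreal (1 / (32 * pi\<^sup>2) * (4 * (2 * pi * (psi t)\<^sup>2))) = ennreal (1 / (32 * pi\<^sup>2)) * (4 * ennreal (2 * pi * (psi t)\<^sup>2))"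
    using ennreal_mult[OF k(1,2)] ennreal_mult[OF _ k(4), of 4] by simp
  also have "\<dots> \<le> ennreal (1 / (32 * pi\<^sup>2)) * (ennreal (2 * pi) * ?Z)"
    unfolding nn_integral_through_circle[OF W]
    by (intro mult_left_mono nn_integral_pencil_energy_lower_bound[OF W t e']) auto
  also have "\<dots> = ennreal (2 * pi) * ennreal (Cr w)"
    unfolding Cr_nn_integral(1)[OF w] cf by (simp only: mult.left_commute)
  also have "\<dots> = ennreal (2 * pi * Cr w)"
    by (rule ennreal_mult[symmetric, OF k(3) Cr_nn_integral(2)[OF w]])
  finally have "1 / (32 * pi\<^sup>2) * (4 * (2 * pi * (psi t)\<^sup>2)) \<le> 2 * pi * Cr w"
    using Cr_nn_integral(2)[OF w] by (simp add: ennreal_le_iff)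
  then show ?thesis
    by (simp add: field_simps power2_eq_square)
qed

section \<open>Geodesic caps attain equality\<close>

lemma sph_dist_le_iff:
  assumes "x \<in> S2" "y \<in> S2" "0 \<le> t" "t \<le> pi"
  shows "sph_dist x y \<le> t \<longleftrightarrow> cos t \<le> x \<bullet> y"
proof -
  have "\<bar>x \<bullet> y\<bar> \<le> 1"
    using Cauchy_Schwarz_ineq2[of x y] assms by simp
  then have "0 \<le> sph_dist x y" "sph_dist x y \<le> pi" "cos (sph_dist x y) = x \<bullet> y"
    by (auto simp: sph_dist_def arccos_lbound arccos_ubound)
  then show ?thesis
    using cos_mono_le_eq[of t "sph_dist x y"] assms by auto
qed

lemma sym_kernel_cap:
  assumes t: "0 \<le> t" "t \<le> pi"
  shows "sym_kernel (\<lambda>x y. of_bool (sph_dist x y \<le> t))"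
proof -
  have "(\<lambda>(x, y). of_bool (cos t \<le> x \<bullet> y) :: real) \<in> borel_measurable (borel \<Otimes>\<^sub>M borel :: ((real^3) \<times> (real^3)) measure)"
    by measurable
  then have "(\<lambda>(x, y). of_bool (cos t \<le> x \<bullet> y) :: real) \<in> borel_measurable (sphere_unif \<Otimes>\<^sub>M sphere_unif)"
    by (rule measurable_compose[rotated]) (intro measurable_id_pair sphere_unif_id_measurable)
  moreover have "(\<lambda>(x, y). of_bool (sph_dist x y \<le> t) :: real) \<in> borel_measurable (sphere_unif \<Otimes>\<^sub>M sphere_unif)
      \<longleftrightarrow> (\<lambda>(x, y). of_bool (cos t \<le> x \<bullet> y) :: real) \<in> borel_measurable (sphere_unif \<Otimes>\<^sub>M sphere_unif)"
    by (rule measurable_cong) (auto simp: space_pair_measure space_sphere_unif sph_dist_le_iff t)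
  ultimately show ?thesis
    by (auto simp: sym_kernel_def sph_dist_def inner_commute)
qed

lemma nn_integral_cap:
  assumes t: "0 \<le> t" "t \<le> pi"
  shows "(\<integral>\<^sup>+x. ennreal (sin x / 2) * of_bool (x \<le> t) \<partial>seg 0 pi) = ennreal ((1 - cos t) / 2)"
    and "(\<integral>\<^sup>+x. ennreal (sin x) * (ennreal x * of_bool (x \<le> t)) \<partial>seg 0 pi) = ennreal (psi t)"
proof -
  have a: "AE x in seg 0 pi. ennreal (sin x / 2) * of_bool (x \<le> t) = ennreal (sin x * of_bool (x \<le> t) / 2)"
    using AE_seg[of 0 pi] by (rule eventually_mono) auto
  have b: "AE x in seg 0 pi. ennreal (sin x) * (ennreal x * of_bool (x \<le> t)) = ennreal (x * sin x * of_bool (x \<le> t))"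
    using AE_seg[of 0 pi] by (rule eventually_mono) (auto simp: ennreal_mult sin_ge_zero mult.commute)
  have "(\<integral>\<^sup>+x. ennreal (sin x * of_bool (x \<le> t) / 2) \<partial>seg 0 pi) = ennreal (\<integral>x. sin x * of_bool (x \<le> t) / 2 \<partial>seg 0 pi)"
    by (rule nn_integral_seg_eq_integral[where M = 1])
      (measurable, auto simp: of_bool_def sin_ge_zero intro: order_trans[OF sin_le_one])
  then show "(\<integral>\<^sup>+x. ennreal (sin x / 2) * of_bool (x \<le> t) \<partial>seg 0 pi) = ennreal ((1 - cos t) / 2)"
    using nn_integral_cong_AE[OF a] by (simp add: integral_sin_le t)
  have "(\<integral>\<^sup>+x. ennreal (x * sin x * of_bool (x \<le> t)) \<partial>seg 0 pi) = ennreal (\<integral>x. x * sin x * of_bool (x \<le> t) \<partial>seg 0 pi)"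
  proof (rule nn_integral_seg_eq_integral[where M = "pi * 1 * 1"])
    fix x :: real assume x: "x \<in> {0..pi}"
    then have "0 \<le> sin x"
      by (auto intro: sin_ge_zero)
    with x show "0 \<le> x * sin x * of_bool (x \<le> t)" "x * sin x * of_bool (x \<le> t) \<le> pi * 1 * 1"
      using mult_mono[of x pi "sin x" 1] by (auto simp: of_bool_def)
  qed measurable
  then show "(\<integral>\<^sup>+x. ennreal (sin x) * (ennreal x * of_bool (x \<le> t)) \<partial>seg 0 pi) = ennreal (psi t)"
    using nn_integral_cong_AE[OF b] by (simp add: integral_sin_le t)
qed

text \<open>Equality is computed directly, without tracing equality cases: for the cap,
  \<open>through\<close> is \<open>psi t\<close> at every frame, so \<open>crossing_formula\<close>
  leaves its constant times \<open>(psi t)^2\<close> times the integral 4 of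
  \<open>|sin|\<close>.\<close>

lemma cap_extremal:
  assumes t: "0 \<le> t" "t \<le> pi"
  defines "w \<equiv> \<lambda>x y. of_bool (sph_dist x y \<le> t) :: real"
  shows "cos t = 1 - 2 * edge_density w" "Cr w = (psi t)\<^sup>2 / (8 * pi\<^sup>2)"
proof -
  have w: "sym_kernel w"
    unfolding w_def by (rule sym_kernel_cap[OF t])
  note W = sym_kernel_sphere_proj[OF w]
  let ?W = "\<lambda>x y. ennreal (w (sphere_proj x) (sphere_proj y))"
  have W_m [measurable]: "(\<lambda>(x, y). ?W x y) \<in> borel_measurable (borel \<Otimes>\<^sub>M borel)"
    using W(1) by measurable
  have wz: "?W (R *v zeta a) (R *v zeta (a + r)) = of_bool (r \<le> t)"
    if "rotation_matrix R" "r \<in> {0..pi}" for R a r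
    using that by (simp add: w_def sphere_proj_eq rotation_matrix_norm norm_zeta sph_dist_rotation)
  have "ennreal (edge_density w) = (\<integral>\<^sup>+r. ennreal (sin r / 2) * (\<integral>\<^sup>+R. ?W (R *v zeta 0) (R *v zeta r) \<partial>haar) \<partial>seg 0 pi)"
    unfolding edge_density_nn_integral(1)[OF w, symmetric] by (rule nn_integral_sphere_pair) measurable
  also have "\<dots> = (\<integral>\<^sup>+r. ennreal (sin r / 2) * of_bool (r \<le> t) \<partial>seg 0 pi)"
  proof (rule nn_integral_cong_AE)
    show "AE r in seg 0 pi. ennreal (sin r / 2) * (\<integral>\<^sup>+R. ?W (R *v zeta 0) (R *v zeta r) \<partial>haar) = ennreal (sin r / 2) * of_bool (r \<le> t)"
      using AE_seg[of 0 pi]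
    proof eventually_elim
      case (elim r)
      have "(\<integral>\<^sup>+R. ?W (R *v zeta 0) (R *v zeta r) \<partial>haar) = (\<integral>\<^sup>+R. of_bool (r \<le> t) \<partial>haar)"
        by (rule nn_integral_haar_cong) (measurable, use wz[OF _ elim, of _ 0] in simp)
      then show ?case
        by (simp only: nn_integral_haar_const)
    qed
  qed
  also have "\<dots> = ennreal ((1 - cos t) / 2)"
    by (rule nn_integral_cap[OF t])
  finally show "cos t = 1 - 2 * edge_density w"
    using edge_density_nn_integral(2)[OF w] by simp
  have F: "through ?W R = ennreal (psi t)" if R: "rotation_matrix R" for R
  proof -
    have "through ?W R = (\<integral>\<^sup>+r. ennreal (sin r) * (ennreal r * of_bool (r \<le> t)) \<partial>seg 0 pi)"
      unfolding through_def
    proof (rule nn_integral_cong_AE)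
      show "AE r in seg 0 pi. ennreal (sin r) * (\<integral>\<^sup>+s. of_bool (s \<le> r) * ?W (R *v zeta (- s)) (R *v zeta (r - s)) \<partial>seg 0 pi)
        = ennreal (sin r) * (ennreal r * of_bool (r \<le> t))"
        using AE_seg[of 0 pi]
      proof eventually_elim
        case (elim r)
        have "?W (R *v zeta (- s)) (R *v zeta (r - s)) = of_bool (r \<le> t)" for s
          using wz[OF R elim, of "- s"] by (simp only: uminus_add_conv_diff)
        then have "(\<integral>\<^sup>+s. of_bool (s \<le> r) * ?W (R *v zeta (- s)) (R *v zeta (r - s)) \<partial>seg 0 pi)
            = (\<integral>\<^sup>+s. of_bool (s \<le> r) * of_bool (r \<le> t) \<partial>seg 0 pi)"
          by (simp only:)
        also have "\<dots> = (\<integral>\<^sup>+s. of_bool (s \<le> r) \<partial>seg 0 pi) * of_bool (r \<le> t)"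
          by (rule nn_integral_multc) measurable
        also have "(\<integral>\<^sup>+s. of_bool (s \<le> r) \<partial>seg 0 pi) = ennreal r"
          using elim by (intro nn_integral_of_bool_le) auto
        finally show ?case by simp
      qed
    qed
    also have "\<dots> = ennreal (psi t)"
      by (rule nn_integral_cap[OF t])
    finally show ?thesis .
  qed
  have "ennreal (Cr w) = ennreal (1 / (32 * pi\<^sup>2)) * (\<integral>\<^sup>+R. \<integral>\<^sup>+p. ennreal \<bar>sin p\<bar> * (through ?W R * through ?W (R ** rotx p)) \<partial>circ \<partial>haar)"
    unfolding Cr_nn_integral(1)[OF w] by (rule crossing_formula) measurable
  also have "(\<integral>\<^sup>+R. \<integral>\<^sup>+p. ennreal \<bar>sin p\<bar> * (through ?W R * through ?W (R ** rotx p)) \<partial>circ \<partial>haar)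
      = (\<integral>\<^sup>+R. \<integral>\<^sup>+p. ennreal \<bar>sin p\<bar> * (ennreal (psi t) * ennreal (psi t)) \<partial>circ \<partial>haar)"
    by (rule nn_integral_haar_cong) (measurable, simp add: F rotation_matrix_mult rotation_matrix_rotx)
  also have "\<dots> = (\<integral>\<^sup>+p. ennreal \<bar>sin p\<bar> * (ennreal (psi t) * ennreal (psi t)) \<partial>circ)"
    by (rule nn_integral_haar_const)
  also have "\<dots> = 4 * (ennreal (psi t) * ennreal (psi t))"
    by (subst nn_integral_multc) (simp_all add: nn_integral_sin_circ)
  also have "ennreal (1 / (32 * pi\<^sup>2)) * \<dots> = ennreal (1 / (32 * pi\<^sup>2) * (4 * (psi t * psi t)))"
    using psi_nonneg[OF t] ennreal_mult[of "1 / (32 * pi\<^sup>2)" "4 * (psi t * psi t)"] ennreal_mult[of 4 "psi t * psi t"]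
    by (simp add: ennreal_mult)
  finally have "Cr w = 1 / (32 * pi\<^sup>2) * (4 * (psi t * psi t))"
    using Cr_nn_integral(2)[OF w] psi_nonneg[OF t] by (subst (asm) ennreal_inj) auto
  then show "Cr w = (psi t)\<^sup>2 / (8 * pi\<^sup>2)"
    by (simp add: power2_eq_square)
qed

theorem theorem2p1:
  shows "(\<forall>w t. sym_kernel w \<longrightarrow> 0 \<le> t \<longrightarrow> t \<le> pi \<longrightarrow> cos t = 1 - 2 * edge_density w \<longrightarrow>
            Cr w \<ge> (sin t - t * cos t)\<^sup>2 / (8 * pi\<^sup>2)) \<and>
         (\<forall>t. 0 \<le> t \<longrightarrow> t \<le> pi \<longrightarrow>
            (let w = (\<lambda>x y. of_bool (sph_dist x y \<le> t)) in
               sym_kernel w \<and> cos t = 1 - 2 * edge_density w \<and>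
               Cr w = (sin t - t * cos t)\<^sup>2 / (8 * pi\<^sup>2)))"
proof (intro conjI allI impI)
  fix w t
  assume w: "sym_kernel w" and t: "0 \<le> t" "t \<le> pi" and e: "cos t = 1 - 2 * edge_density w"
  show "Cr w \<ge> (sin t - t * cos t)\<^sup>2 / (8 * pi\<^sup>2)"
  \<comment> \<open>The tangent argument divides by the cube root of \<open>psi t\<close>, which is
    zero at \<open>t = 0\<close>; there the claimed bound is zero.\<close>
  proof (cases "t = 0")
    case True
    then show ?thesis
      using Cr_nn_integral(2)[OF w] by simp
  next
    case False
    then show ?thesis
      using psi_sq_le_Cr[OF w _ t(2) e] t by (simp add: psi_def)
  qed
next
  fix t :: real
  assume t: "0 \<le> t" "t \<le> pi"
  then show "let w = (\<lambda>x y. of_bool (sph_dist x y \<le> t)) in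
      sym_kernel w \<and> cos t = 1 - 2 * edge_density w \<and> Cr w = (sin t - t * cos t)\<^sup>2 / (8 * pi\<^sup>2)"
    using sym_kernel_cap[OF t] cap_extremal[OF t] by (simp add: psi_def)
qed

end
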